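(* Let $H$ be a quantum subgroup of a compact quantum group $G$, given by a surjective morphism $\theta:C(G)\to C(H)$ of Woronowicz Hopf $C^*$-algebras. Let $h_H$ and $h_G$ be the Haar states on $C(H)$ and $C(G)$, let $\Phi_G$ be the coproduct of $C(G)$, let $$C(H\backslash G)=\{a\in C(G):(\theta\otimes1)\Phi_G(a)=1\otimes a\},$$ and let $\alpha=\Phi_G|_{C(H\backslash G)}:C(H\backslash G)\to C(H\backslash G)\otimes C(G)$ be the natural action of $G$ on $C(H\backslash G)$. Then: (1) the action $\alpha$ of $G$ on $C(H\backslash G)$ is ergodic; (2) $C(H\backslash G)$ has a unique $\alpha$-invariant state $\omega$, satisfying $$h_G(a)=\omega\big((h_H\theta\otimes1)\Phi_G(a)\big),\qquad a\in C(G).$$ Namely, $\omega$ is the restriction of $h_G$ to $C(H\backslash G)$.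
   Context: A compact quantum group $G$ is given by a full Woronowicz Hopf $C^*$-algebra $A=C(G)$: a unital $C^*$-algebra with coproduct $\Phi$ and canonical dense Hopf $*$-subalgebra $\mathcal{A}$ (spanned by coefficients of finite-dimensional unitary representations), $A$ being the enveloping $C^*$-algebra of $\mathcal{A}$. A morphism of Woronowicz Hopf $C^*$-algebras is a unital $*$-homomorphism intertwining the coproducts. The Haar state $h$ on $A$ is the unique state with $(\mathrm{id}\otimes h)\Phi(a)=h(a)1=(h\otimes\mathrm{id})\Phi(a)$. The map $(h_H\theta\otimes1)\Phi_G$ is a norm-one projection of $C(G)$ onto $C(H\backslash G)$. An action of $A$ on a $C^*$-algebra $B$ is a unital $*$-homomorphism $\alpha:B\to B\otimes A$ with $(\mathrm{id}\otimes\Phi)\alpha=(\alpha\otimes\mathrm{id})\alpha$, $(\mathrm{id}\otimes\epsilon)\alpha=\mathrm{id}$ ($\epsilon$ the counit), and $\alpha(\mathcal{B})\subseteq\mathcal{B}\otimes\mathcal{A}$ for some dense $*$-subalgebra $\mathcal{B}$. It is ergodic if $\alpha(b)=b\otimes1$ only for scalar $b$. A state $\phi$ on $B$ is $\alpha$-invariant if $(\phi\otimes\mathrm{id})\alpha(b)=\phi(b)1$ for all $b\in B$. *)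

theory Defs
  imports "HOL-Analysis.Analysis"
begin

subsection \<open>Unital C*-algebras and states\<close>

text \<open>Completeness is added only in \<open>cstar_algebra\<close>, so that algebraic tensor products are covered
  by the first class. The zero algebra is admitted; it carries no state.\<close>

class scaleC =
  fixes scaleC :: "complex \<Rightarrow> 'a \<Rightarrow> 'a"  (infixr \<open>*\<^sub>C\<close> 75)

class adj =
  fixes adj :: "'a \<Rightarrow> 'a"

class pre_cstar_algebra = real_normed_algebra + monoid_mult + scaleC + adj +
  assumes scaleC_of_real: "complex_of_real r *\<^sub>C x = r *\<^sub>R x"
    and scaleC_add_right: "c *\<^sub>C (x + y) = c *\<^sub>C x + c *\<^sub>C y"
    and scaleC_add_left: "(c + d) *\<^sub>C x = c *\<^sub>C x + d *\<^sub>C x"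
    and scaleC_scaleC: "c *\<^sub>C d *\<^sub>C x = (c * d) *\<^sub>C x"
    and scaleC_mult_left: "(c *\<^sub>C x) * y = c *\<^sub>C (x * y)"
    and scaleC_mult_right: "x * (c *\<^sub>C y) = c *\<^sub>C (x * y)"
    and norm_scaleC: "norm (c *\<^sub>C x) = cmod c * norm x"
    and adj_add: "adj (x + y) = adj x + adj y"
    and adj_scaleC: "adj (c *\<^sub>C x) = cnj c *\<^sub>C adj x"
    and adj_mult: "adj (x * y) = adj y * adj x"
    and adj_adj [simp]: "adj (adj x) = x"
    and cstar_identity: "norm (adj x * x) = (norm x)\<^sup>2"

class cstar_algebra = pre_cstar_algebra + banach

instantiation complex :: cstar_algebra
begin

definition scaleC_complex :: "complex \<Rightarrow> complex \<Rightarrow> complex"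
  where "scaleC_complex c z = c * z"

definition adj_complex :: "complex \<Rightarrow> complex"
  where "adj_complex z = cnj z"

instance
  by intro_classes
    (simp_all add: scaleC_complex_def adj_complex_def algebra_simps scaleR_conv_of_real
      norm_mult power2_eq_square)

end

lemma scaleC_one [simp]: "1 *\<^sub>C x = (x :: 'a::pre_cstar_algebra)"
  using scaleC_of_real[of 1 x] by simp

lemma scaleC_zero_left [simp]: "0 *\<^sub>C x = (0 :: 'a::pre_cstar_algebra)"
  using scaleC_of_real[of 0 x] by simp

lemma adj_one [simp]: "adj 1 = (1 :: 'a::pre_cstar_algebra)"
  by (metis adj_adj adj_mult mult.right_neutral)

lemma norm_adj [simp]: "norm (adj x) = norm (x :: 'a::pre_cstar_algebra)"
proof -
  have *: "norm y \<le> norm (adj y)" for y :: 'a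
  proof (cases "norm y = 0")
    case False
    have "norm y * norm y \<le> norm (adj y) * norm y"
      using norm_mult_ineq[of "adj y" y] by (simp add: cstar_identity power2_eq_square)
    then show ?thesis using False by simp
  qed simp
  from *[of x] *[of "adj x"] show ?thesis by simp
qed

definition bounded_clinear_on ::
    "'a::pre_cstar_algebra set \<Rightarrow> ('a \<Rightarrow> 'b::pre_cstar_algebra) \<Rightarrow> bool"
  where "bounded_clinear_on S f \<longleftrightarrow>
    (\<forall>x\<in>S. \<forall>y\<in>S. f (x + y) = f x + f y) \<and>
    (\<forall>c. \<forall>x\<in>S. f (c *\<^sub>C x) = c *\<^sub>C f x) \<and>
    (\<exists>K. \<forall>x\<in>S. norm (f x) \<le> K * norm x)"

text \<open>Continuity of positive functionals is automatic; it is included for convenience.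
  For a positive functional on a unital C*-algebra, norm one means value one at the unit.\<close>

definition state_on :: "'a::pre_cstar_algebra set \<Rightarrow> ('a \<Rightarrow> complex) \<Rightarrow> bool"
  where "state_on S \<phi> \<longleftrightarrow> bounded_clinear_on S \<phi> \<and>
    (\<forall>x\<in>S. Re (\<phi> (adj x * x)) \<ge> 0 \<and> Im (\<phi> (adj x * x)) = 0) \<and> \<phi> 1 = 1"

abbreviation state :: "('a::pre_cstar_algebra \<Rightarrow> complex) \<Rightarrow> bool"
  where "state \<equiv> state_on UNIV"

subsection \<open>Positive functionals\<close>

lemma cauchy_schwarz_aux:
  fixes p q :: real and z :: complex
  assumes *: "\<And>c. 0 \<le> p + 2 * Re (c * z) + (cmod c)\<^sup>2 * q" and "0 \<le> q"
  shows "(cmod z)\<^sup>2 \<le> p * q"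
proof -
  have r: "Re (complex_of_real a * cnj z * z) = a * (cmod z)\<^sup>2" for a
  proof -
    have "complex_of_real a * cnj z * z = complex_of_real (a * (cmod z)\<^sup>2)"
      unfolding of_real_mult complex_norm_square by (simp add: mult_ac)
    then show ?thesis by (simp only: Re_complex_of_real)
  qed
  show ?thesis
  proof (cases "q = 0")
    case True
    have "0 \<le> p - 2 * t * (cmod z)\<^sup>2" for t :: real
      using *[of "complex_of_real (- t) * cnj z"] True r[of "- t"] by simp
    note t = this[of "(p + 1) / (cmod z)\<^sup>2"]
    have "z = 0"
    proof (rule ccontr)
      assume "z \<noteq> 0"
      then have "2 * ((p + 1) / (cmod z)\<^sup>2) * (cmod z)\<^sup>2 = 2 * (p + 1)" by simp
      with t *[of 0] True show False by simp
    qed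
    then show ?thesis using True by simp
  next
    case False
    with assms(2) have q: "q > 0" by simp
    have "0 \<le> p + 2 * Re (complex_of_real (- 1 / q) * cnj z * z)
        + (cmod (complex_of_real (- 1 / q) * cnj z))\<^sup>2 * q"
      by (rule *)
    also have "(cmod (complex_of_real (- 1 / q) * cnj z))\<^sup>2 = (cmod z)\<^sup>2 / q\<^sup>2"
      by (simp add: norm_mult norm_divide power_mult_distrib power_divide)
    finally have "0 \<le> p - (cmod z)\<^sup>2 / q" using q
      unfolding r by (simp add: power2_eq_square field_simps)
    then show ?thesis using q by (simp add: field_simps)
  qed
qed

lemma positive_functional_hermitian:
  fixes f :: "'a::pre_cstar_algebra \<Rightarrow> complex"
  assumes add: "\<And>x y. f (x + y) = f x + f y" and sc: "\<And>c x. f (c *\<^sub>C x) = c * f x"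
    and pos: "\<And>x. Im (f (adj x * x)) = 0"
  shows "f (adj x * y) = cnj (f (adj y * x))"
proof -
  have e: "f (adj (x + c *\<^sub>C y) * (x + c *\<^sub>C y)) =
     f (adj x * x) + c * f (adj x * y) + cnj c * f (adj y * x)
       + cnj c * c * f (adj y * y)" for c
    by (simp add: adj_add adj_scaleC algebra_simps add sc scaleC_mult_left scaleC_mult_right)
  have 1: "Im (f (adj x * y)) + Im (f (adj y * x)) = 0"
    using pos[of "x + 1 *\<^sub>C y"] unfolding e[of 1] using pos[of x] pos[of y] by simp
  have 2: "Re (f (adj x * y)) - Re (f (adj y * x)) = 0"
    using pos[of "x + \<i> *\<^sub>C y"] unfolding e[of "\<i>"] using pos[of x] pos[of y] by simp
  show ?thesis using 1 2 by (simp add: complex_eq_iff)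
qed

lemma positive_functional_cauchy_schwarz:
  fixes f :: "'a::pre_cstar_algebra \<Rightarrow> complex"
  assumes add: "\<And>x y. f (x + y) = f x + f y" and sc: "\<And>c x. f (c *\<^sub>C x) = c * f x"
    and pos: "\<And>x. Im (f (adj x * x)) = 0" "\<And>x. Re (f (adj x * x)) \<ge> 0"
  shows "(cmod (f (adj x * y)))\<^sup>2 \<le> Re (f (adj x * x)) * Re (f (adj y * y))"
proof (rule cauchy_schwarz_aux)
  fix c
  have e: "f (adj (x + c *\<^sub>C y) * (x + c *\<^sub>C y)) =
     f (adj x * x) + c * f (adj x * y) + cnj c * f (adj y * x)
       + cnj c * c * f (adj y * y)"
    by (simp add: adj_add adj_scaleC algebra_simps add sc scaleC_mult_left scaleC_mult_right)
  have h: "f (adj y * x) = cnj (f (adj x * y))"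
    by (rule positive_functional_hermitian) (use assms in auto)
  have "cnj c * c = complex_of_real ((cmod c)\<^sup>2)"
    by (metis complex_norm_square mult.commute)
  with e h have "Re (f (adj (x + c *\<^sub>C y) * (x + c *\<^sub>C y))) =
     Re (f (adj x * x)) + 2 * Re (c * f (adj x * y)) + (cmod c)\<^sup>2 * Re (f (adj y * y))"
    by simp
  with pos(2)[of "x + c *\<^sub>C y"]
  show "0 \<le> Re (f (adj x * x)) + 2 * Re (c * f (adj x * y)) + (cmod c)\<^sup>2 * Re (f (adj y * y))"
    by simp
qed (rule pos)

lemma positive_functional_bound:
  fixes f :: "'a::pre_cstar_algebra \<Rightarrow> complex"
  assumes add: "\<And>x y. f (x + y) = f x + f y" and sc: "\<And>c x. f (c *\<^sub>C x) = c * f x"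
    and pos: "\<And>x. Im (f (adj x * x)) = 0" "\<And>x. Re (f (adj x * x)) \<ge> 0"
    and bdd: "\<And>x. cmod (f x) \<le> C * norm x"
  shows "Re (f (adj z * z)) \<le> (norm z)\<^sup>2 * Re (f 1)"
proof -
  have cs: "(cmod (f y))\<^sup>2 \<le> Re (f 1) * Re (f (adj y * y))" for y
    using positive_functional_cauchy_schwarz[of f 1 y] add sc pos by simp
  have F: "0 \<le> Re (f 1)" using pos(2)[of 1] by simp
  define N where "N = (norm z)\<^sup>2"
  define y where "y n = (adj z * z) ^ (2 ^ n)" for n
  have y0: "y 0 = adj z * z" by (simp add: y_def)
  have ySuc: "y (Suc n) = y n * y n" for n
    by (simp add: y_def mult_2 power_add)
  have ya: "adj (y n) = y n" for n
    by (induction n) (simp_all add: y0 ySuc adj_mult)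
  have yn: "norm (y n) = N ^ (2 ^ n)" for n
  proof (induction n)
    case (Suc n)
    then show ?case using cstar_identity[of "y n"]
      by (simp add: ySuc ya power2_eq_square mult_2 power_add)
  qed (simp add: y0 N_def cstar_identity)
  show ?thesis
  proof (rule ccontr)
    assume "\<not> ?thesis"
    then have gt: "N * Re (f 1) < Re (f (y 0))" by (simp add: N_def y0)
    have N0: "0 \<le> N" by (simp add: N_def)
    have F0: "Re (f 1) > 0"
    proof (rule ccontr)
      assume "\<not> ?thesis"
      with F have "Re (f 1) = 0" by simp
      with cs[of "y 0"] have "f (y 0) = 0" by simp
      with gt \<open>Re (f 1) = 0\<close> show False by simp
    qed
    have Npos: "N > 0"
    proof (rule ccontr)
      assume "\<not> ?thesis"
      with N0 have "N = 0" by simp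
      then have "z = 0" by (simp add: N_def)
      then have "y 0 = 0" by (simp add: y0)
      with gt bdd[of "y 0"] \<open>N = 0\<close> show False by simp
    qed
    define r where "r = Re (f (y 0)) / (N * Re (f 1))"
    have r1: "r > 1" using gt F0 Npos by (simp add: r_def field_simps)
    have key: "r ^ (2 ^ n) * (N ^ (2 ^ n) * Re (f 1)) \<le> Re (f (y n))" for n
    proof (induction n)
      case 0
      then show ?case using F0 Npos by (simp add: r_def)
    next
      case (Suc n)
      let ?w = "r ^ (2 ^ n) * (N ^ (2 ^ n) * Re (f 1))"
      have "0 \<le> ?w" using r1 Npos F0 by simp
      then have "?w\<^sup>2 \<le> (Re (f (y n)))\<^sup>2" using Suc by (intro power_mono)
      also have "\<dots> \<le> (cmod (f (y n)))\<^sup>2"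
        by (metis abs_Re_le_cmod abs_ge_zero power2_abs power_mono)
      also have "\<dots> \<le> Re (f 1) * Re (f (y (Suc n)))"
        using cs[of "y n"] by (simp add: ya ySuc)
      finally have "Re (f 1) * (r ^ (2 ^ Suc n) * (N ^ (2 ^ Suc n) * Re (f 1)))
          \<le> Re (f 1) * Re (f (y (Suc n)))"
        by (simp add: power2_eq_square mult_2 power_add mult_ac)
      then show ?case using F0 by simp
    qed
    have bd: "r ^ (2 ^ n) \<le> C / Re (f 1)" for n
    proof -
      have "r ^ (2 ^ n) * Re (f 1) * N ^ (2 ^ n) \<le> C * N ^ (2 ^ n)"
        using key[of n] complex_Re_le_cmod[of "f (y n)"] bdd[of "y n"] yn[of n]
        by (simp add: mult_ac)
      then have "r ^ (2 ^ n) * Re (f 1) \<le> C" using Npos by simp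
      then show ?thesis using F0 by (simp add: field_simps)
    qed
    obtain m where m: "C / Re (f 1) < r ^ m" using real_arch_pow[OF r1] by blast
    have "r ^ m \<le> r ^ (2 ^ m)" using r1
      by (intro power_increasing) (simp_all add: less_imp_le)
    with m bd[of m] show False by simp
  qed
qed

subsection \<open>Entrywise products of positive semidefinite matrices\<close>

definition psd_on :: "'i set \<Rightarrow> ('i \<Rightarrow> 'i \<Rightarrow> complex) \<Rightarrow> bool"
  where "psd_on I M \<longleftrightarrow> (\<forall>i\<in>I. \<forall>j\<in>I. M j i = cnj (M i j)) \<and>
    (\<forall>c. 0 \<le> Re (\<Sum>i\<in>I. \<Sum>j\<in>I. cnj (c i) * c j * M i j))"

lemma psd_on_diag:
  assumes "psd_on I M" "finite I" "k \<in> I"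
  shows "0 \<le> Re (M k k)" "Im (M k k) = 0"
proof -
  define c where "c i = (if i = k then 1 else 0 :: complex)" for i
  have "(\<Sum>i\<in>I. \<Sum>j\<in>I. cnj (c i) * c j * M i j)
      = (\<Sum>i\<in>I. if i = k then (\<Sum>j\<in>I. if j = k then M i j else 0) else 0)"
    by (intro sum.cong refl) (auto simp: c_def intro!: sum.cong)
  also have "\<dots> = M k k" using assms by simp
  finally have eq: "(\<Sum>i\<in>I. \<Sum>j\<in>I. cnj (c i) * c j * M i j) = M k k" .
  have "0 \<le> Re (\<Sum>i\<in>I. \<Sum>j\<in>I. cnj (c i) * c j * M i j)"
    using assms(1) unfolding psd_on_def by blast
  then show "0 \<le> Re (M k k)" unfolding eq .
  have "M k k = cnj (M k k)" using assms unfolding psd_on_def by blast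
  from arg_cong[OF this, of Im] show "Im (M k k) = 0" by simp
qed

lemma psd_on_subset: "psd_on (insert k I) M \<Longrightarrow> finite I \<Longrightarrow> k \<notin> I \<Longrightarrow> psd_on I M"
  unfolding psd_on_def
proof (intro conjI allI, blast)
  fix c :: "'a \<Rightarrow> complex"
  assume "(\<forall>i\<in>insert k I. \<forall>j\<in>insert k I. M j i = cnj (M i j)) \<and>
    (\<forall>c. 0 \<le> Re (\<Sum>i\<in>insert k I. \<Sum>j\<in>insert k I. cnj (c i) * c j * M i j))"
    and I: "finite I" "k \<notin> I"
  then have "0 \<le> Re (\<Sum>i\<in>insert k I. \<Sum>j\<in>insert k I. cnj ((c(k := 0)) i) * (c(k := 0)) j * M i j)"
    by blast
  also have "(\<Sum>i\<in>insert k I. \<Sum>j\<in>insert k I. cnj ((c(k := 0)) i) * (c(k := 0)) j * M i j)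
     = (\<Sum>i\<in>I. \<Sum>j\<in>I. cnj (c i) * c j * M i j)"
    using I by (auto intro!: sum.cong)
  finally show "0 \<le> Re (\<Sum>i\<in>I. \<Sum>j\<in>I. cnj (c i) * c j * M i j)" .
qed

lemma psd_on_expand:
  assumes "finite I" "k \<notin> I" and h: "\<forall>i\<in>insert k I. \<forall>j\<in>insert k I. M j i = cnj (M i j)"
  shows "(\<Sum>i\<in>insert k I. \<Sum>j\<in>insert k I. M i j * (N i j :: complex)) =
    M k k * N k k + (\<Sum>j\<in>I. M k j * N k j) + (\<Sum>i\<in>I. M i k * N i k) + (\<Sum>i\<in>I. \<Sum>j\<in>I. M i j * N i j)"
  using assms(1,2) by (simp add: sum.distrib algebra_simps)

lemma psd_on_cross:
  assumes M: "psd_on (insert k I) M" and I: "finite I" "k \<notin> I" and z: "Re (M k k) = 0" and i: "i \<in> I"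
  shows "M k i = 0"
proof -
  have kk: "M k k = 0" using psd_on_diag[OF M] z I by (simp add: complex_eq_iff)
  have ik: "i \<noteq> k" using i I by blast
  have "(cmod (M k i))\<^sup>2 \<le> Re (M i i) * Re (M k k)"
  proof (rule cauchy_schwarz_aux)
    fix d :: complex
    define c where "c j = (if j = i then 1 else if j = k then cnj d else 0)" for j
    have s: "(\<Sum>j\<in>insert k I. c j * f j) = f i + cnj d * f k"
      "(\<Sum>j\<in>insert k I. cnj (c j) * f j) = f i + d * f k" for f :: "'a \<Rightarrow> complex"
    proof -
      have "c j * f j = (if j = i then f j else 0)" "cnj (c j) * f j = (if j = i then f j else 0)"
        if "j \<in> I" for j using that I by (auto simp: c_def)
      note * = sum.cong[OF refl this(1), of I] sum.cong[OF refl this(2), of I]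
      have ck: "c k = cnj d" using ik by (simp add: c_def)
      have "(\<Sum>j\<in>insert k I. c j * f j) = cnj d * f k + (\<Sum>j\<in>I. if j = i then f j else 0)"
        using I by (simp add: * ck)
      then show "(\<Sum>j\<in>insert k I. c j * f j) = f i + cnj d * f k" using i I by simp
      have "(\<Sum>j\<in>insert k I. cnj (c j) * f j) = d * f k + (\<Sum>j\<in>I. if j = i then f j else 0)"
        using I by (simp add: * ck)
      then show "(\<Sum>j\<in>insert k I. cnj (c j) * f j) = f i + d * f k" using i I by simp
    qed
    have "(\<Sum>a\<in>insert k I. \<Sum>b\<in>insert k I. cnj (c a) * c b * M a b)
       = (\<Sum>a\<in>insert k I. cnj (c a) * (\<Sum>b\<in>insert k I. c b * M a b))"
      by (simp only: sum_distrib_left mult.assoc)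
    also have "\<dots> = M i i + cnj d * M i k + d * (M k i + cnj d * M k k)"
      unfolding s by (simp add: algebra_simps)
    finally have e: "(\<Sum>a\<in>insert k I. \<Sum>b\<in>insert k I. cnj (c a) * c b * M a b)
      = M i i + cnj d * M i k + d * M k i" by (simp add: kk)
    have "M i k = cnj (M k i)" using M i unfolding psd_on_def by blast
    then have "Re (M i i + cnj d * M i k + d * M k i) = Re (M i i) + 2 * Re (d * M k i)"
      by simp
    moreover have "0 \<le> Re (\<Sum>a\<in>insert k I. \<Sum>b\<in>insert k I. cnj (c a) * c b * M a b)"
      using M unfolding psd_on_def by blast
    ultimately show "0 \<le> Re (M i i) + 2 * Re (d * M k i) + (cmod d)\<^sup>2 * Re (M k k)"
      unfolding e by (simp add: kk)
  qed (simp add: kk)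
  then show ?thesis by (simp add: kk)
qed

lemma schur_product:
  assumes "finite I" "psd_on I M" "psd_on I N"
  shows "0 \<le> Re (\<Sum>i\<in>I. \<Sum>j\<in>I. M i j * N i j)"
  using assms
proof (induction I arbitrary: M rule: finite_induct)
  case (insert k I)
  note M = insert.prems(1) and N = insert.prems(2) and I = insert.hyps
  have hM: "\<forall>i\<in>insert k I. \<forall>j\<in>insert k I. M j i = cnj (M i j)"
    using M unfolding psd_on_def by blast
  have hk: "cnj (M k i) = M i k" if "i \<in> insert k I" for i
    using hM that by (metis insertI1)
  have NI: "psd_on I N" using psd_on_subset[OF N] I by simp
  show ?case
  proof (cases "Re (M k k) = 0")
    case True
    have kk: "M k k = 0" using psd_on_diag[OF M] True I by (simp add: complex_eq_iff)
    have ki: "M k i = 0" if "i \<in> I" for i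
      using psd_on_cross[OF M I True that] .
    have ik: "M i k = 0" if "i \<in> I" for i
      using ki[OF that] hM that by (metis complex_cnj_zero insertCI)
    have "(\<Sum>i\<in>insert k I. \<Sum>j\<in>insert k I. M i j * N i j) = (\<Sum>i\<in>I. \<Sum>j\<in>I. M i j * N i j)"
      unfolding psd_on_expand[OF I hM] by (simp add: kk ki ik)
    then show ?thesis using insert.IH[OF psd_on_subset[OF M I] NI] by simp
  next
    case False
    define m where "m = Re (M k k)"
    have m: "m > 0" "M k k = complex_of_real m" "M k k \<noteq> 0"
      using psd_on_diag[OF M, of k] I False by (auto simp: complex_eq_iff m_def)
    define M' where "M' i j = M i j - M i k * M k j / M k k" for i j
    have "psd_on I M'"
      unfolding psd_on_def
    proof (intro conjI allI ballI)
      fix i j assume "i \<in> I" "j \<in> I"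
      then have h: "M j i = cnj (M i j)" "M j k = cnj (M k j)" "M k i = cnj (M i k)"
        using hM by blast+
      show "M' j i = cnj (M' i j)"
        unfolding M'_def h m(2) by (simp add: mult.commute)
    next
      fix c :: "'a \<Rightarrow> complex"
      define s where "s = (\<Sum>j\<in>I. c j * M k j)"
      have s': "(\<Sum>i\<in>I. cnj (c i) * M i k) = cnj s"
        unfolding s_def cnj_sum by (intro sum.cong refl) (simp add: hk)
      define e where "e = c (k := - s / M k k)"
      have ek: "e k = - s / M k k" "cnj (e k) = - cnj s / M k k"
        unfolding e_def by (simp_all add: m(2))
      have ei: "i \<in> I \<Longrightarrow> e i = c i" for i using I by (auto simp: e_def)
      have "(\<Sum>i\<in>insert k I. \<Sum>j\<in>insert k I. cnj (e i) * e j * M i j)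
        = cnj (e k) * (e k * M k k + s) + e k * cnj s + (\<Sum>i\<in>I. \<Sum>j\<in>I. cnj (c i) * c j * M i j)"
      proof -
        have "(\<Sum>i\<in>insert k I. \<Sum>j\<in>insert k I. cnj (e i) * e j * M i j)
          = cnj (e k) * e k * M k k + (\<Sum>j\<in>I. cnj (e k) * e j * M k j)
            + (\<Sum>i\<in>I. cnj (e i) * e k * M i k) + (\<Sum>i\<in>I. \<Sum>j\<in>I. cnj (e i) * e j * M i j)"
          using I by (simp add: sum.distrib)
        also have "(\<Sum>j\<in>I. cnj (e k) * e j * M k j) = cnj (e k) * s"
          by (simp add: s_def sum_distrib_left ei mult.assoc)
        also have "(\<Sum>i\<in>I. cnj (e i) * e k * M i k) = e k * cnj s"
          unfolding s'[symmetric] by (simp add: sum_distrib_left ei mult_ac)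
        also have "(\<Sum>i\<in>I. \<Sum>j\<in>I. cnj (e i) * e j * M i j) = (\<Sum>i\<in>I. \<Sum>j\<in>I. cnj (c i) * c j * M i j)"
          by (simp add: ei)
        finally show ?thesis by (simp add: distrib_left)
      qed
      also have "\<dots> = (\<Sum>i\<in>I. \<Sum>j\<in>I. cnj (c i) * c j * M i j) - cnj s * s / M k k"
        using m(3) by (simp add: ek mult.commute)
      also have "cnj s * s / M k k = (\<Sum>i\<in>I. \<Sum>j\<in>I. cnj (c i) * c j * (M i k * M k j / M k k))"
        unfolding s'[symmetric] unfolding s_def sum_product sum_divide_distrib
        by (simp add: mult_ac)
      also have "(\<Sum>i\<in>I. \<Sum>j\<in>I. cnj (c i) * c j * M i j) - \<dots>
          = (\<Sum>i\<in>I. \<Sum>j\<in>I. cnj (c i) * c j * M' i j)"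
        by (simp add: M'_def sum_subtractf right_diff_distrib)
      finally have eq: "(\<Sum>i\<in>insert k I. \<Sum>j\<in>insert k I. cnj (e i) * e j * M i j)
        = (\<Sum>i\<in>I. \<Sum>j\<in>I. cnj (c i) * c j * M' i j)" .
      have "0 \<le> Re (\<Sum>i\<in>insert k I. \<Sum>j\<in>insert k I. cnj (e i) * e j * M i j)"
        using M unfolding psd_on_def by blast
      then show "0 \<le> Re (\<Sum>i\<in>I. \<Sum>j\<in>I. cnj (c i) * c j * M' i j)"
        unfolding eq .
    qed
    then have 1: "0 \<le> Re (\<Sum>i\<in>I. \<Sum>j\<in>I. M' i j * N i j)"
      using insert.IH NI by blast
    have "0 \<le> Re (\<Sum>i\<in>insert k I. \<Sum>j\<in>insert k I. cnj (M k i) * M k j * N i j)"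
      using N unfolding psd_on_def by blast
    also have "(\<Sum>i\<in>insert k I. \<Sum>j\<in>insert k I. cnj (M k i) * M k j * N i j)
       = (\<Sum>i\<in>insert k I. \<Sum>j\<in>insert k I. M i k * M k j * N i j)"
      by (intro sum.cong refl) (simp only: hk)
    finally have 2: "0 \<le> Re (\<Sum>i\<in>insert k I. \<Sum>j\<in>insert k I. M i k * M k j * N i j)" .
    have "(\<Sum>i\<in>insert k I. \<Sum>j\<in>insert k I. M i j * N i j) =
      (\<Sum>i\<in>insert k I. \<Sum>j\<in>insert k I. M' i j * N i j)
       + (\<Sum>i\<in>insert k I. \<Sum>j\<in>insert k I. M i k * M k j * N i j) / M k k"
      unfolding sum_divide_distrib sum.distrib[symmetric]
      by (intro sum.cong refl) (simp add: M'_def algebra_simps)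
    also have "(\<Sum>i\<in>insert k I. \<Sum>j\<in>insert k I. M' i j * N i j) = (\<Sum>i\<in>I. \<Sum>j\<in>I. M' i j * N i j)"
      using I m(3) by (simp add: M'_def)
    finally show ?thesis using 1 2 m(1) unfolding m(2) by simp
  qed
qed simp

subsection \<open>The algebraic tensor product with the spatial norm\<close>

text \<open>A finite list of pairs \<open>(a, b)\<close> stands for the sum of the elementary tensors \<open>a \<otimes> b\<close>.\<close>

definition lsum :: "('a \<Rightarrow> 'b \<Rightarrow> 'c::comm_monoid_add) \<Rightarrow> ('a \<times> 'b) list \<Rightarrow> 'c"
  where "lsum g t = (\<Sum>(a, b)\<leftarrow>t. g a b)"

definition lmult :: "('a::times \<times> 'b::times) list \<Rightarrow> ('a \<times> 'b) list \<Rightarrow> ('a \<times> 'b) list"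
  where "lmult s t = concat (map (\<lambda>(a, b). map (\<lambda>(c, d). (a * c, b * d)) t) s)"

definition lscale :: "complex \<Rightarrow> ('a::scaleC \<times> 'b) list \<Rightarrow> ('a \<times> 'b) list"
  where "lscale c t = map (\<lambda>(a, b). (c *\<^sub>C a, b)) t"

definition ladj :: "('a::adj \<times> 'b::adj) list \<Rightarrow> ('a \<times> 'b) list"
  where "ladj t = map (\<lambda>(a, b). (adj a, adj b)) t"

lemma lsum_simps [simp]:
  "lsum g [] = 0" "lsum g ((a, b) # t) = g a b + lsum g t"
  "lsum g (s @ t) = lsum g s + lsum g t"
  by (simp_all add: lsum_def)

lemma lsum_simps2 [simp]:
  "lsum g (lscale c t) = lsum (\<lambda>a b. g (c *\<^sub>C a) b) t"
  by (simp add: lsum_def lscale_def o_def case_prod_unfold)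

lemma lsum_simps3 [simp]: "lsum g (ladj t) = lsum (\<lambda>a b. g (adj a) (adj b)) t"
  by (simp add: lsum_def ladj_def o_def case_prod_unfold)

lemma lsum_lmult [simp]:
  "lsum g (lmult s t) = lsum (\<lambda>a b. lsum (\<lambda>c d. g (a * c) (b * d)) t) s"
proof (induction s)
  case (Cons x s)
  then show ?case
    by (cases x) (simp add: lmult_def, simp add: lsum_def o_def case_prod_unfold)
qed (simp add: lmult_def)

lemma lsum_add: "lsum (\<lambda>a b. f a b + g a b) t = lsum f t + lsum g t"
  by (induction t) (auto simp: algebra_simps)

lemma lsum_mult: "lsum (\<lambda>a b. c * f a b) t = c * (lsum f t :: complex)"
  by (induction t) (auto simp: algebra_simps)

lemma lsum_cnj: "lsum (\<lambda>a b. cnj (f a b)) t = cnj (lsum f t)"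
  by (induction t) auto

lemma lsum_swap: "lsum (\<lambda>a b. lsum (\<lambda>c d. g a b c d) t) s = lsum (\<lambda>c d. lsum (\<lambda>a b. g a b c d) s) t"
proof (induction s)
  case Nil
  show ?case by (induction t) auto
next
  case (Cons x s)
  then show ?case by (cases x) (simp add: lsum_add)
qed

lemma lsum_nth: "lsum g t = (\<Sum>i<length t. g (fst (t ! i)) (snd (t ! i)))"
  by (simp add: lsum_def sum_list_sum_nth case_prod_unfold atLeast0LessThan)

text \<open>The GNS form \<open>(\<phi> \<otimes> \<psi>)(s* t)\<close> of the product of two states.\<close>

definition gns :: "('a::pre_cstar_algebra \<Rightarrow> complex) \<Rightarrow> ('b::pre_cstar_algebra \<Rightarrow> complex) \<Rightarrow>
    ('a \<times> 'b) list \<Rightarrow> ('a \<times> 'b) list \<Rightarrow> complex"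
  where "gns \<phi> \<psi> s t = lsum (\<lambda>a b. \<phi> a * \<psi> b) (lmult (ladj s) t)"

lemma gns_append [simp]:
  "gns \<phi> \<psi> s (t @ u) = gns \<phi> \<psi> s t + gns \<phi> \<psi> s u"
  "gns \<phi> \<psi> (s @ t) u = gns \<phi> \<psi> s u + gns \<phi> \<psi> t u"
  by (simp_all add: gns_def lsum_add)

lemma gns_lmult: "gns \<phi> \<psi> s (lmult t u) = gns \<phi> \<psi> (lmult (ladj t) s) u"
  by (simp add: gns_def adj_mult mult.assoc) (rule lsum_swap)

lemma gns_lmult_assoc: "gns \<phi> \<psi> s (lmult (lmult t u) v) = gns \<phi> \<psi> s (lmult t (lmult u v))"
  by (simp add: gns_def mult.assoc)

locale state_pair =
  fixes \<phi> :: "'a::pre_cstar_algebra \<Rightarrow> complex" and \<psi> :: "'b::pre_cstar_algebra \<Rightarrow> complex"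
  assumes state1: "state \<phi>" and state2: "state \<psi>"
begin

lemma lin:
  "\<phi> (x + y) = \<phi> x + \<phi> y" "\<phi> (c *\<^sub>C x) = c * \<phi> x"
  "\<psi> (x' + y') = \<psi> x' + \<psi> y'" "\<psi> (c *\<^sub>C x') = c * \<psi> x'"
  using state1 state2 unfolding state_on_def bounded_clinear_on_def
  by (simp_all add: scaleC_complex_def)

lemma pos: "Im (\<phi> (adj x * x)) = 0" "0 \<le> Re (\<phi> (adj x * x))"
  "Im (\<psi> (adj y * y)) = 0" "0 \<le> Re (\<psi> (adj y * y))"
  using state1 state2 unfolding state_on_def by simp_all

lemma herm: "\<phi> (adj x * y) = cnj (\<phi> (adj y * x))" "\<psi> (adj x' * y') = cnj (\<psi> (adj y' * x'))"
  by (rule positive_functional_hermitian; simp add: lin pos)+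

lemma herm1: "\<phi> (adj x) = cnj (\<phi> x)" "\<psi> (adj y) = cnj (\<psi> y)"
  using herm(1)[of x 1] herm(2)[of y 1] by simp_all

lemma bound1: obtains K where "\<And>x. cmod (\<phi> x) \<le> K * norm x"
  using state1 unfolding state_on_def bounded_clinear_on_def by auto

lemma bound2: obtains K where "\<And>x. cmod (\<psi> x) \<le> K * norm x"
  using state2 unfolding state_on_def bounded_clinear_on_def by auto

lemma gns_lscale [simp]:
  "gns \<phi> \<psi> s (lscale c t) = c * gns \<phi> \<psi> s t"
  "gns \<phi> \<psi> (lscale c s) t = cnj c * gns \<phi> \<psi> s t"
  by (simp_all add: gns_def lin scaleC_mult_right scaleC_mult_left adj_scaleC lsum_mult mult.assoc)

lemma gns_sym: "gns \<phi> \<psi> s t = cnj (gns \<phi> \<psi> t s)"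
proof -
  have "cnj (gns \<phi> \<psi> t s) = lsum (\<lambda>a b. lsum (\<lambda>c d. \<phi> (adj c * a) * \<psi> (adj d * b)) s) t"
    by (simp add: gns_def lsum_cnj[symmetric] herm[symmetric])
  also have "\<dots> = gns \<phi> \<psi> s t" by (simp add: gns_def) (rule lsum_swap)
  finally show ?thesis by simp
qed

lemma psd:
  fixes I :: "nat set"
  shows "finite I \<Longrightarrow> psd_on I (\<lambda>i j. \<phi> (adj (x i) * x j))"
    "finite I \<Longrightarrow> psd_on I (\<lambda>i j. \<psi> (adj (y i) * y j))"
proof -
  have *: "psd_on I (\<lambda>i j. f (adj (z i) * z j))"
    if I: "finite I" and f: "\<And>x y. f (x + y) = f x + f y" "\<And>c x. f (c *\<^sub>C x) = c * f x"
      "\<And>x. 0 \<le> Re (f (adj x * x))" "\<And>x y. f (adj x * y) = cnj (f (adj y * x))"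
    for f :: "'c::pre_cstar_algebra \<Rightarrow> complex" and z :: "nat \<Rightarrow> 'c"
    unfolding psd_on_def
  proof (intro conjI allI ballI)
    fix c :: "nat \<Rightarrow> complex"
    have f0: "f 0 = 0" using f(2)[of 0 0] by simp
    have fs: "f (sum g J) = (\<Sum>j\<in>J. f (g j))" if "finite J" for g and J :: "nat set"
      using that by (induction J rule: finite_induct) (simp_all add: f0 f)
    have a0: "adj (0 :: 'c) = 0" using adj_scaleC[of 0 "0 :: 'c"] by simp
    have as: "adj (sum g J) = (\<Sum>j\<in>J. adj (g j) :: 'c)" if "finite J" for g and J :: "nat set"
      using that by (induction J rule: finite_induct) (simp_all add: a0 adj_add)
    have "(\<Sum>i\<in>I. \<Sum>j\<in>I. cnj (c i) * c j * f (adj (z i) * z j))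
       = f (adj (\<Sum>i\<in>I. c i *\<^sub>C z i) * (\<Sum>i\<in>I. c i *\<^sub>C z i))"
      using I by (simp add: as fs sum_product adj_scaleC scaleC_mult_left scaleC_mult_right
          scaleC_scaleC f(1,2) mult_ac)
    then show "0 \<le> Re (\<Sum>i\<in>I. \<Sum>j\<in>I. cnj (c i) * c j * f (adj (z i) * z j))"
      using f(3) by simp
  qed (rule f(4))
  show "finite I \<Longrightarrow> psd_on I (\<lambda>i j. \<phi> (adj (x i) * x j))"
    by (rule *) (simp, (simp add: lin), (simp add: lin), (simp add: pos), rule herm)
  show "finite I \<Longrightarrow> psd_on I (\<lambda>i j. \<psi> (adj (y i) * y j))"
    by (rule *) (simp, (simp add: lin), (simp add: lin), (simp add: pos), rule herm)
qed

lemma gns_pos: "0 \<le> Re (gns \<phi> \<psi> t t)" "Im (gns \<phi> \<psi> t t) = 0"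
proof -
  have "gns \<phi> \<psi> t t = lsum (\<lambda>a b. lsum (\<lambda>c d. \<phi> (adj a * c) * \<psi> (adj b * d)) t) t"
    by (simp add: gns_def)
  also have "\<dots> = (\<Sum>i<length t. \<Sum>j<length t.
      \<phi> (adj (fst (t ! i)) * fst (t ! j)) * \<psi> (adj (snd (t ! i)) * snd (t ! j)))"
    by (simp only: lsum_nth)
  also have "0 \<le> Re \<dots>"
    by (rule schur_product) (auto intro!: psd)
  finally show "0 \<le> Re (gns \<phi> \<psi> t t)" .
  from arg_cong[OF gns_sym[of t t], of Im] show "Im (gns \<phi> \<psi> t t) = 0" by simp
qed

lemma gns_expand: "Re (gns \<phi> \<psi> (s @ lscale c t) (s @ lscale c t)) =
    Re (gns \<phi> \<psi> s s) + 2 * Re (c * gns \<phi> \<psi> s t) + (cmod c)\<^sup>2 * Re (gns \<phi> \<psi> t t)"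
proof -
  have "gns \<phi> \<psi> t s = cnj (gns \<phi> \<psi> s t)" by (rule gns_sym)
  moreover have "(cmod c)\<^sup>2 * x = Im c * (Im c * x) + Re c * (Re c * x)" for x
    unfolding cmod_power2 by (simp add: power2_eq_square algebra_simps)
  ultimately show ?thesis
    using gns_pos by (simp add: algebra_simps)
qed

lemma gns_cs: "(cmod (gns \<phi> \<psi> s t))\<^sup>2 \<le> Re (gns \<phi> \<psi> s s) * Re (gns \<phi> \<psi> t t)"
proof (rule cauchy_schwarz_aux)
  show "0 \<le> Re (gns \<phi> \<psi> s s) + 2 * Re (c * gns \<phi> \<psi> s t) + (cmod c)\<^sup>2 * Re (gns \<phi> \<psi> t t)"
    for c
    unfolding gns_expand[symmetric] by (rule gns_pos)
qed (rule gns_pos)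

lemma gns_minkowski:
  "sqrt (Re (gns \<phi> \<psi> (s @ t) (s @ t))) \<le> sqrt (Re (gns \<phi> \<psi> s s)) + sqrt (Re (gns \<phi> \<psi> t t))"
proof (rule real_le_lsqrt)
  have "Re (gns \<phi> \<psi> s t) \<le> sqrt (Re (gns \<phi> \<psi> s s) * Re (gns \<phi> \<psi> t t))"
    using gns_cs[of s t] complex_Re_le_cmod[of "gns \<phi> \<psi> s t"]
    by (meson order_trans real_le_rsqrt)
  moreover have "Re (gns \<phi> \<psi> t s) = Re (gns \<phi> \<psi> s t)" by (subst gns_sym) simp
  ultimately show "Re (gns \<phi> \<psi> (s @ t) (s @ t))
      \<le> (sqrt (Re (gns \<phi> \<psi> s s)) + sqrt (Re (gns \<phi> \<psi> t t)))\<^sup>2"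
    using gns_pos by (simp add: power2_sum real_sqrt_mult)
qed (use gns_pos in simp)

end

lemma lmult_simps [simp]:
  "lmult [] v = []"
  "lmult (t @ u) v = lmult t v @ lmult u v"
  by (simp_all add: lmult_def)

lemma lmult_one [simp]:
  "lmult [(1, 1)] v = (v :: ('a::monoid_mult \<times> 'b::monoid_mult) list)"
  "lmult t [(1, 1)] = (t :: ('a::monoid_mult \<times> 'b::monoid_mult) list)"
proof -
  show "lmult t [(1, 1)] = t" by (induction t) (auto simp: lmult_def)
qed (simp add: lmult_def)

lemma lmult_lscale:
  "lmult (lscale c t) v = lscale c (lmult t (v :: ('a::pre_cstar_algebra \<times> 'b::times) list))"
  by (induction t) (auto simp: lmult_def lscale_def scaleC_mult_left)

lemma ladj_ladj [simp]: "ladj (ladj t) = (t :: ('a::pre_cstar_algebra \<times> 'b::pre_cstar_algebra) list)"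
  by (induction t) (auto simp: ladj_def)

lemma gns_nil [simp]: "gns \<phi> \<psi> s [] = 0" "gns \<phi> \<psi> [] s = 0"
  by (simp_all add: gns_def lmult_def ladj_def)
     (induction s; auto simp: lmult_def lsum_def ladj_def)

lemma gns_ladj: "gns \<phi> \<psi> s (lmult (ladj t) v) = gns \<phi> \<psi> (lmult t s) v"
  by (simp add: gns_lmult)

lemma gns_lmult_append:
  "gns \<phi> \<psi> s (lmult x (p @ q)) = gns \<phi> \<psi> s (lmult x p) + gns \<phi> \<psi> s (lmult x q)"
  by (simp add: gns_lmult)

lemma gns_lmult_assoc2:
  "gns \<phi> \<psi> s (lmult x (lmult (lmult y z) v)) = gns \<phi> \<psi> s (lmult x (lmult y (lmult z v)))"
  by (simp only: gns_lmult[of _ _ s x] gns_lmult_assoc)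

lemma (in state_pair) gns_lmult_lscale:
  "gns \<phi> \<psi> s (lmult x (lscale c p)) = c * gns \<phi> \<psi> s (lmult x p)"
  by (simp add: gns_lmult)

lemma (in state_pair) gns_zero_right:
  assumes "Re (gns \<phi> \<psi> t t) = 0"
  shows "gns \<phi> \<psi> s t = 0"
  using gns_cs[of s t] assms by simp

text \<open>The least such \<open>K\<close> is the supremum, over all pairs of states, of the operator norm of \<open>t\<close> in
  the tensor product \<open>\<pi>\<^sub>\<phi> \<otimes> \<pi>\<^sub>\<psi>\<close> of the GNS representations on the Hilbert space tensor product, in
  which the classes of the lists \<open>s\<close> are dense. This is the spatial (minimal) C*-norm.\<close>

definition op_bound :: "('a::pre_cstar_algebra \<times> 'b::pre_cstar_algebra) list \<Rightarrow> real \<Rightarrow> bool"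
  where "op_bound t K \<longleftrightarrow> 0 \<le> K \<and> (\<forall>\<phi> \<psi> s. state \<phi> \<longrightarrow> state \<psi> \<longrightarrow>
    Re (gns \<phi> \<psi> (lmult t s) (lmult t s)) \<le> K\<^sup>2 * Re (gns \<phi> \<psi> s s))"

definition spatial_norm :: "('a::pre_cstar_algebra \<times> 'b::pre_cstar_algebra) list \<Rightarrow> real"
  where "spatial_norm t = Inf {K. op_bound t K}"

lemma op_bound_sqrt:
  "op_bound t K \<longleftrightarrow> 0 \<le> K \<and> (\<forall>\<phi> \<psi> s. state \<phi> \<longrightarrow> state \<psi> \<longrightarrow>
    sqrt (Re (gns \<phi> \<psi> (lmult t s) (lmult t s))) \<le> K * sqrt (Re (gns \<phi> \<psi> s s)))"
proof -
  have "Re (gns \<phi> \<psi> (lmult t s) (lmult t s)) \<le> K\<^sup>2 * Re (gns \<phi> \<psi> s s) \<longleftrightarrow>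
      sqrt (Re (gns \<phi> \<psi> (lmult t s) (lmult t s))) \<le> K * sqrt (Re (gns \<phi> \<psi> s s))"
    if "0 \<le> K" for \<phi> \<psi> s
  proof -
    have "K * sqrt (Re (gns \<phi> \<psi> s s)) = sqrt (K\<^sup>2 * Re (gns \<phi> \<psi> s s))"
      using that by (simp add: real_sqrt_mult)
    then show ?thesis by simp
  qed
  then show ?thesis unfolding op_bound_def by blast
qed

lemma op_bound_append:
  assumes "op_bound t K" "op_bound u L"
  shows "op_bound (t @ u) (K + L)"
  unfolding op_bound_sqrt
proof (intro conjI allI impI)
  fix \<phi> :: "'a \<Rightarrow> complex" and \<psi> :: "'b \<Rightarrow> complex" and s
  assume st: "state \<phi>" "state \<psi>"
  interpret state_pair \<phi> \<psi> by standard (rule st)+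
  have "sqrt (Re (gns \<phi> \<psi> (lmult t s) (lmult t s))) \<le> K * sqrt (Re (gns \<phi> \<psi> s s))"
    "sqrt (Re (gns \<phi> \<psi> (lmult u s) (lmult u s))) \<le> L * sqrt (Re (gns \<phi> \<psi> s s))"
    using assms st unfolding op_bound_sqrt by blast+
  with gns_minkowski[of "lmult t s" "lmult u s"]
  show "sqrt (Re (gns \<phi> \<psi> (lmult (t @ u) s) (lmult (t @ u) s))) \<le> (K + L) * sqrt (Re (gns \<phi> \<psi> s s))"
    by (simp add: distrib_right)
next
  show "0 \<le> K + L" using assms unfolding op_bound_def by auto
qed

lemma gns_square_assoc:
  assumes "state \<phi>" "state \<psi>"
  shows "gns \<phi> \<psi> (lmult (lmult t u) s) (lmult (lmult t u) s) =
    gns \<phi> \<psi> (lmult t (lmult u s)) (lmult t (lmult u s))"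
proof -
  interpret state_pair \<phi> \<psi> by standard (rule assms)+
  have "gns \<phi> \<psi> (lmult (lmult t u) s) (lmult (lmult t u) s) =
      gns \<phi> \<psi> (lmult (lmult t u) s) (lmult t (lmult u s))"
    by (rule gns_lmult_assoc)
  also have "\<dots> = cnj (gns \<phi> \<psi> (lmult t (lmult u s)) (lmult (lmult t u) s))"
    by (rule gns_sym)
  also have "\<dots> = cnj (gns \<phi> \<psi> (lmult t (lmult u s)) (lmult t (lmult u s)))"
    by (simp only: gns_lmult_assoc)
  also have "\<dots> = gns \<phi> \<psi> (lmult t (lmult u s)) (lmult t (lmult u s))"
    by (rule gns_sym[symmetric])
  finally show ?thesis .
qed

lemma op_bound_lmult:
  assumes "op_bound t K" "op_bound u L"
  shows "op_bound (lmult t u) (K * L)"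
  unfolding op_bound_def
proof (intro conjI allI impI)
  fix \<phi> :: "'a \<Rightarrow> complex" and \<psi> :: "'b \<Rightarrow> complex" and s
  assume st: "state \<phi>" "state \<psi>"
  have "Re (gns \<phi> \<psi> (lmult t (lmult u s)) (lmult t (lmult u s)))
      \<le> K\<^sup>2 * Re (gns \<phi> \<psi> (lmult u s) (lmult u s))"
    using assms(1) st unfolding op_bound_def by blast
  also have "\<dots> \<le> K\<^sup>2 * (L\<^sup>2 * Re (gns \<phi> \<psi> s s))"
    using assms(2) st unfolding op_bound_def by (intro mult_left_mono) auto
  finally show "Re (gns \<phi> \<psi> (lmult (lmult t u) s) (lmult (lmult t u) s))
      \<le> (K * L)\<^sup>2 * Re (gns \<phi> \<psi> s s)"
    by (simp add: gns_square_assoc[OF st] power_mult_distrib mult.assoc)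
next
  show "0 \<le> K * L" using assms unfolding op_bound_def by auto
qed

lemma lsum_functional_bound:
  fixes f :: "'c::real_normed_algebra \<Rightarrow> complex" and s :: "('d \<times> 'e) list"
  assumes K: "\<And>x. cmod (f x) \<le> K * norm x"
  shows "\<exists>C. \<forall>z. cmod (lsum (\<lambda>a b. lsum (\<lambda>c d. f (p a b * (z * q c d)) * r a b c d) s) s) \<le> C * norm z"
proof -
  have ex: "\<exists>C. \<forall>z. cmod (g z) \<le> C * norm z \<Longrightarrow> \<exists>C. \<forall>z. cmod (h z) \<le> C * norm z \<Longrightarrow>
      \<exists>C. \<forall>z. cmod (g z + h z) \<le> C * norm z" for g h :: "'c \<Rightarrow> complex"
  proof (elim exE)
    fix C D assume "\<forall>z. cmod (g z) \<le> C * norm z" "\<forall>z. cmod (h z) \<le> D * norm z"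
    then have "cmod (g z + h z) \<le> (C + D) * norm z" for z
      by (metis add_mono distrib_right norm_triangle_le)
    then show ?thesis by blast
  qed
  have lex: "\<exists>C. \<forall>z. cmod (lsum (\<lambda>a b. g a b z) t) \<le> C * norm z"
    if "\<And>a b. \<exists>C. \<forall>z. cmod (g a b z) \<le> C * norm z" for g :: "'d \<Rightarrow> 'e \<Rightarrow> 'c \<Rightarrow> complex" and t :: "('d \<times> 'e) list"
  proof (induction t)
    case Nil
    show ?case by (auto intro: exI[of _ 0])
  next
    case (Cons x t)
    obtain a b where x: "x = (a, b)" by (cases x)
    show ?case unfolding x lsum_simps by (rule ex[of "g a b" "\<lambda>z. lsum (\<lambda>a b. g a b z) t", OF that Cons])
  qed
  have e: "\<exists>C. \<forall>z. cmod (f (p a b * (z * q c d)) * r a b c d) \<le> C * norm z" for a b c d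
  proof (intro exI allI)
    fix z
    have "cmod (f (p a b * (z * q c d))) \<le> \<bar>K\<bar> * norm (p a b * (z * q c d))"
      using K[of "p a b * (z * q c d)"] by (meson abs_ge_self dual_order.trans mult_right_mono norm_ge_zero)
    also have "\<dots> \<le> \<bar>K\<bar> * (norm (p a b) * (norm z * norm (q c d)))"
      by (intro mult_left_mono order_trans[OF norm_mult_ineq] norm_mult_ineq) auto
    finally have "cmod (f (p a b * (z * q c d))) * cmod (r a b c d)
        \<le> \<bar>K\<bar> * (norm (p a b) * (norm z * norm (q c d))) * cmod (r a b c d)"
      by (rule mult_right_mono) simp
    then show "cmod (f (p a b * (z * q c d)) * r a b c d) \<le>
       (\<bar>K\<bar> * norm (p a b) * norm (q c d) * cmod (r a b c d)) * norm z"
      by (simp add: norm_mult mult_ac)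
  qed
  show ?thesis by (rule lex, rule lex, rule e)
qed

lemma op_bound_left: "op_bound [(a, 1)] (norm a)"
  for a :: "'a::pre_cstar_algebra"
  unfolding op_bound_def
proof (intro conjI allI impI)
  fix \<phi> :: "'a \<Rightarrow> complex" and \<psi> :: "'b::pre_cstar_algebra \<Rightarrow> complex" and s
  assume st: "state \<phi>" "state \<psi>"
  interpret state_pair \<phi> \<psi> by standard (rule st)+
  define f where "f z = gns \<phi> \<psi> s (lmult [(z, 1)] s)" for z
  have fe: "f z = lsum (\<lambda>a b. lsum (\<lambda>c d. \<phi> (adj a * (z * c)) * \<psi> (adj b * d)) s) s" for z
    by (simp add: f_def gns_def)
  obtain K where K: "\<And>x. cmod (\<phi> x) \<le> K * norm x" using bound1 by blast
  obtain C where C: "\<And>z. cmod (f z) \<le> C * norm z"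
    using lsum_functional_bound[OF K, of "\<lambda>a b. adj a" "\<lambda>c d. c" "\<lambda>a b c d. \<psi> (adj b * d)" s]
    unfolding fe by blast
  have fp: "f (adj z * z) = gns \<phi> \<psi> (lmult [(z, 1)] s) (lmult [(z, 1)] s)" for z
  proof -
    have "gns \<phi> \<psi> (lmult [(z, 1)] s) (lmult [(z, 1)] s) = gns \<phi> \<psi> s (lmult (ladj [(z, 1)]) (lmult [(z, 1)] s))"
      by (simp only: gns_ladj)
    also have "\<dots> = gns \<phi> \<psi> s (lmult (lmult (ladj [(z, 1)]) [(z, 1)]) s)"
      by (simp only: gns_lmult_assoc)
    also have "lmult (ladj [(z, 1)]) [(z, 1 :: 'b)] = [(adj z * z, 1)]"
      by (simp add: ladj_def lmult_def)
    finally show ?thesis by (simp add: f_def)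
  qed
  have "Re (f (adj a * a)) \<le> (norm a)\<^sup>2 * Re (f 1)"
  proof (rule positive_functional_bound[OF _ _ _ _ C])
    show "f (x + y) = f x + f y" for x y
      by (simp add: fe lin distrib_left distrib_right lsum_add)
    show "f (c *\<^sub>C x) = c * f x" for c x
      by (simp add: fe lin scaleC_mult_left scaleC_mult_right lsum_mult mult.assoc)
    show "Im (f (adj x * x)) = 0" "0 \<le> Re (f (adj x * x))" for x
      unfolding fp by (rule gns_pos)+
  qed
  then show "Re (gns \<phi> \<psi> (lmult [(a, 1)] s) (lmult [(a, 1)] s)) \<le> (norm a)\<^sup>2 * Re (gns \<phi> \<psi> s s)"
    by (simp add: fp) (simp add: f_def)
qed simp

lemma op_bound_right: "op_bound [(1, b)] (norm b)"
  for b :: "'b::pre_cstar_algebra"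
  unfolding op_bound_def
proof (intro conjI allI impI)
  fix \<phi> :: "'a::pre_cstar_algebra \<Rightarrow> complex" and \<psi> :: "'b \<Rightarrow> complex" and s
  assume st: "state \<phi>" "state \<psi>"
  interpret state_pair \<phi> \<psi> by standard (rule st)+
  define f where "f z = gns \<phi> \<psi> s (lmult [(1, z)] s)" for z
  have fe: "f z = lsum (\<lambda>a b. lsum (\<lambda>c d. \<psi> (adj b * (z * d)) * \<phi> (adj a * c)) s) s" for z
    by (simp add: f_def gns_def mult.commute)
  obtain K where K: "\<And>x. cmod (\<psi> x) \<le> K * norm x" using bound2 by blast
  obtain C where C: "\<And>z. cmod (f z) \<le> C * norm z"
    using lsum_functional_bound[OF K, of "\<lambda>a b. adj b" "\<lambda>c d. d" "\<lambda>a b c d. \<phi> (adj a * c)" s]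
    unfolding fe by blast
  have fp: "f (adj z * z) = gns \<phi> \<psi> (lmult [(1, z)] s) (lmult [(1, z)] s)" for z
  proof -
    have "gns \<phi> \<psi> (lmult [(1, z)] s) (lmult [(1, z)] s) = gns \<phi> \<psi> s (lmult (ladj [(1, z)]) (lmult [(1, z)] s))"
      by (simp only: gns_ladj)
    also have "\<dots> = gns \<phi> \<psi> s (lmult (lmult (ladj [(1, z)]) [(1, z)]) s)"
      by (simp only: gns_lmult_assoc)
    also have "lmult (ladj [(1, z)]) [(1 :: 'a, z)] = [(1, adj z * z)]"
      by (simp add: ladj_def lmult_def)
    finally show ?thesis by (simp add: f_def)
  qed
  have "Re (f (adj b * b)) \<le> (norm b)\<^sup>2 * Re (f 1)"
  proof (rule positive_functional_bound[OF _ _ _ _ C])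
    show "f (x + y) = f x + f y" for x y
      by (simp add: fe lin distrib_left distrib_right lsum_add)
    show "f (c *\<^sub>C x) = c * f x" for c x
      by (simp add: fe lin scaleC_mult_left scaleC_mult_right lsum_mult mult.assoc)
    show "Im (f (adj x * x)) = 0" "0 \<le> Re (f (adj x * x))" for x
      unfolding fp by (rule gns_pos)+
  qed
  then show "Re (gns \<phi> \<psi> (lmult [(1, b)] s) (lmult [(1, b)] s)) \<le> (norm b)\<^sup>2 * Re (gns \<phi> \<psi> s s)"
    by (simp add: fp) (simp add: f_def)
qed simp

lemma op_bound_exists: "\<exists>K. op_bound t K"
proof (induction t)
  case Nil
  show ?case by (auto simp: op_bound_def intro!: exI[of _ 0])
next
  case (Cons x t)
  obtain a b where x: "x = (a, b)" by (cases x)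
  have "lmult [(a, 1)] [(1, b)] = [(a, b)]" by (simp add: lmult_def)
  then have "op_bound [(a, b)] (norm a * norm b)"
    using op_bound_lmult[OF op_bound_left[of a] op_bound_right[of b]] by simp
  with Cons show ?case using op_bound_append[of "[(a, b)]" _ t] by (auto simp: x)
qed

lemma spatial_norm_le: "op_bound t K \<Longrightarrow> spatial_norm t \<le> K"
  unfolding spatial_norm_def
  by (rule cInf_lower) (auto intro!: bdd_belowI[of _ 0] simp: op_bound_def)

lemma spatial_norm_nonneg: "0 \<le> spatial_norm t"
  unfolding spatial_norm_def
  by (rule cInf_greatest) (use op_bound_exists[of t] in \<open>auto simp: op_bound_def\<close>)

lemma op_bound_spatial_norm: "op_bound t (spatial_norm t)"
  unfolding op_bound_def
proof (intro conjI allI impI)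
  fix \<phi> :: "'a \<Rightarrow> complex" and \<psi> :: "'b \<Rightarrow> complex" and s
  assume st: "state \<phi>" "state \<psi>"
  interpret state_pair \<phi> \<psi> by standard (rule st)+
  let ?x = "Re (gns \<phi> \<psi> (lmult t s) (lmult t s))" and ?y = "Re (gns \<phi> \<psi> s s)"
  have *: "?x \<le> K\<^sup>2 * ?y" if "op_bound t K" for K
    using that st unfolding op_bound_def by blast
  show "?x \<le> (spatial_norm t)\<^sup>2 * ?y"
  proof (cases "?y = 0")
    case True
    with op_bound_exists[of t] * show ?thesis by auto
  next
    case False
    with gns_pos have y: "?y > 0" by (simp add: order_less_le)
    have "sqrt (?x / ?y) \<le> K" if "op_bound t K" for K
      using *[OF that] y that by (intro real_le_lsqrt) (auto simp: op_bound_def field_simps)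
    then have "sqrt (?x / ?y) \<le> spatial_norm t"
      unfolding spatial_norm_def using op_bound_exists[of t] by (intro cInf_greatest) auto
    then have "?x / ?y \<le> (spatial_norm t)\<^sup>2"
      by (rule sqrt_le_D)
    with y show ?thesis by (simp add: field_simps)
  qed
qed (rule spatial_norm_nonneg)

lemma spatial_norm_append: "spatial_norm (t @ u) \<le> spatial_norm t + spatial_norm u"
  by (intro spatial_norm_le op_bound_append op_bound_spatial_norm)

lemma spatial_norm_lmult: "spatial_norm (lmult t u) \<le> spatial_norm t * spatial_norm u"
  by (intro spatial_norm_le op_bound_lmult op_bound_spatial_norm)

lemma spatial_norm_cstar: "(spatial_norm t)\<^sup>2 \<le> spatial_norm (lmult (ladj t) t)"
proof -
  let ?n = "spatial_norm (lmult (ladj t) t)"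
  have "op_bound t (sqrt ?n)"
    unfolding op_bound_def
  proof (intro conjI allI impI)
    fix \<phi> :: "'a \<Rightarrow> complex" and \<psi> :: "'b \<Rightarrow> complex" and s
    assume st: "state \<phi>" "state \<psi>"
    interpret state_pair \<phi> \<psi> by standard (rule st)+
    let ?w = "lmult (lmult (ladj t) t) s"
    have "gns \<phi> \<psi> (lmult t s) (lmult t s) = gns \<phi> \<psi> s ?w"
      by (simp only: gns_ladj gns_lmult_assoc)
    then have "Re (gns \<phi> \<psi> (lmult t s) (lmult t s)) \<le> cmod (gns \<phi> \<psi> s ?w)"
      by (simp add: complex_Re_le_cmod)
    also have "\<dots> \<le> sqrt (Re (gns \<phi> \<psi> s s) * Re (gns \<phi> \<psi> ?w ?w))"
      by (rule real_le_rsqrt) (rule gns_cs)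
    also have "\<dots> \<le> sqrt (Re (gns \<phi> \<psi> s s) * (?n\<^sup>2 * Re (gns \<phi> \<psi> s s)))"
      using op_bound_spatial_norm[of "lmult (ladj t) t"] st gns_pos[of s] unfolding op_bound_def
      by (intro real_sqrt_le_mono mult_left_mono) auto
    also have "\<dots> = ?n * Re (gns \<phi> \<psi> s s)"
    proof -
      have "Re (gns \<phi> \<psi> s s) * (?n\<^sup>2 * Re (gns \<phi> \<psi> s s)) = (?n * Re (gns \<phi> \<psi> s s))\<^sup>2"
        by (simp add: power2_eq_square)
      then show ?thesis using gns_pos[of s]
        by (simp add: spatial_norm_nonneg abs_mult)
    qed
    finally show "Re (gns \<phi> \<psi> (lmult t s) (lmult t s)) \<le> (sqrt ?n)\<^sup>2 * Re (gns \<phi> \<psi> s s)"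
      by (simp add: spatial_norm_nonneg)
  qed (simp add: spatial_norm_nonneg)
  then have "spatial_norm t \<le> sqrt ?n" by (rule spatial_norm_le)
  then show ?thesis by (rule sqrt_ge_absD[OF order_trans[OF _ ], rotated]) (simp add: spatial_norm_nonneg)
qed

text \<open>Two lists are identified if they act in the same way in all these representations. For
  C*-algebras the product states separate the points of the algebraic tensor product, so the quotient
  is exactly the algebraic tensor product.\<close>

definition tensor_rel ::
    "('a::pre_cstar_algebra \<times> 'b::pre_cstar_algebra) list \<Rightarrow> ('a \<times> 'b) list \<Rightarrow> bool"
  where "tensor_rel t u \<longleftrightarrow> (\<forall>\<phi> \<psi>. state \<phi> \<longrightarrow> state \<psi> \<longrightarrow>
    (\<forall>s v. gns \<phi> \<psi> s (lmult t v) = gns \<phi> \<psi> s (lmult u v)))"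

lemma tensor_relI:
  assumes "\<And>\<phi> \<psi> s v. state_pair \<phi> \<psi> \<Longrightarrow> gns \<phi> \<psi> s (lmult t v) = gns \<phi> \<psi> s (lmult u v)"
  shows "tensor_rel t u"
  using assms unfolding tensor_rel_def state_pair_def by blast

lemma tensor_relD:
  "tensor_rel t u \<Longrightarrow> state_pair \<phi> \<psi> \<Longrightarrow> gns \<phi> \<psi> s (lmult t v) = gns \<phi> \<psi> s (lmult u v)"
  unfolding tensor_rel_def state_pair_def by blast

lemma tensor_relD_left:
  assumes "tensor_rel t u" "state_pair \<phi> \<psi>"
  shows "gns \<phi> \<psi> (lmult t s) v = gns \<phi> \<psi> (lmult u s) v"
proof -
  interpret state_pair \<phi> \<psi> by (rule assms)
  show ?thesis
    unfolding gns_sym[of _ v] tensor_relD[OF assms] ..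
qed

lemma tensor_rel_lmult:
  assumes "tensor_rel t t'" "tensor_rel u u'"
  shows "tensor_rel (lmult t u) (lmult t' u')"
proof (rule tensor_relI)
  fix \<phi> :: "'a \<Rightarrow> complex" and \<psi> :: "'b \<Rightarrow> complex" and s v
  assume st: "state_pair \<phi> \<psi>"
  have "gns \<phi> \<psi> s (lmult (lmult t u) v) = gns \<phi> \<psi> s (lmult t' (lmult u v))"
    unfolding gns_lmult_assoc by (rule tensor_relD[OF assms(1) st])
  also have "\<dots> = gns \<phi> \<psi> (lmult (ladj t') s) (lmult u' v)"
    unfolding gns_lmult[of _ _ s] by (rule tensor_relD[OF assms(2) st])
  also have "\<dots> = gns \<phi> \<psi> s (lmult (lmult t' u') v)"
    by (simp only: gns_lmult_assoc gns_lmult[of _ _ s])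
  finally show "gns \<phi> \<psi> s (lmult (lmult t u) v) = gns \<phi> \<psi> s (lmult (lmult t' u') v)" .
qed

lemma tensor_rel_lscale: "tensor_rel t u \<Longrightarrow> tensor_rel (lscale c t) (lscale c u)"
proof (rule tensor_relI)
  fix \<phi> :: "'a \<Rightarrow> complex" and \<psi> :: "'b \<Rightarrow> complex" and s v
  assume "tensor_rel t u" "state_pair \<phi> \<psi>"
  then show "gns \<phi> \<psi> s (lmult (lscale c t) v) = gns \<phi> \<psi> s (lmult (lscale c u) v)"
    by (simp add: lmult_lscale state_pair.gns_lscale tensor_relD[of t u])
qed

lemma tensor_rel_append:
  "tensor_rel t t' \<Longrightarrow> tensor_rel u u' \<Longrightarrow> tensor_rel (t @ u) (t' @ u')"
  by (rule tensor_relI) (simp add: tensor_relD[of t t'] tensor_relD[of u u'])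

lemma tensor_rel_ladj: "tensor_rel t u \<Longrightarrow> tensor_rel (ladj t) (ladj u)"
  by (rule tensor_relI) (simp add: gns_ladj tensor_relD_left[of t u])

lemma tensor_rel_spatial_norm:
  assumes "tensor_rel t u"
  shows "spatial_norm t = spatial_norm u"
proof -
  have "gns \<phi> \<psi> (lmult t s) (lmult t s) = gns \<phi> \<psi> (lmult u s) (lmult u s)"
    if "state \<phi>" "state \<psi>" for \<phi> \<psi> s
    using that tensor_relD[OF assms] tensor_relD_left[OF assms] by (simp add: state_pair_def)
  then have "op_bound t = op_bound u"
    unfolding op_bound_def by (auto simp: fun_eq_iff)
  then show ?thesis by (simp add: spatial_norm_def)
qed

lemma tensor_rel_nil:
  assumes "spatial_norm t = 0"
  shows "tensor_rel t []"
proof (rule tensor_relI)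
  fix \<phi> :: "'a \<Rightarrow> complex" and \<psi> :: "'b \<Rightarrow> complex" and s v
  assume "state_pair \<phi> \<psi>"
  then interpret state_pair \<phi> \<psi> .
  have "Re (gns \<phi> \<psi> (lmult t v) (lmult t v)) \<le> 0"
    using op_bound_spatial_norm[of t] state1 state2 assms unfolding op_bound_def by fastforce
  with gns_pos(1)[of "lmult t v"] have "Re (gns \<phi> \<psi> (lmult t v) (lmult t v)) = 0" by simp
  then show "gns \<phi> \<psi> s (lmult t v) = gns \<phi> \<psi> s (lmult [] v)"
    by (simp add: gns_zero_right)
qed

quotient_type (overloaded) ('a, 'b) alg_tensor =
  "('a::pre_cstar_algebra \<times> 'b::pre_cstar_algebra) list" / tensor_rel
  by (rule equivpI) (auto simp: reflp_def symp_def transp_def tensor_rel_def)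

instantiation alg_tensor :: (pre_cstar_algebra, pre_cstar_algebra) pre_cstar_algebra
begin

lift_definition zero_alg_tensor :: "('a, 'b) alg_tensor" is "[]" .
lift_definition one_alg_tensor :: "('a, 'b) alg_tensor" is "[(1, 1)]" .
lift_definition plus_alg_tensor :: "('a, 'b) alg_tensor \<Rightarrow> ('a, 'b) alg_tensor \<Rightarrow> ('a, 'b) alg_tensor"
  is append by (rule tensor_rel_append)
lift_definition uminus_alg_tensor :: "('a, 'b) alg_tensor \<Rightarrow> ('a, 'b) alg_tensor"
  is "lscale (- 1)" by (rule tensor_rel_lscale)
lift_definition minus_alg_tensor :: "('a, 'b) alg_tensor \<Rightarrow> ('a, 'b) alg_tensor \<Rightarrow> ('a, 'b) alg_tensor"
  is "\<lambda>t u. t @ lscale (- 1) u" by (intro tensor_rel_append tensor_rel_lscale)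
lift_definition times_alg_tensor :: "('a, 'b) alg_tensor \<Rightarrow> ('a, 'b) alg_tensor \<Rightarrow> ('a, 'b) alg_tensor"
  is lmult by (rule tensor_rel_lmult)
lift_definition scaleC_alg_tensor :: "complex \<Rightarrow> ('a, 'b) alg_tensor \<Rightarrow> ('a, 'b) alg_tensor"
  is lscale by (rule tensor_rel_lscale)
lift_definition scaleR_alg_tensor :: "real \<Rightarrow> ('a, 'b) alg_tensor \<Rightarrow> ('a, 'b) alg_tensor"
  is "\<lambda>r. lscale (complex_of_real r)" by (rule tensor_rel_lscale)
lift_definition adj_alg_tensor :: "('a, 'b) alg_tensor \<Rightarrow> ('a, 'b) alg_tensor"
  is ladj by (rule tensor_rel_ladj)
lift_definition norm_alg_tensor :: "('a, 'b) alg_tensor \<Rightarrow> real"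
  is spatial_norm by (rule tensor_rel_spatial_norm)

definition dist_alg_tensor :: "('a, 'b) alg_tensor \<Rightarrow> ('a, 'b) alg_tensor \<Rightarrow> real"
  where "dist_alg_tensor x y = norm (x - y)"
definition sgn_alg_tensor :: "('a, 'b) alg_tensor \<Rightarrow> ('a, 'b) alg_tensor"
  where "sgn_alg_tensor x = inverse (norm x) *\<^sub>R x"
definition uniformity_alg_tensor :: "(('a, 'b) alg_tensor \<times> ('a, 'b) alg_tensor) filter"
  where "uniformity_alg_tensor = (INF e\<in>{0 <..}. principal {(x, y). dist x y < e})"
definition open_alg_tensor :: "('a, 'b) alg_tensor set \<Rightarrow> bool"
  where "open_alg_tensor U \<longleftrightarrow> (\<forall>x\<in>U. eventually (\<lambda>(x', y). x' = x \<longrightarrow> y \<in> U) uniformity)"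

lemmas tensor_laws = state_pair.gns_lscale state_pair.gns_lmult_lscale gns_lmult_append
  lmult_lscale gns_lmult_assoc gns_lmult_assoc2 algebra_simps

instance
proof
  fix x y z :: "('a, 'b) alg_tensor" and r q :: real and c d :: complex
  show "x + y + z = x + (y + z)" by transfer (rule tensor_relI, simp)
  show "x + y = y + x" by transfer (rule tensor_relI, simp)
  show "0 + x = x" by transfer (rule tensor_relI, simp)
  show "- x + x = 0" by transfer (rule tensor_relI, simp add: tensor_laws)
  show "x - y = x + - y" by transfer (rule tensor_relI, simp)
  show "r *\<^sub>R (x + y) = r *\<^sub>R x + r *\<^sub>R y" by transfer (rule tensor_relI, simp add: tensor_laws)
  show "(r + q) *\<^sub>R x = r *\<^sub>R x + q *\<^sub>R x" by transfer (rule tensor_relI, simp add: tensor_laws)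
  show "r *\<^sub>R q *\<^sub>R x = (r * q) *\<^sub>R x" by transfer (rule tensor_relI, simp add: tensor_laws)
  show "1 *\<^sub>R x = x" by transfer (rule tensor_relI, simp add: tensor_laws)
  show "x * y * z = x * (y * z)" by transfer (rule tensor_relI, simp add: tensor_laws)
  show "(x + y) * z = x * z + y * z" by transfer (rule tensor_relI, simp)
  show "x * (y + z) = x * y + x * z" by transfer (rule tensor_relI, simp add: tensor_laws)
  show "r *\<^sub>R x * y = r *\<^sub>R (x * y)" by transfer (rule tensor_relI, simp add: tensor_laws)
  show "x * r *\<^sub>R y = r *\<^sub>R (x * y)" by transfer (rule tensor_relI, simp add: tensor_laws)
  show "1 * x = x" by transfer (rule tensor_relI, simp)
  show "x * 1 = x" by transfer (rule tensor_relI, simp)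
  show "complex_of_real r *\<^sub>C x = r *\<^sub>R x" by transfer (rule tensor_relI, simp)
  show "c *\<^sub>C (x + y) = c *\<^sub>C x + c *\<^sub>C y" by transfer (rule tensor_relI, simp add: tensor_laws)
  show "(c + d) *\<^sub>C x = c *\<^sub>C x + d *\<^sub>C x" by transfer (rule tensor_relI, simp add: tensor_laws)
  show "c *\<^sub>C d *\<^sub>C x = (c * d) *\<^sub>C x" by transfer (rule tensor_relI, simp add: tensor_laws)
  show "c *\<^sub>C x * y = c *\<^sub>C (x * y)" by transfer (rule tensor_relI, simp add: tensor_laws)
  show "x * c *\<^sub>C y = c *\<^sub>C (x * y)" by transfer (rule tensor_relI, simp add: tensor_laws)
  show "adj (x + y) = adj x + adj y" by transfer (rule tensor_relI, simp add: gns_ladj)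
  show "adj (c *\<^sub>C x) = cnj c *\<^sub>C adj x"
    by transfer (rule tensor_relI, simp add: gns_ladj tensor_laws)
  show "adj (adj x) = x" by transfer (rule tensor_relI, simp)
  show "dist x y = norm (x - y)" by (rule dist_alg_tensor_def)
  show "sgn x = inverse (norm x) *\<^sub>R x" by (rule sgn_alg_tensor_def)
  show "uniformity = (INF e\<in>{0 <..}. principal {(x :: ('a, 'b) alg_tensor, y). dist x y < e})"
    by (rule uniformity_alg_tensor_def)
  show "open U \<longleftrightarrow> (\<forall>x\<in>U. eventually (\<lambda>(x', y). x' = x \<longrightarrow> y \<in> U) uniformity)"
    for U :: "('a, 'b) alg_tensor set"
    by (rule open_alg_tensor_def)
  show am: "adj (x * y) = adj y * adj x" for x y :: "('a, 'b) alg_tensor"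
  proof (transfer, rule tensor_relI)
    fix t u s v :: "('a \<times> 'b) list" and \<phi> :: "'a \<Rightarrow> complex" and \<psi> :: "'b \<Rightarrow> complex"
    assume "state_pair \<phi> \<psi>"
    then interpret state_pair \<phi> \<psi> .
    have "gns \<phi> \<psi> s (lmult (ladj (lmult t u)) v) = cnj (gns \<phi> \<psi> v (lmult (lmult t u) s))"
      unfolding gns_ladj by (rule gns_sym)
    also have "\<dots> = gns \<phi> \<psi> (lmult t (lmult u s)) v"
      unfolding gns_lmult_assoc by (rule gns_sym[symmetric])
    also have "\<dots> = gns \<phi> \<psi> s (lmult (lmult (ladj u) (ladj t)) v)"
      by (simp only: gns_lmult_assoc gns_ladj)
    finally show "gns \<phi> \<psi> s (lmult (ladj (lmult t u)) v) = gns \<phi> \<psi> s (lmult (lmult (ladj u) (ladj t)) v)" .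
  qed
  show tri: "norm (x + y) \<le> norm x + norm y" by transfer (rule spatial_norm_append)
  show "(norm x = 0) = (x = 0)"
  proof (transfer, rule iffI)
    fix t :: "('a \<times> 'b) list"
    show "spatial_norm t = 0 \<Longrightarrow> tensor_rel t []" by (rule tensor_rel_nil)
    assume "tensor_rel t []"
    then have "spatial_norm t = spatial_norm ([] :: ('a \<times> 'b) list)"
      by (rule tensor_rel_spatial_norm)
    also have "\<dots> \<le> 0" by (rule spatial_norm_le) (simp add: op_bound_def)
    finally show "spatial_norm t = 0" using spatial_norm_nonneg[of t] by simp
  qed
  have nle: "norm (c *\<^sub>C x) \<le> cmod c * norm x" for c and x :: "('a, 'b) alg_tensor"
  proof transfer
    fix c and t :: "('a \<times> 'b) list"
    show "spatial_norm (lscale c t) \<le> cmod c * spatial_norm t"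
    proof (rule spatial_norm_le, unfold op_bound_def, intro conjI allI impI)
      fix \<phi> :: "'a \<Rightarrow> complex" and \<psi> :: "'b \<Rightarrow> complex" and s
      assume st: "state \<phi>" "state \<psi>"
      interpret state_pair \<phi> \<psi> by standard (rule st)+
      have e: "gns \<phi> \<psi> (lscale c u) (lscale c u) = complex_of_real ((cmod c)\<^sup>2) * gns \<phi> \<psi> u u" for u
        unfolding complex_norm_square by simp
      have "Re (gns \<phi> \<psi> (lmult t s) (lmult t s)) \<le> (spatial_norm t)\<^sup>2 * Re (gns \<phi> \<psi> s s)"
        using op_bound_spatial_norm[of t] st unfolding op_bound_def by blast
      then have "(cmod c)\<^sup>2 * Re (gns \<phi> \<psi> (lmult t s) (lmult t s))
          \<le> (cmod c)\<^sup>2 * ((spatial_norm t)\<^sup>2 * Re (gns \<phi> \<psi> s s))"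
        by (rule mult_left_mono) simp
      then show "Re (gns \<phi> \<psi> (lmult (lscale c t) s) (lmult (lscale c t) s))
          \<le> (cmod c * spatial_norm t)\<^sup>2 * Re (gns \<phi> \<psi> s s)"
        unfolding lmult_lscale e by (simp add: power_mult_distrib mult.assoc)
    qed (simp add: spatial_norm_nonneg)
  qed
  show nsc: "norm (c *\<^sub>C x) = cmod c * norm x" for c and x :: "('a, 'b) alg_tensor"
  proof (cases "c = 0")
    case True
    have "norm x \<ge> 0" by transfer (rule spatial_norm_nonneg)
    moreover have "norm (c *\<^sub>C x) \<ge> 0" by transfer (rule spatial_norm_nonneg)
    ultimately show ?thesis using nle[of c x] True by simp
  next
    case False
    have "inverse c *\<^sub>C c *\<^sub>C x = x"
      using False by transfer (rule tensor_relI, simp add: tensor_laws)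
    then have "norm x \<le> cmod (inverse c) * norm (c *\<^sub>C x)" using nle[of "inverse c" "c *\<^sub>C x"] by simp
    with False nle[of c x] show ?thesis by (simp add: norm_divide field_simps)
  qed
  have rc: "r *\<^sub>R x = complex_of_real r *\<^sub>C x" by transfer (rule tensor_relI, simp)
  show "norm (r *\<^sub>R x) = \<bar>r\<bar> * norm x" unfolding rc nsc by simp
  show nm: "norm (x * y) \<le> norm x * norm y" for x y :: "('a, 'b) alg_tensor"
    by transfer (rule spatial_norm_lmult)
  have n0: "0 \<le> norm x" for x :: "('a, 'b) alg_tensor"
    by transfer (rule spatial_norm_nonneg)
  have c1: "(norm x)\<^sup>2 \<le> norm (adj x * x)" for x :: "('a, 'b) alg_tensor"
    by transfer (rule spatial_norm_cstar)
  have aa: "adj (adj x) = x" for x :: "('a, 'b) alg_tensor"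
    by transfer (rule tensor_relI, simp)
  have na: "norm x \<le> norm (adj x)" for x :: "('a, 'b) alg_tensor"
    using order_trans[OF c1[of x] nm[of "adj x" x]] n0[of x] n0[of "adj x"]
    by (cases "norm x = 0") (auto simp: power2_eq_square)
  have "norm (adj x) = norm x" using na[of x] na[of "adj x"] aa[of x] by simp
  then show "norm (adj x * x) = (norm x)\<^sup>2"
    using c1[of x] nm[of "adj x" x] by (simp add: power2_eq_square)
qed

end

subsection \<open>Completion\<close>

lemma Cauchy_const_seq [simp]: "Cauchy (\<lambda>_. a :: 'a::real_normed_vector)"
  by (intro convergent_Cauchy convergent_const)

lemma Cauchy_add_seq:
  fixes X Y :: "nat \<Rightarrow> 'a::real_normed_vector"
  assumes "Cauchy X" "Cauchy Y"
  shows "Cauchy (\<lambda>n. X n + Y n)"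
proof (rule CauchyI)
  fix e :: real assume "0 < e"
  then have e: "0 < e / 2" by simp
  obtain M where M: "\<And>m n. m \<ge> M \<Longrightarrow> n \<ge> M \<Longrightarrow> norm (X m - X n) < e / 2"
    using CauchyD[OF assms(1) e] by blast
  obtain N where N: "\<And>m n. m \<ge> N \<Longrightarrow> n \<ge> N \<Longrightarrow> norm (Y m - Y n) < e / 2"
    using CauchyD[OF assms(2) e] by blast
  show "\<exists>M. \<forall>m\<ge>M. \<forall>n\<ge>M. norm (X m + Y m - (X n + Y n)) < e"
  proof (intro exI allI impI)
    fix m n assume mn: "max M N \<le> m" "max M N \<le> n"
    then have "norm (X m - X n) < e / 2" "norm (Y m - Y n) < e / 2"
      using M[of m n] N[of m n] by simp_all
    then show "norm (X m + Y m - (X n + Y n)) < e"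
      using norm_triangle_ineq[of "X m - X n" "Y m - Y n"] by (simp add: algebra_simps)
  qed
qed

lemma Cauchy_diff_seq:
  fixes X Y :: "nat \<Rightarrow> 'a::real_normed_vector"
  assumes "Cauchy X" "Cauchy Y"
  shows "Cauchy (\<lambda>n. X n - Y n)"
  using Cauchy_add_seq[OF assms(1)
    bounded_linear.Cauchy[OF bounded_linear_minus[OF bounded_linear_ident] assms(2)]] by simp

lemma Cauchy_norm_seq:
  fixes X :: "nat \<Rightarrow> 'a::real_normed_vector"
  assumes "Cauchy X"
  shows "Cauchy (\<lambda>n. norm (X n))"
proof (rule CauchyI)
  fix e :: real assume "0 < e"
  from CauchyD[OF assms this] obtain M where
    "\<forall>m\<ge>M. \<forall>n\<ge>M. norm (X m - X n) < e" by blast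
  then show "\<exists>M. \<forall>m\<ge>M. \<forall>n\<ge>M. norm (norm (X m) - norm (X n)) < e"
    unfolding real_norm_def using norm_triangle_ineq3 order_le_less_trans by blast
qed

definition cauchy_rel :: "(nat \<Rightarrow> 'a::real_normed_vector) \<Rightarrow> (nat \<Rightarrow> 'a) \<Rightarrow> bool"
  where "cauchy_rel X Y \<longleftrightarrow> Cauchy X \<and> Cauchy Y \<and> (\<lambda>n. X n - Y n) \<longlonglongrightarrow> 0"

lemma cauchy_rel_part_equivp: "part_equivp (cauchy_rel :: (nat \<Rightarrow> 'a::real_normed_vector) \<Rightarrow> _)"
proof (rule part_equivpI)
  show "\<exists>X. cauchy_rel X (X :: nat \<Rightarrow> 'a)"
    by (rule exI[of _ "\<lambda>_. 0"]) (simp add: cauchy_rel_def)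
  show "symp (cauchy_rel :: (nat \<Rightarrow> 'a) \<Rightarrow> _)"
  proof (rule sympI)
    fix X Y :: "nat \<Rightarrow> 'a" assume "cauchy_rel X Y"
    then show "cauchy_rel Y X"
      unfolding cauchy_rel_def using tendsto_minus[of "\<lambda>n. X n - Y n" 0] by simp
  qed
  show "transp (cauchy_rel :: (nat \<Rightarrow> 'a) \<Rightarrow> _)"
  proof (rule transpI)
    fix X Y Z :: "nat \<Rightarrow> 'a" assume "cauchy_rel X Y" "cauchy_rel Y Z"
    then show "cauchy_rel X Z"
      unfolding cauchy_rel_def using tendsto_add[of "\<lambda>n. X n - Y n" 0 _ "\<lambda>n. Y n - Z n" 0] by simp
  qed
qed

lemma cauchy_rel_bounded_linear:
  assumes "cauchy_rel X Y" "bounded_linear f"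
  shows "cauchy_rel (\<lambda>n. f (X n)) (\<lambda>n. f (Y n))"
proof -
  interpret bounded_linear f by (rule assms)
  show ?thesis
    using assms(1) Cauchy[of X] Cauchy[of Y] tendsto_zero[of "\<lambda>n. X n - Y n"]
    by (simp add: cauchy_rel_def diff)
qed

lemma cauchy_rel_add:
  assumes "cauchy_rel X X'" "cauchy_rel Y Y'"
  shows "cauchy_rel (\<lambda>n. X n + Y n) (\<lambda>n. X' n + Y' n)"
  using assms Cauchy_add_seq[of X Y] Cauchy_add_seq[of X' Y']
    tendsto_add[of "\<lambda>n. X n - X' n" 0 _ "\<lambda>n. Y n - Y' n" 0]
  by (simp add: cauchy_rel_def add_diff_add)

lemma Cauchy_mult_algebra:
  fixes X Y :: "nat \<Rightarrow> 'a::real_normed_algebra"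
  assumes "Cauchy X" "Cauchy Y"
  shows "Cauchy (\<lambda>n. X n * Y n)"
proof (rule CauchyI)
  fix e :: real assume e: "0 < e"
  obtain K where K: "0 < K" "\<And>n. norm (X n) \<le> K"
    using Cauchy_Bseq[OF assms(1)] by (auto simp: Bseq_def)
  obtain L where L: "0 < L" "\<And>n. norm (Y n) \<le> L"
    using Cauchy_Bseq[OF assms(2)] by (auto simp: Bseq_def)
  obtain M where M: "\<And>m n. m \<ge> M \<Longrightarrow> n \<ge> M \<Longrightarrow> norm (X m - X n) < e / (2 * L)"
    using CauchyD[OF assms(1), of "e / (2 * L)"] e L by auto
  obtain N where N: "\<And>m n. m \<ge> N \<Longrightarrow> n \<ge> N \<Longrightarrow> norm (Y m - Y n) < e / (2 * K)"
    using CauchyD[OF assms(2), of "e / (2 * K)"] e K by auto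
  show "\<exists>M. \<forall>m\<ge>M. \<forall>n\<ge>M. norm (X m * Y m - X n * Y n) < e"
  proof (intro exI allI impI)
    fix m n assume mn: "max M N \<le> m" "max M N \<le> n"
    have "X m * Y m - X n * Y n = (X m - X n) * Y m + X n * (Y m - Y n)"
      by (simp add: algebra_simps)
    then have "norm (X m * Y m - X n * Y n) \<le> norm (X m - X n) * norm (Y m) + norm (X n) * norm (Y m - Y n)"
      by (metis (no_types, opaque_lifting) add_mono norm_mult_ineq norm_triangle_le)
    also have "\<dots> \<le> norm (X m - X n) * L + K * norm (Y m - Y n)"
      using K L by (intro add_mono mult_left_mono mult_right_mono) auto
    also have "\<dots> < e / (2 * L) * L + K * (e / (2 * K))"
      using mn K(1) L(1) by (intro add_strict_mono mult_strict_right_mono mult_strict_left_mono M N) auto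
    also have "\<dots> = e" using K L by simp
    finally show "norm (X m * Y m - X n * Y n) < e" .
  qed
qed

lemma cauchy_rel_mult:
  fixes X Y :: "nat \<Rightarrow> 'a::real_normed_algebra"
  assumes "cauchy_rel X X'" "cauchy_rel Y Y'"
  shows "cauchy_rel (\<lambda>n. X n * Y n) (\<lambda>n. X' n * Y' n)"
proof -
  have c: "Cauchy X" "Cauchy X'" "Cauchy Y" "Cauchy Y'"
    and l: "(\<lambda>n. X n - X' n) \<longlonglongrightarrow> 0" "(\<lambda>n. Y n - Y' n) \<longlonglongrightarrow> 0"
    using assms by (auto simp: cauchy_rel_def)
  have "(\<lambda>n. (X n - X' n) * Y n + X' n * (Y n - Y' n)) \<longlonglongrightarrow> 0"
  proof -
    obtain L where L: "\<And>n. norm (Y n) \<le> L"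
      using Cauchy_Bseq[OF c(3)] by (auto simp: Bseq_def)
    obtain K where K: "\<And>n. norm (X' n) \<le> K"
      using Cauchy_Bseq[OF c(2)] by (auto simp: Bseq_def)
    have "(\<lambda>n. norm (X n - X' n) * L + K * norm (Y n - Y' n)) \<longlonglongrightarrow> 0 * L + K * 0"
      by (intro tendsto_intros tendsto_norm_zero l)
    then have g: "(\<lambda>n. norm (X n - X' n) * L + K * norm (Y n - Y' n)) \<longlonglongrightarrow> 0" by simp
    have b: "norm ((X n - X' n) * Y n + X' n * (Y n - Y' n))
        \<le> norm (X n - X' n) * L + K * norm (Y n - Y' n)" for n
      by (intro norm_triangle_le add_mono order_trans[OF norm_mult_ineq] mult_left_mono
          mult_right_mono L K norm_ge_zero)
    show ?thesis
      by (rule Lim_null_comparison[OF _ g]) (simp add: b)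
  qed
  then show ?thesis
    unfolding cauchy_rel_def using c by (simp add: Cauchy_mult_algebra algebra_simps)
qed

lemma adj_diff: "adj (x - y) = adj x - adj (y :: 'a::pre_cstar_algebra)"
proof -
  have "adj (x - y) + adj y = adj x" by (simp add: adj_add[symmetric])
  then show ?thesis by (simp add: eq_diff_eq)
qed

lemma bounded_linear_adj: "bounded_linear (adj :: 'a::pre_cstar_algebra \<Rightarrow> 'a)"
proof (rule bounded_linear_intro[of _ 1])
  show "adj (r *\<^sub>R x) = r *\<^sub>R adj x" for r and x :: 'a
    using adj_scaleC[of "complex_of_real r" x] by (simp add: scaleC_of_real)
qed (simp_all add: adj_add)

lemma bounded_linear_scaleC: "bounded_linear ((*\<^sub>C) c :: 'a::pre_cstar_algebra \<Rightarrow> 'a)"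
proof (rule bounded_linear_intro[of _ "cmod c"])
  show "c *\<^sub>C r *\<^sub>R x = r *\<^sub>R c *\<^sub>C x" for r and x :: 'a
    by (simp add: scaleC_of_real[symmetric] scaleC_scaleC mult.commute)
qed (simp_all add: scaleC_add_right norm_scaleC mult.commute)

lemma cauchy_rel_norm:
  assumes "cauchy_rel X Y"
  shows "lim (\<lambda>n. norm (X n)) = lim (\<lambda>n. norm (Y n))"
proof -
  have "Cauchy (\<lambda>n. norm (X n))" "Cauchy (\<lambda>n. norm (Y n))"
    using assms by (simp_all add: cauchy_rel_def Cauchy_norm_seq)
  then obtain a b where ab: "(\<lambda>n. norm (X n)) \<longlonglongrightarrow> a" "(\<lambda>n. norm (Y n)) \<longlonglongrightarrow> b"
    by (auto simp: Cauchy_convergent_iff convergent_def)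
  have "(\<lambda>n. norm (X n) - norm (Y n)) \<longlonglongrightarrow> 0"
  proof (rule Lim_null_comparison)
    show "(\<lambda>n. norm (X n - Y n)) \<longlonglongrightarrow> 0"
      using assms by (simp add: cauchy_rel_def tendsto_norm_zero)
  qed (auto intro!: always_eventually norm_triangle_ineq3)
  then have "a - b = 0" using tendsto_diff[OF ab] LIMSEQ_unique by blast
  with ab show ?thesis by (simp add: limI)
qed

quotient_type (overloaded) 'a completion = "nat \<Rightarrow> 'a::pre_cstar_algebra" / partial: cauchy_rel
  by (rule cauchy_rel_part_equivp)

lemma cauchy_rel_refl: "Cauchy X \<Longrightarrow> cauchy_rel X X"
  by (simp add: cauchy_rel_def)

instantiation completion :: (pre_cstar_algebra) pre_cstar_algebra
begin

lift_definition zero_completion :: "'a completion" is "\<lambda>_. 0" by (simp add: cauchy_rel_refl)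
lift_definition one_completion :: "'a completion" is "\<lambda>_. 1" by (simp add: cauchy_rel_refl)
lift_definition plus_completion :: "'a completion \<Rightarrow> 'a completion \<Rightarrow> 'a completion"
  is "\<lambda>X Y n. X n + Y n" by (rule cauchy_rel_add)
lift_definition uminus_completion :: "'a completion \<Rightarrow> 'a completion"
  is "\<lambda>X n. - X n" by (rule cauchy_rel_bounded_linear[OF _ bounded_linear_minus[OF bounded_linear_ident]])
lift_definition minus_completion :: "'a completion \<Rightarrow> 'a completion \<Rightarrow> 'a completion"
  is "\<lambda>X Y n. X n - Y n"
  unfolding diff_conv_add_uminus
  by (intro cauchy_rel_add
      cauchy_rel_bounded_linear[OF _ bounded_linear_minus[OF bounded_linear_ident]])
lift_definition times_completion :: "'a completion \<Rightarrow> 'a completion \<Rightarrow> 'a completion"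
  is "\<lambda>X Y n. X n * Y n" by (rule cauchy_rel_mult)
lift_definition scaleC_completion :: "complex \<Rightarrow> 'a completion \<Rightarrow> 'a completion"
  is "\<lambda>c X n. c *\<^sub>C X n" by (rule cauchy_rel_bounded_linear[OF _ bounded_linear_scaleC])
lift_definition scaleR_completion :: "real \<Rightarrow> 'a completion \<Rightarrow> 'a completion"
  is "\<lambda>r X n. r *\<^sub>R X n" by (rule cauchy_rel_bounded_linear[OF _ bounded_linear_scaleR_right])
lift_definition adj_completion :: "'a completion \<Rightarrow> 'a completion"
  is "\<lambda>X n. adj (X n)" by (rule cauchy_rel_bounded_linear[OF _ bounded_linear_adj])
lift_definition norm_completion :: "'a completion \<Rightarrow> real"
  is "\<lambda>X. lim (\<lambda>n. norm (X n))" by (rule cauchy_rel_norm)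

definition dist_completion :: "'a completion \<Rightarrow> 'a completion \<Rightarrow> real"
  where "dist_completion x y = norm (x - y)"
definition sgn_completion :: "'a completion \<Rightarrow> 'a completion"
  where "sgn_completion x = inverse (norm x) *\<^sub>R x"
definition uniformity_completion :: "('a completion \<times> 'a completion) filter"
  where "uniformity_completion = (INF e\<in>{0 <..}. principal {(x, y). dist x y < e})"
definition open_completion :: "'a completion set \<Rightarrow> bool"
  where "open_completion U \<longleftrightarrow> (\<forall>x\<in>U. eventually (\<lambda>(x', y). x' = x \<longrightarrow> y \<in> U) uniformity)"

lemma completion_eqI:
  "cauchy_rel X X \<Longrightarrow> cauchy_rel Y Y \<Longrightarrow> (\<And>n. X n = Y n) \<Longrightarrow> cauchy_rel X (Y :: nat \<Rightarrow> 'a)"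
  by (simp add: cauchy_rel_def)

lemma norm_limit:
  assumes "cauchy_rel X (X :: nat \<Rightarrow> 'a)"
  shows "(\<lambda>n. norm (X n)) \<longlonglongrightarrow> lim (\<lambda>n. norm (X n))"
proof -
  have "Cauchy (\<lambda>n. norm (X n))" using assms by (simp add: cauchy_rel_def Cauchy_norm_seq)
  then show ?thesis by (simp add: Cauchy_convergent_iff convergent_LIMSEQ_iff)
qed

lemma cauchy_rel_closed:
  fixes X Y :: "nat \<Rightarrow> 'a"
  assumes "cauchy_rel X X"
  shows "cauchy_rel (\<lambda>n. c *\<^sub>C X n) (\<lambda>n. c *\<^sub>C X n)" "cauchy_rel (\<lambda>n. r *\<^sub>R X n) (\<lambda>n. r *\<^sub>R X n)"
    "cauchy_rel (\<lambda>n. - X n) (\<lambda>n. - X n)" "cauchy_rel (\<lambda>n. adj (X n)) (\<lambda>n. adj (X n))"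
  by (rule cauchy_rel_bounded_linear[OF assms bounded_linear_scaleC]
      cauchy_rel_bounded_linear[OF assms bounded_linear_scaleR_right]
      cauchy_rel_bounded_linear[OF assms bounded_linear_minus[OF bounded_linear_ident]]
      cauchy_rel_bounded_linear[OF assms bounded_linear_adj])+

lemmas cauchy_rel_intros = cauchy_rel_add cauchy_rel_mult cauchy_rel_closed

instance
proof
  fix x y z :: "'a completion" and r q :: real and c d :: complex
  show "x + y + z = x + (y + z)"
    by transfer (rule completion_eqI, (assumption | rule cauchy_rel_intros)+, simp add: add.assoc)
  show "x + y = y + x"
    by transfer (rule completion_eqI, (assumption | rule cauchy_rel_intros)+, simp add: add.commute)
  show "0 + x = x" by transfer simp
  show "- x + x = 0" by transfer (simp add: cauchy_rel_refl)
  show "x - y = x + - y"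
    by transfer (unfold diff_conv_add_uminus, (assumption | rule cauchy_rel_intros)+)
  show "r *\<^sub>R (x + y) = r *\<^sub>R x + r *\<^sub>R y"
    by transfer (rule completion_eqI, (assumption | rule cauchy_rel_intros)+, simp add: algebra_simps)
  show "(r + q) *\<^sub>R x = r *\<^sub>R x + q *\<^sub>R x"
    by transfer (rule completion_eqI, (assumption | rule cauchy_rel_intros)+, simp add: algebra_simps)
  show "r *\<^sub>R q *\<^sub>R x = (r * q) *\<^sub>R x"
    by transfer (rule completion_eqI, (assumption | rule cauchy_rel_intros)+, simp)
  show "1 *\<^sub>R x = x" by transfer simp
  show "x * y * z = x * (y * z)"
    by transfer (rule completion_eqI, (assumption | rule cauchy_rel_intros)+, simp add: mult.assoc)
  show "(x + y) * z = x * z + y * z"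
    by transfer (rule completion_eqI, (assumption | rule cauchy_rel_intros)+, simp add: algebra_simps)
  show "x * (y + z) = x * y + x * z"
    by transfer (rule completion_eqI, (assumption | rule cauchy_rel_intros)+, simp add: algebra_simps)
  show "r *\<^sub>R x * y = r *\<^sub>R (x * y)"
    by transfer (rule completion_eqI, (assumption | rule cauchy_rel_intros)+, simp)
  show "x * r *\<^sub>R y = r *\<^sub>R (x * y)"
    by transfer (rule completion_eqI, (assumption | rule cauchy_rel_intros)+, simp)
  show "1 * x = x" by transfer simp
  show "x * 1 = x" by transfer simp
  show "complex_of_real r *\<^sub>C x = r *\<^sub>R x"
    by transfer (rule completion_eqI, (assumption | rule cauchy_rel_intros)+, simp add: scaleC_of_real)
  show "c *\<^sub>C (x + y) = c *\<^sub>C x + c *\<^sub>C y"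
    by transfer (rule completion_eqI, (assumption | rule cauchy_rel_intros)+, simp add: scaleC_add_right)
  show "(c + d) *\<^sub>C x = c *\<^sub>C x + d *\<^sub>C x"
    by transfer (rule completion_eqI, (assumption | rule cauchy_rel_intros)+, simp add: scaleC_add_left)
  show "c *\<^sub>C d *\<^sub>C x = (c * d) *\<^sub>C x"
    by transfer (rule completion_eqI, (assumption | rule cauchy_rel_intros)+, simp add: scaleC_scaleC)
  show "c *\<^sub>C x * y = c *\<^sub>C (x * y)"
    by transfer (rule completion_eqI, (assumption | rule cauchy_rel_intros)+, simp add: scaleC_mult_left)
  show "x * c *\<^sub>C y = c *\<^sub>C (x * y)"
    by transfer (rule completion_eqI, (assumption | rule cauchy_rel_intros)+, simp add: scaleC_mult_right)
  show "adj (x + y) = adj x + adj y"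
    by transfer (rule completion_eqI, (assumption | rule cauchy_rel_intros)+, simp add: adj_add)
  show "adj (c *\<^sub>C x) = cnj c *\<^sub>C adj x"
    by transfer (rule completion_eqI, (assumption | rule cauchy_rel_intros)+, simp add: adj_scaleC)
  show "adj (x * y) = adj y * adj x"
    by transfer (rule completion_eqI, (assumption | rule cauchy_rel_intros)+, simp add: adj_mult)
  show "adj (adj x) = x" by transfer simp
  show "dist x y = norm (x - y)" by (rule dist_completion_def)
  show "sgn x = inverse (norm x) *\<^sub>R x" by (rule sgn_completion_def)
  show "uniformity = (INF e\<in>{0 <..}. principal {(x :: 'a completion, y). dist x y < e})"
    by (rule uniformity_completion_def)
  show "open U \<longleftrightarrow> (\<forall>x\<in>U. eventually (\<lambda>(x', y). x' = x \<longrightarrow> y \<in> U) uniformity)"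
    for U :: "'a completion set"
    by (rule open_completion_def)
  show "norm (x + y) \<le> norm x + norm y"
  proof transfer
    fix X Y :: "nat \<Rightarrow> 'a" assume XY: "cauchy_rel X X" "cauchy_rel Y Y"
    show "lim (\<lambda>n. norm (X n + Y n)) \<le> lim (\<lambda>n. norm (X n)) + lim (\<lambda>n. norm (Y n))"
      by (rule LIMSEQ_le[OF norm_limit[OF cauchy_rel_add[OF XY]]
            tendsto_add[OF norm_limit[OF XY(1)] norm_limit[OF XY(2)]]])
        (auto intro: norm_triangle_ineq)
  qed
  show "norm (x * y) \<le> norm x * norm y"
  proof transfer
    fix X Y :: "nat \<Rightarrow> 'a" assume XY: "cauchy_rel X X" "cauchy_rel Y Y"
    show "lim (\<lambda>n. norm (X n * Y n)) \<le> lim (\<lambda>n. norm (X n)) * lim (\<lambda>n. norm (Y n))"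
      by (rule LIMSEQ_le[OF norm_limit[OF cauchy_rel_mult[OF XY]]
            tendsto_mult[OF norm_limit[OF XY(1)] norm_limit[OF XY(2)]]])
        (auto intro: norm_mult_ineq)
  qed
  show "(norm x = 0) = (x = 0)"
  proof transfer
    fix X :: "nat \<Rightarrow> 'a" assume X: "cauchy_rel X X"
    have "lim (\<lambda>n. norm (X n)) = 0 \<longleftrightarrow> (\<lambda>n. norm (X n)) \<longlonglongrightarrow> 0"
      using norm_limit[OF X] LIMSEQ_unique by metis
    also have "\<dots> \<longleftrightarrow> cauchy_rel X (\<lambda>_. 0)"
      using X by (simp add: cauchy_rel_def tendsto_norm_zero_iff)
    finally show "(lim (\<lambda>n. norm (X n)) = 0) = cauchy_rel X (\<lambda>_. 0)" .
  qed
  show "norm (r *\<^sub>R x) = \<bar>r\<bar> * norm x"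
  proof transfer
    fix r and X :: "nat \<Rightarrow> 'a" assume X: "cauchy_rel X X"
    show "lim (\<lambda>n. norm (r *\<^sub>R X n)) = \<bar>r\<bar> * lim (\<lambda>n. norm (X n))"
      using tendsto_mult_left[OF norm_limit[OF X], of "\<bar>r\<bar>"] by (intro limI) simp
  qed
  show "norm (c *\<^sub>C x) = cmod c * norm x"
  proof transfer
    fix c and X :: "nat \<Rightarrow> 'a" assume X: "cauchy_rel X X"
    show "lim (\<lambda>n. norm (c *\<^sub>C X n)) = cmod c * lim (\<lambda>n. norm (X n))"
      using tendsto_mult_left[OF norm_limit[OF X], of "cmod c"] by (intro limI) (simp add: norm_scaleC)
  qed
  show "norm (adj x * x) = (norm x)\<^sup>2"
  proof transfer
    fix X :: "nat \<Rightarrow> 'a" assume X: "cauchy_rel X X"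
    show "lim (\<lambda>n. norm (adj (X n) * X n)) = (lim (\<lambda>n. norm (X n)))\<^sup>2"
      using tendsto_power[OF norm_limit[OF X], of 2] by (intro limI) (simp add: cstar_identity)
  qed
qed

end

lift_definition completion_of :: "'a::pre_cstar_algebra \<Rightarrow> 'a completion" is "\<lambda>a _. a"
  by (simp add: cauchy_rel_refl)

lemma norm_completion_of: "norm (completion_of a) = norm a"
  by transfer simp

lemma completion_of_diff: "completion_of (a - b) = completion_of a - completion_of b"
  by transfer (simp add: cauchy_rel_refl)

lemma completion_of_dense:
  assumes "0 < e"
  shows "\<exists>a. norm (x - completion_of a) < e"
  using assms
proof (transfer fixing: e)
  fix X :: "nat \<Rightarrow> 'a"
  assume X: "cauchy_rel X X"
  then obtain N where N: "\<And>n. n \<ge> N \<Longrightarrow> norm (X n - X N) < e / 2"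
    using CauchyD[of X "e / 2"] assms unfolding cauchy_rel_def by (meson half_gt_zero order_refl)
  have "cauchy_rel (\<lambda>n. X n - X N) (\<lambda>n. X n - X N)"
    using X Cauchy_add_seq[of X "\<lambda>_. - X N"] by (simp add: cauchy_rel_def)
  then have "lim (\<lambda>n. norm (X n - X N)) \<le> e / 2"
    by (rule LIMSEQ_le_const2[OF norm_limit]) (use N less_imp_le in blast)
  then show "\<exists>a. lim (\<lambda>n. norm (X n - a)) < e"
    using assms by (intro exI[of _ "X N"]) simp
qed

lemma completion_of_Cauchy_limit:
  assumes "Cauchy a"
  shows "\<exists>y. \<forall>e>0. \<exists>N. \<forall>k\<ge>N. norm (completion_of (a k) - y) \<le> e"
  using assms
proof (transfer fixing: a)
  assume a: "Cauchy a"
  have "\<exists>N. \<forall>k\<ge>N. lim (\<lambda>n. norm (a k - a n)) \<le> e" if e: "0 < e" for e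
  proof -
    obtain N where N: "\<And>m n. m \<ge> N \<Longrightarrow> n \<ge> N \<Longrightarrow> norm (a m - a n) < e"
      using CauchyD[OF a e] by blast
    have "lim (\<lambda>n. norm (a k - a n)) \<le> e" if k: "k \<ge> N" for k
    proof -
      have "cauchy_rel (\<lambda>n. a k - a n) (\<lambda>n. a k - a n)"
        using a Cauchy_diff_seq[of "\<lambda>_. a k" a] by (simp add: cauchy_rel_def)
      then show ?thesis
        by (rule LIMSEQ_le_const2[OF norm_limit]) (use N k less_imp_le in blast)
    qed
    then show ?thesis by blast
  qed
  then show "\<exists>y\<in>{X. cauchy_rel X X}. \<forall>e>0. \<exists>N. \<forall>k\<ge>N. lim (\<lambda>n. norm (a k - y n)) \<le> e"
    using a cauchy_rel_refl by blast
qed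

instance completion :: (pre_cstar_algebra) cstar_algebra
proof
  fix x :: "nat \<Rightarrow> 'a completion"
  assume x: "Cauchy x"
  have "\<forall>k. \<exists>a. norm (x k - completion_of a) < inverse (real (Suc k))"
    by (intro allI completion_of_dense) simp
  then obtain a where a: "\<And>k. norm (x k - completion_of (a k)) < inverse (real (Suc k))"
    by metis
  have d: "(\<lambda>k. x k - completion_of (a k)) \<longlonglongrightarrow> 0"
    by (rule Lim_null_comparison[OF _ LIMSEQ_inverse_real_of_nat])
      (use a less_imp_le in \<open>auto intro!: always_eventually\<close>)
  then have "Cauchy (\<lambda>k. x k - (x k - completion_of (a k)))"
    by (intro Cauchy_diff_seq x LIMSEQ_imp_Cauchy)
  then have "Cauchy (\<lambda>k. completion_of (a k))" by simp
  then have "Cauchy a"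
    unfolding Cauchy_iff completion_of_diff[symmetric] norm_completion_of .
  then obtain y where y: "\<And>e. 0 < e \<Longrightarrow> \<exists>N. \<forall>k\<ge>N. norm (completion_of (a k) - y) \<le> e"
    using completion_of_Cauchy_limit by blast
  have "(\<lambda>k. completion_of (a k)) \<longlonglongrightarrow> y"
  proof (rule LIMSEQ_I)
    fix r :: real assume r: "0 < r"
    then obtain N where "\<forall>k\<ge>N. norm (completion_of (a k) - y) \<le> r / 2" using y[of "r / 2"] by auto
    with r show "\<exists>N. \<forall>k\<ge>N. norm (completion_of (a k) - y) < r" by (intro exI[of _ N]) force
  qed
  from tendsto_add[OF d this] have "x \<longlonglongrightarrow> y" by simp
  then show "convergent x" by (auto simp: convergent_def)
qed

subsection \<open>The minimal C*-tensor product\<close>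

type_synonym ('a, 'b) min_tensor = "('a, 'b) alg_tensor completion"

definition tensor ::
    "'a::pre_cstar_algebra \<Rightarrow> 'b::pre_cstar_algebra \<Rightarrow> ('a, 'b) min_tensor"  (infixr \<open>\<otimes>\<close> 70)
  where "a \<otimes> b = completion_of (abs_alg_tensor [(a, b)])"

lemma completion_of_simps:
  "completion_of (x * y) = completion_of x * completion_of y"
  "completion_of (adj x) = adj (completion_of x)"
  "completion_of 1 = 1"
  by (transfer, simp add: cauchy_rel_refl)+

lemma tensor_mult: "(a \<otimes> b) * (c \<otimes> d) = (a * c) \<otimes> (b * d)"
  by (simp add: tensor_def completion_of_simps(1)[symmetric] times_alg_tensor.abs_eq lmult_def)

lemma tensor_adj: "adj (a \<otimes> b) = adj a \<otimes> adj b"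
  by (simp add: tensor_def completion_of_simps(2)[symmetric] adj_alg_tensor.abs_eq ladj_def)

lemma tensor_one: "1 \<otimes> 1 = 1"
  by (simp add: tensor_def one_alg_tensor_def[symmetric] completion_of_simps(3))

definition cspan :: "'a::pre_cstar_algebra set \<Rightarrow> 'a set"
  where "cspan S = {x. \<exists>n c s. (\<forall>i<n. s i \<in> S) \<and> x = (\<Sum>i<(n::nat). c i *\<^sub>C s i)}"

definition alg_tensor_set :: "'a::cstar_algebra set \<Rightarrow> 'b::cstar_algebra set \<Rightarrow> ('a, 'b) min_tensor set"
  where "alg_tensor_set B C = cspan {b \<otimes> c |b c. b \<in> B \<and> c \<in> C}"

text \<open>The minimal tensor product respects inclusions of C*-algebras, so for C*-subalgebras \<open>B\<close>
  and \<open>C\<close> the closure below is their minimal tensor product.\<close>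

definition min_tensor_set :: "'a::cstar_algebra set \<Rightarrow> 'b::cstar_algebra set \<Rightarrow> ('a, 'b) min_tensor set"
  where "min_tensor_set B C = closure (alg_tensor_set B C)"

text \<open>The bounded linear map on \<open>B \<otimes> C\<close> that sends \<open>b \<otimes> c\<close> to \<open>\<beta> b c\<close>. Being continuous, it is
  determined on \<^term>\<open>min_tensor_set B C\<close>; values outside this set are irrelevant.
  All maps of the form \<open>f \<otimes> g\<close>, including the slice maps (where \<open>\<complex> \<otimes> A\<close> and \<open>A \<otimes> \<complex>\<close> are
  identified with \<open>A\<close>), are instances.\<close>

definition tensor_lift ::
    "'a::cstar_algebra set \<Rightarrow> 'b::cstar_algebra set \<Rightarrow> ('a \<Rightarrow> 'b \<Rightarrow> 'c::cstar_algebra) \<Rightarrow>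
      ('a, 'b) min_tensor \<Rightarrow> 'c"
  where "tensor_lift B C \<beta> = (SOME F. bounded_clinear_on (min_tensor_set B C) F \<and>
    (\<forall>b\<in>B. \<forall>c\<in>C. F (b \<otimes> c) = \<beta> b c))"

definition tensor_map ::
    "'a::cstar_algebra set \<Rightarrow> ('a \<Rightarrow> 'c::cstar_algebra) \<Rightarrow> 'b::cstar_algebra set \<Rightarrow>
      ('b \<Rightarrow> 'd::cstar_algebra) \<Rightarrow> ('a, 'b) min_tensor \<Rightarrow> ('c, 'd) min_tensor"
  where "tensor_map B f C g = tensor_lift B C (\<lambda>b c. f b \<otimes> g c)"

definition slice_left ::
    "'a::cstar_algebra set \<Rightarrow> ('a \<Rightarrow> complex) \<Rightarrow> 'b::cstar_algebra set \<Rightarrow> ('a, 'b) min_tensor \<Rightarrow> 'b"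
  where "slice_left B \<phi> C = tensor_lift B C (\<lambda>b c. \<phi> b *\<^sub>C c)"

definition slice_right ::
    "'a::cstar_algebra set \<Rightarrow> 'b::cstar_algebra set \<Rightarrow> ('b \<Rightarrow> complex) \<Rightarrow> ('a, 'b) min_tensor \<Rightarrow> 'a"
  where "slice_right B C \<psi> = tensor_lift B C (\<lambda>b c. \<psi> c *\<^sub>C b)"

definition tensor_assoc ::
    "(('a::cstar_algebra, 'b::cstar_algebra) min_tensor, 'c::cstar_algebra) min_tensor \<Rightarrow>
      ('a, ('b, 'c) min_tensor) min_tensor"
  where "tensor_assoc = tensor_lift UNIV UNIV (\<lambda>t c. tensor_lift UNIV UNIV (\<lambda>a b. a \<otimes> b \<otimes> c) t)"

subsection \<open>Subalgebras and homomorphisms\<close>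

definition star_subalgebra :: "'a::cstar_algebra set \<Rightarrow> bool"
  where "star_subalgebra S \<longleftrightarrow> 0 \<in> S \<and> (\<forall>x\<in>S. \<forall>y\<in>S. x + y \<in> S \<and> x * y \<in> S) \<and>
    (\<forall>c. \<forall>x\<in>S. c *\<^sub>C x \<in> S) \<and> (\<forall>x\<in>S. adj x \<in> S)"

definition unital_cstar_subalgebra :: "'a::cstar_algebra set \<Rightarrow> bool"
  where "unital_cstar_subalgebra B \<longleftrightarrow> star_subalgebra B \<and> 1 \<in> B \<and> closed B"

definition unital_star_hom_on :: "'a::cstar_algebra set \<Rightarrow> ('a \<Rightarrow> 'b::cstar_algebra) \<Rightarrow> bool"
  where "unital_star_hom_on S f \<longleftrightarrow>
    (\<forall>x\<in>S. \<forall>y\<in>S. f (x + y) = f x + f y \<and> f (x * y) = f x * f y) \<and>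
    (\<forall>c. \<forall>x\<in>S. f (c *\<^sub>C x) = c *\<^sub>C f x) \<and> (\<forall>x\<in>S. f (adj x) = adj (f x)) \<and> f 1 = 1"

definition cstar_seminorm_on :: "'a::cstar_algebra set \<Rightarrow> ('a \<Rightarrow> real) \<Rightarrow> bool"
  where "cstar_seminorm_on S p \<longleftrightarrow>
    (\<forall>x\<in>S. 0 \<le> p x \<and> p (adj x * x) = (p x)\<^sup>2) \<and> (\<forall>c. \<forall>x\<in>S. p (c *\<^sub>C x) = cmod c * p x) \<and>
    (\<forall>x\<in>S. \<forall>y\<in>S. p (x + y) \<le> p x + p y \<and> p (x * y) \<le> p x * p y)"

subsection \<open>Compact quantum groups\<close>

definition coassociative :: "('a::cstar_algebra \<Rightarrow> ('a, 'a) min_tensor) \<Rightarrow> bool"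
  where "coassociative \<Phi> \<longleftrightarrow>
    (\<forall>a. tensor_assoc (tensor_map UNIV \<Phi> UNIV id (\<Phi> a)) = tensor_map UNIV id UNIV \<Phi> (\<Phi> a))"

definition unitary_rep :: "('a::cstar_algebra \<Rightarrow> ('a, 'a) min_tensor) \<Rightarrow> nat \<Rightarrow> (nat \<Rightarrow> nat \<Rightarrow> 'a) \<Rightarrow> bool"
  where "unitary_rep \<Phi> n u \<longleftrightarrow> (\<forall>i<n. \<forall>j<n.
    \<Phi> (u i j) = (\<Sum>k<n. u i k \<otimes> u k j) \<and>
    (\<Sum>k<n. adj (u k i) * u k j) = (if i = j then 1 else 0) \<and>
    (\<Sum>k<n. u i k * adj (u j k)) = (if i = j then 1 else 0))"

definition coeff_algebra :: "('a::cstar_algebra \<Rightarrow> ('a, 'a) min_tensor) \<Rightarrow> 'a set"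
  where "coeff_algebra \<Phi> = cspan {u i j |n u i j. unitary_rep \<Phi> n u \<and> i < n \<and> j < n}"

text \<open>The map \<open>m (\<kappa> \<otimes> id)\<close> need not be bounded, so the counit and antipode identities are stated
  for every representation of \<open>\<Phi> a\<close> as a finite sum of elementary tensors from \<open>\<A> \<otimes> \<A>\<close>.\<close>

definition hopf_star_algebra_on ::
    "'a::cstar_algebra set \<Rightarrow> ('a \<Rightarrow> ('a, 'a) min_tensor) \<Rightarrow> ('a \<Rightarrow> complex) \<Rightarrow> ('a \<Rightarrow> 'a) \<Rightarrow> bool"
  where "hopf_star_algebra_on \<A> \<Phi> \<epsilon> \<kappa> \<longleftrightarrow>
    star_subalgebra \<A> \<and> 1 \<in> \<A> \<and>
    (\<forall>a\<in>\<A>. \<Phi> a \<in> alg_tensor_set \<A> \<A>) \<and>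
    unital_star_hom_on \<A> \<epsilon> \<and>
    (\<forall>a\<in>\<A>. \<kappa> a \<in> \<A> \<and> \<kappa> (adj (\<kappa> (adj a))) = a \<and> (\<forall>c. \<kappa> (c *\<^sub>C a) = c *\<^sub>C \<kappa> a)) \<and>
    (\<forall>a\<in>\<A>. \<forall>b\<in>\<A>. \<kappa> (a + b) = \<kappa> a + \<kappa> b \<and> \<kappa> (a * b) = \<kappa> b * \<kappa> a) \<and>
    (\<forall>a\<in>\<A>. \<forall>n x y. (\<forall>i<n. x i \<in> \<A> \<and> y i \<in> \<A>) \<longrightarrow> \<Phi> a = (\<Sum>i<(n::nat). x i \<otimes> y i) \<longrightarrow>
      (\<Sum>i<n. \<epsilon> (x i) *\<^sub>C y i) = a \<and> (\<Sum>i<n. \<epsilon> (y i) *\<^sub>C x i) = a \<and>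
      (\<Sum>i<n. \<kappa> (x i) * y i) = \<epsilon> a *\<^sub>C 1 \<and> (\<Sum>i<n. x i * \<kappa> (y i)) = \<epsilon> a *\<^sub>C 1)"

text \<open>The last conjunct says that the algebra is the enveloping C*-algebra of its canonical dense
  Hopf *-algebra \<open>\<A>\<close>: the norm is the largest C*-seminorm on \<open>\<A>\<close>.\<close>

definition full_woronowicz_algebra :: "('a::cstar_algebra \<Rightarrow> ('a, 'a) min_tensor) \<Rightarrow> bool"
  where "full_woronowicz_algebra \<Phi> \<longleftrightarrow>
    unital_star_hom_on UNIV \<Phi> \<and> coassociative \<Phi> \<and>
    closure (coeff_algebra \<Phi>) = UNIV \<and>
    (\<exists>\<epsilon> \<kappa>. hopf_star_algebra_on (coeff_algebra \<Phi>) \<Phi> \<epsilon> \<kappa>) \<and>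
    (\<forall>p. cstar_seminorm_on (coeff_algebra \<Phi>) p \<longrightarrow> (\<forall>a\<in>coeff_algebra \<Phi>. p a \<le> norm a))"

text \<open>The counit of the dense Hopf *-algebra extends to the full C*-algebra.\<close>

definition counit :: "('a::cstar_algebra \<Rightarrow> ('a, 'a) min_tensor) \<Rightarrow> 'a \<Rightarrow> complex"
  where "counit \<Phi> = (THE \<epsilon>. unital_star_hom_on UNIV \<epsilon> \<and>
    (\<exists>\<kappa>. hopf_star_algebra_on (coeff_algebra \<Phi>) \<Phi> \<epsilon> \<kappa>))"

definition haar_state :: "('a::cstar_algebra \<Rightarrow> ('a, 'a) min_tensor) \<Rightarrow> ('a \<Rightarrow> complex) \<Rightarrow> bool"
  where "haar_state \<Phi> h \<longleftrightarrow> state h \<and>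
    (\<forall>a. slice_right UNIV UNIV h (\<Phi> a) = h a *\<^sub>C 1 \<and> slice_left UNIV h UNIV (\<Phi> a) = h a *\<^sub>C 1)"

definition woronowicz_morphism ::
    "('a::cstar_algebra \<Rightarrow> ('a, 'a) min_tensor) \<Rightarrow> ('b::cstar_algebra \<Rightarrow> ('b, 'b) min_tensor) \<Rightarrow>
      ('a \<Rightarrow> 'b) \<Rightarrow> bool"
  where "woronowicz_morphism \<Phi>\<^sub>1 \<Phi>\<^sub>2 \<theta> \<longleftrightarrow> unital_star_hom_on UNIV \<theta> \<and>
    (\<forall>a. tensor_map UNIV \<theta> UNIV \<theta> (\<Phi>\<^sub>1 a) = \<Phi>\<^sub>2 (\<theta> a))"

subsection \<open>Actions\<close>

definition cqg_action ::
    "('a::cstar_algebra \<Rightarrow> ('a, 'a) min_tensor) \<Rightarrow> 'b::cstar_algebra set \<Rightarrow>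
      ('b \<Rightarrow> ('b, 'a) min_tensor) \<Rightarrow> bool"
  where "cqg_action \<Phi> B \<alpha> \<longleftrightarrow>
    unital_cstar_subalgebra B \<and> unital_star_hom_on B \<alpha> \<and> \<alpha> ` B \<subseteq> min_tensor_set B UNIV \<and>
    (\<forall>b\<in>B. tensor_map B id UNIV \<Phi> (\<alpha> b) = tensor_assoc (tensor_map B \<alpha> UNIV id (\<alpha> b))) \<and>
    (\<forall>b\<in>B. slice_right B UNIV (counit \<Phi>) (\<alpha> b) = b) \<and>
    (\<exists>B\<^sub>0. star_subalgebra B\<^sub>0 \<and> B\<^sub>0 \<subseteq> B \<and> B \<subseteq> closure B\<^sub>0 \<and>
      \<alpha> ` B\<^sub>0 \<subseteq> alg_tensor_set B\<^sub>0 (coeff_algebra \<Phi>))"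

definition ergodic_action ::
    "('a::cstar_algebra \<Rightarrow> ('a, 'a) min_tensor) \<Rightarrow> 'b::cstar_algebra set \<Rightarrow>
      ('b \<Rightarrow> ('b, 'a) min_tensor) \<Rightarrow> bool"
  where "ergodic_action \<Phi> B \<alpha> \<longleftrightarrow> cqg_action \<Phi> B \<alpha> \<and>
    (\<forall>b\<in>B. \<alpha> b = b \<otimes> 1 \<longrightarrow> (\<exists>c. b = c *\<^sub>C 1))"

definition invariant_state ::
    "'b::cstar_algebra set \<Rightarrow> ('b \<Rightarrow> ('b, 'a::cstar_algebra) min_tensor) \<Rightarrow> ('b \<Rightarrow> complex) \<Rightarrow> bool"
  where "invariant_state B \<alpha> \<phi> \<longleftrightarrow> state_on B \<phi> \<and>
    (\<forall>b\<in>B. slice_left B \<phi> UNIV (\<alpha> b) = \<phi> b *\<^sub>C 1)"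

definition quotient_algebra ::
    "('g::cstar_algebra \<Rightarrow> ('g, 'g) min_tensor) \<Rightarrow> ('g \<Rightarrow> 'h::cstar_algebra) \<Rightarrow> 'g set"
  where "quotient_algebra \<Phi> \<theta> = {a. tensor_map UNIV \<theta> UNIV id (\<Phi> a) = 1 \<otimes> a}"

end

(*
  Slicing the first leg of the coproduct with h_H theta gives a projection E of C(G) onto C(H\G).
  By coassociativity Phi E = (E (x) id) Phi, and theta E = h_H theta, so E takes values in C(H\G) and
  Phi maps C(H\G) into C(H\G) (x) C(G). E maps the coefficient algebra into itself, so the
  coefficients in C(H\G) are dense. If Phi b = b (x) 1, the slice id (x) h_G shows b = h_G(b) 1; an
  invariant state w satisfies w(b) = h_G((w (x) id) Phi b) = w((id (x) h_G) Phi b) = h_G(b), and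
  h_G E = h_G by the same exchange of slices.

  All maps on minimal tensor products must be shown to be bounded for the spatial norm. This needs
  norming states and extensions of states, hence that x*x has spectrum in [0, oo) (Kelley and Vaught).
*)

theory Submission
  imports Defs
begin

text \<open>Each map on a minimal tensor product is a \<open>tensor_lift\<close>, a choice among
  bounded linear maps with prescribed values. Nothing can be computed from it before some bounded
  map with these values is exhibited. A formula on lists of pairs passes to the tensor product only
  with a bound by \<open>spatial_norm\<close>, which is a supremum over pairs of states of the
  factors. Norming states translate between such suprema and norms; for homomorphisms a crude bound
  suffices, because positivity sharpens it.

  The associator is the hard case: its target pairs one state with an arbitrary state of a tensor
  product, so it needs a slice estimate of its own.

  Maps on the smaller \<open>B \<otimes> C(G)\<close> are never built separately. They are
  restrictions of maps on \<open>C(G) \<otimes> C(G)\<close>, which for an invariant state on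
  \<open>B\<close> requires an extension to a state of \<open>C(G)\<close>.

  Spectral arguments are reduced to invertibility, obtained from Neumann series and factored
  polynomials; norms enter through the fact that a self-adjoint element of norm one has 1 or -1 in
  its spectrum.\<close>

section \<open>Arithmetic of complex scalars and the involution\<close>

lemma scaleC_zero_right [simp]: "c *\<^sub>C (0 :: 'a::pre_cstar_algebra) = 0"
  using scaleC_add_right[of c 0 "0 :: 'a"] by simp

lemma scaleC_minus_right: "c *\<^sub>C (- x) = - (c *\<^sub>C (x :: 'a::pre_cstar_algebra))"
  using scaleC_add_right[of c x "- x"] by (simp add: eq_neg_iff_add_eq_0 add.commute)

lemma scaleC_minus_left: "(- c) *\<^sub>C x = - (c *\<^sub>C (x :: 'a::pre_cstar_algebra))"
  using scaleC_add_left[of c "- c" x] by (simp add: eq_neg_iff_add_eq_0 add.commute)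

lemma scaleC_diff_right: "c *\<^sub>C (x - y) = c *\<^sub>C x - c *\<^sub>C (y :: 'a::pre_cstar_algebra)"
  using scaleC_add_right[of c x "- y"] by (simp add: scaleC_minus_right)

lemma scaleC_diff_left: "(c - d) *\<^sub>C x = c *\<^sub>C x - d *\<^sub>C (x :: 'a::pre_cstar_algebra)"
  using scaleC_add_left[of c "- d" x] by (simp add: scaleC_minus_left)

lemma scaleC_scaleR: "c *\<^sub>C r *\<^sub>R x = r *\<^sub>R c *\<^sub>C (x :: 'a::pre_cstar_algebra)"
  by (simp add: scaleC_of_real[symmetric] scaleC_scaleC mult.commute)

lemma scaleC_minus_one: "(- 1) *\<^sub>C x = - (x :: 'a::pre_cstar_algebra)"
  by (simp add: scaleC_minus_left)

lemma adj_zero [simp]: "adj (0 :: 'a::pre_cstar_algebra) = 0"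
  using adj_scaleC[of 0 "0 :: 'a"] by simp

lemma adj_minus: "adj (- x) = - adj (x :: 'a::pre_cstar_algebra)"
  using adj_diff[of 0 x] by simp

lemma adj_scaleR: "adj (r *\<^sub>R x) = r *\<^sub>R adj (x :: 'a::pre_cstar_algebra)"
  using adj_scaleC[of "complex_of_real r" x] by (simp add: scaleC_of_real)

lemmas scaleC_simps = scaleC_mult_left scaleC_mult_right scaleC_scaleC scaleC_add_right
  scaleC_add_left scaleC_diff_right scaleC_diff_left scaleC_minus_right scaleC_minus_left
  scaleC_scaleR

lemmas adj_simps = adj_add adj_diff adj_minus adj_mult adj_scaleC adj_scaleR

text \<open>In the zero algebra the unit has norm zero.\<close>

lemma norm_one_le: "norm (1 :: 'a::pre_cstar_algebra) \<le> 1"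
proof (rule ccontr)
  assume "\<not> ?thesis"
  then have "norm (1 :: 'a) * 1 < norm (1 :: 'a) * norm (1 :: 'a)"
    by (intro mult_strict_left_mono) auto
  then show False using cstar_identity[of "1 :: 'a"] by (metis adj_one less_irrefl mult_1_right power2_eq_square)
qed

section \<open>Invertible elements\<close>

definition has_inverse :: "'a::monoid_mult \<Rightarrow> bool"
  where "has_inverse x \<longleftrightarrow> (\<exists>y. x * y = 1 \<and> y * x = 1)"

lemma has_inverseI: "x * y = 1 \<Longrightarrow> z * x = 1 \<Longrightarrow> has_inverse x"
  unfolding has_inverse_def by (metis mult.assoc mult_1_left mult_1_right)

lemma has_inverse_mult: "has_inverse x \<Longrightarrow> has_inverse y \<Longrightarrow> has_inverse (x * y)"
  unfolding has_inverse_def by (metis mult.assoc mult_1_left)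

text \<open>Used contrapositively in \<open>positive_elem_adj_mult\<close>: a factor that is not
  invertible spoils a commuting product, which carries a spectral value through a
  polynomial.\<close>

lemma has_inverse_mult_commuting:
  assumes "has_inverse (x * y)" "x * y = y * x"
  shows "has_inverse x" "has_inverse y"
proof -
  obtain z where z: "x * y * z = 1" "z * (x * y) = 1"
    using assms(1) unfolding has_inverse_def by blast
  show "has_inverse x"
    by (rule has_inverseI[of x "y * z" "z * y"]) (metis z mult.assoc assms(2))+
  show "has_inverse y"
    by (rule has_inverseI[of y "x * z" "z * x"]) (metis z mult.assoc assms(2))+
qed

lemma inverse_commutes:
  fixes x y c :: "'a::monoid_mult"
  assumes "x * y = 1" "y * x = 1" "x * c = c * x"
  shows "y * c = c * y"
  by (metis assms mult.assoc mult_1_left mult_1_right)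

lemma has_inverse_scaleC:
  assumes "has_inverse (x :: 'a::pre_cstar_algebra)" "c \<noteq> 0"
  shows "has_inverse (c *\<^sub>C x)"
proof -
  obtain y where "x * y = 1" "y * x = 1" using assms(1) unfolding has_inverse_def by blast
  then show ?thesis using assms(2)
    by (intro has_inverseI[of _ "inverse c *\<^sub>C y" "inverse c *\<^sub>C y"]) (simp_all add: scaleC_simps)
qed

lemma has_inverse_scaleR:
  "has_inverse (x :: 'a::pre_cstar_algebra) \<Longrightarrow> r \<noteq> 0 \<Longrightarrow> has_inverse (r *\<^sub>R x)"
  using has_inverse_scaleC[of x "complex_of_real r"] by (simp add: scaleC_of_real)

lemma has_inverse_minus: "has_inverse (- x) \<longleftrightarrow> has_inverse (x :: 'a::pre_cstar_algebra)"
  using has_inverse_scaleC[of x "- 1"] has_inverse_scaleC[of "- x" "- 1"]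
  by (auto simp: scaleC_minus_one)

text \<open>The right and left inverses are the fixed points of the contractions
  \<open>y \<mapsto> 1 + x * y\<close> and \<open>y \<mapsto> 1 + y * x\<close>.\<close>

lemma neumann:
  fixes x :: "'a::cstar_algebra"
  assumes "norm x < 1"
  shows "has_inverse (1 - x)"
proof -
  have d: "dist (1 + x * y) (1 + x * z) \<le> norm x * dist y z"
    "dist (1 + y * x) (1 + z * x) \<le> norm x * dist y z" for y z
    using norm_mult_ineq[of x "y - z"] norm_mult_ineq[of "y - z" x]
    by (simp_all add: dist_norm algebra_simps)
  have "\<exists>!y. 1 + x * y = y"
    by (rule banach_fix_type[of "norm x" "\<lambda>y. 1 + x * y"]) (use d assms in auto)
  then obtain y where y: "1 + x * y = y" by blast
  have "\<exists>!y. 1 + y * x = y"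
    by (rule banach_fix_type[of "norm x" "\<lambda>y. 1 + y * x"]) (use d assms in auto)
  then obtain z where z: "1 + z * x = z" by blast
  show ?thesis
  proof (rule has_inverseI)
    show "(1 - x) * y = 1" using y by (simp add: left_diff_distrib diff_eq_eq)
    show "z * (1 - x) = 1" using z by (simp add: right_diff_distrib diff_eq_eq)
  qed
qed

lemma neumann_scaleC:
  fixes x :: "'a::cstar_algebra"
  assumes "norm x < cmod c"
  shows "has_inverse (c *\<^sub>C 1 - x)"
proof -
  have c: "c \<noteq> 0" using assms by auto
  have "norm (inverse c *\<^sub>C x) < 1"
    using assms c by (simp add: norm_scaleC norm_divide divide_simps)
  from has_inverse_scaleC[OF neumann[OF this] c] show ?thesis
    using c by (simp add: scaleC_simps)
qed

lemma neumann_scaleR: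
  fixes x :: "'a::cstar_algebra"
  assumes "norm x < \<bar>r\<bar>"
  shows "has_inverse (r *\<^sub>R 1 - x)" "has_inverse (r *\<^sub>R 1 + x)"
  using neumann_scaleC[of x "complex_of_real r"] neumann_scaleC[of "- x" "complex_of_real r"] assms
  by (simp_all add: scaleC_of_real)

section \<open>Self-adjoint elements\<close>

text \<open>Write \<open>s + i\<lambda>\<close> as \<open>i(\<lambda> + t) - (it - s)\<close>, where \<open>\<parallel>it - s\<parallel>\<^sup>2 \<le> t\<^sup>2 + \<parallel>s\<parallel>\<^sup>2\<close> is smaller than
  \<open>(\<lambda> + t)\<^sup>2\<close> for suitable \<open>t\<close>.\<close>

lemma selfadjoint_add_imaginary:
  fixes s :: "'a::cstar_algebra"
  assumes s: "adj s = s" and l: "l \<noteq> 0"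
  shows "has_inverse (s + (\<i> * complex_of_real l) *\<^sub>C 1)"
proof -
  \<comment> \<open>This choice gives 2 l t = 2 |s|^2, so (l + t)^2 exceeds t^2 + |s|^2 by l^2 +
    |s|^2.\<close>
  define t where "t = (norm s)\<^sup>2 / l"
  define y where "y = (\<i> * complex_of_real t) *\<^sub>C 1 - s"
  have "adj y * y = (t * t) *\<^sub>R 1 + s * s"
    using s by (simp add: y_def adj_simps scaleC_simps algebra_simps scaleC_of_real[symmetric])
  then have "(norm y)\<^sup>2 = norm ((t * t) *\<^sub>R 1 + s * s)" by (simp add: cstar_identity[symmetric])
  also have "\<dots> \<le> \<bar>t * t\<bar> * norm (1 :: 'a) + norm s * norm s"
    by (intro norm_triangle_le add_mono norm_mult_ineq) simp
  also have "\<dots> \<le> t * t * 1 + norm s * norm s"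
    by (intro add_mono mult_mono norm_one_le) auto
  also have "\<dots> < (l + t)\<^sup>2"
  proof -
    have "l * t = norm s * norm s" using l by (simp add: t_def power2_eq_square)
    moreover have "(l + t)\<^sup>2 = l * l + 2 * (l * t) + t * t"
      by (simp add: power2_eq_square algebra_simps)
    moreover have "0 < l * l" using l by (metis not_real_square_gt_zero)
    moreover have "0 \<le> norm s * norm s" by simp
    ultimately show ?thesis by linarith
  qed
  finally have "norm y < \<bar>l + t\<bar>" by (metis abs_norm_cancel power2_less_imp_less abs_ge_zero power2_abs)
  then have "norm y < cmod (\<i> * complex_of_real (l + t))"
    by (simp add: norm_mult flip: of_real_add)
  from neumann_scaleC[OF this] show ?thesis
    by (simp add: y_def scaleC_simps algebra_simps)
qed

text \<open>Factor over the complex numbers as (s + i sqrt l)(s - i sqrt l); both factors are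
  invertible because the spectrum of \<open>s\<close> is real.\<close>

lemma selfadjoint_square_shift:
  fixes s :: "'a::cstar_algebra"
  assumes s: "adj s = s" and l: "l > 0"
  shows "has_inverse (s * s + l *\<^sub>R 1)"
proof -
  have "has_inverse ((s + (\<i> * complex_of_real (sqrt l)) *\<^sub>C 1) * (s + (\<i> * complex_of_real (- sqrt l)) *\<^sub>C 1))"
    using l by (intro has_inverse_mult selfadjoint_add_imaginary s) auto
  also have "(s + (\<i> * complex_of_real (sqrt l)) *\<^sub>C 1) * (s + (\<i> * complex_of_real (- sqrt l)) *\<^sub>C 1)
      = s * s + complex_of_real (sqrt l * sqrt l) *\<^sub>C 1"
    by (simp add: algebra_simps scaleC_simps flip: of_real_mult)
  finally show ?thesis using l by (simp add: scaleC_of_real)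
qed

text \<open>The Cayley transform \<open>u = (s - i)(s + i)\<^sup>-\<^sup>1\<close> is unitary and \<open>s(1 + s\<^sup>2)\<^sup>-\<^sup>1\<close> is a
  multiple of its imaginary part.\<close>

lemma selfadjoint_cayley_bound:
  fixes s :: "'a::cstar_algebra"
  assumes s: "adj s = s"
  obtains w where "(1 + s * s) * w = 1" "w * (1 + s * s) = 1" "norm (s * w) \<le> 1 / 2"
proof -
  define p where "p = s + \<i> *\<^sub>C 1"
  define m where "m = s - \<i> *\<^sub>C 1"
  obtain v where v: "p * v = 1" "v * p = 1"
    using selfadjoint_add_imaginary[OF s, of 1] unfolding has_inverse_def p_def by auto
  have ap: "adj p = m" by (simp add: p_def m_def adj_simps s scaleC_simps)
  have am: "adj m = p" using ap by (metis adj_adj)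
  have pm: "p * m = 1 + s * s" "m * p = 1 + s * s"
    by (simp_all add: p_def m_def algebra_simps scaleC_simps)
  have v': "m * adj v = 1" "adj v * m = 1"
    using arg_cong[OF v(2), of adj] arg_cong[OF v(1), of adj] by (simp_all add: adj_mult ap)
  define w where "w = adj v * v"
  have qw: "(1 + s * s) * w = 1"
  proof -
    have "p * m * w = p * (m * adj v) * v" by (simp only: w_def mult.assoc)
    then show ?thesis by (simp add: v v' pm)
  qed
  have wq: "w * (1 + s * s) = 1"
  proof -
    have "w * (p * m) = adj v * (v * p) * m" by (simp only: w_def mult.assoc)
    then show ?thesis by (simp add: v v' pm)
  qed
  define u where "u = m * v"
  have au: "adj u = adj v * p" by (simp add: u_def adj_mult am)
  have "adj u * u = adj v * (p * m) * v" by (simp add: au) (simp add: u_def mult.assoc)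
  also have "\<dots> = (adj v * m) * (p * v)" by (simp only: pm(1) pm(2)[symmetric] mult.assoc)
  finally have "adj u * u = 1" by (simp add: v v')
  then have "(norm u)\<^sup>2 \<le> 1" using norm_one_le[where 'a='a] by (simp add: cstar_identity[symmetric])
  then have nu: "norm u \<le> 1" using power2_le_imp_le[of "norm u" 1] by simp
  have "u * (1 + s * s) = m * (v * p) * m" by (simp only: u_def pm(1)[symmetric] mult.assoc)
  moreover have "adj u * (1 + s * s) = (adj v * m) * (p * p)"
  proof -
    have "adj u * (1 + s * s) = adj v * (p * m * p)" by (simp only: au pm(2)[symmetric] mult.assoc)
    also have "p * m * p = m * p * p" by (simp only: pm)
    finally show ?thesis by (simp only: mult.assoc)
  qed
  ultimately have "(u - adj u) * (1 + s * s) = m * m - p * p"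
    by (simp add: left_diff_distrib v v')
  also have "\<dots> = (- 4 * \<i>) *\<^sub>C s"
  proof -
    have "m * m - p * p = - ((\<i> + \<i> + \<i> + \<i>) *\<^sub>C s)"
      unfolding scaleC_add_left by (simp add: p_def m_def algebra_simps scaleC_simps)
    then show ?thesis by (simp flip: scaleC_minus_left)
  qed
  finally have "(u - adj u) * (1 + s * s) * w = (- 4 * \<i>) *\<^sub>C (s * w)" by (simp only: scaleC_mult_left)
  then have "u - adj u = (- 4 * \<i>) *\<^sub>C (s * w)" by (simp add: mult.assoc qw)
  then have "4 * norm (s * w) = norm (u - adj u)" by (simp add: norm_scaleC norm_mult)
  also have "\<dots> \<le> 2" using norm_triangle_ineq4[of u "adj u"] nu by simp
  finally have "norm (s * w) \<le> 1 / 2" by simp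
  then show ?thesis using that[of w] qw wq by blast
qed

text \<open>Takes the place of the spectral radius formula: 1 or -1 is a spectral value of
  \<open>b\<close>. The powers \<open>b ^ (2 ^ n)\<close> keep norm one by the C*-identity, whereas
  an inverse of \<open>1 - b * b\<close> would force them to tend to 0.\<close>

lemma selfadjoint_norm_one_not_invertible:
  fixes b :: "'a::cstar_algebra"
  assumes b: "adj b = b" "norm b = 1"
  shows "\<not> has_inverse (1 - b * b)"
proof
  assume "has_inverse (1 - b * b)"
  then obtain d where d: "(1 - b * b) * d = 1" "d * (1 - b * b) = 1"
    unfolding has_inverse_def by blast
  define s where "s n = b ^ (2 ^ n)" for n
  have s0: "s 0 = b" by (simp add: s_def)
  have sS: "s (Suc n) = s n * s n" for n by (simp add: s_def mult_2 power_add)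
  have sa: "adj (s n) = s n" for n by (induction n) (simp_all add: s0 sS b adj_mult)
  have sn: "norm (s n) = 1" for n
  proof (induction n)
    case (Suc n)
    then show ?case using cstar_identity[of "s n"] by (simp add: sS sa)
  qed (simp add: s0 b)
  have sb: "s n * b = b * s n" for n by (simp add: s_def power_commutes)
  \<comment> \<open>Telescoping: \<open>s n\<close> is \<open>b\<close> times the product of the
    \<open>s k\<close> with k < n, and \<open>1 - b * b\<close> times the product of the
    \<open>1 + s k * s k\<close> is \<open>1 - s n * s n\<close>. So \<open>z\<close> is the product
    of the quotients of \<open>s k\<close> by \<open>1 + s k * s k\<close>, each of norm at most 1/2
    by the Cayley bound.\<close>
  have "\<exists>z. norm z \<le> (1 / 2) ^ n \<and> z * b = b * z \<and> s n * (1 - b * b) = b * z * (1 - s n * s n)" for n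
  proof (induction n)
    case 0
    show ?case by (rule exI[of _ 1]) (simp add: s0 norm_one_le)
  next
    case (Suc n)
    then obtain z where z: "norm z \<le> (1 / 2) ^ n" "z * b = b * z"
      "s n * (1 - b * b) = b * z * (1 - s n * s n)" by blast
    obtain w where w: "(1 + s n * s n) * w = 1" "w * (1 + s n * s n) = 1" "norm (s n * w) \<le> 1 / 2"
      using selfadjoint_cayley_bound[OF sa] by blast
    have wb: "w * b = b * w"
    proof (rule inverse_commutes[OF w(1,2)])
      have "s n * s n * b = b * (s n * s n)" by (metis mult.assoc sb)
      then show "(1 + s n * s n) * b = b * (1 + s n * s n)" by (simp add: algebra_simps)
    qed
    have zs: "z * s n = s n * z"
      unfolding s_def using z(2) by (metis power_commuting_commutes)
    let ?z = "s n * z * w"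
    have "s (Suc n) * (1 - b * b) = s n * (b * z * (1 - s n * s n))"
      by (simp add: sS mult.assoc z(3))
    also have "\<dots> = b * (s n * z) * (1 - s n * s n)"
      by (simp add: mult.assoc[symmetric] sb)
    also have "\<dots> = b * (s n * z) * (w * (1 + s n * s n)) * (1 - s n * s n)" by (simp add: w)
    also have "b * (s n * z) * (w * (1 + s n * s n)) * (1 - s n * s n)
      = b * (s n * z * w) * ((1 + s n * s n) * (1 - s n * s n))" by (simp add: mult.assoc)
    also have "(1 + s n * s n) * (1 - s n * s n) = 1 - s (Suc n) * s (Suc n)"
      by (simp add: sS algebra_simps)
    finally have "s (Suc n) * (1 - b * b) = b * ?z * (1 - s (Suc n) * s (Suc n))" .
    moreover have "?z * b = b * ?z"
      by (metis mult.assoc sb z(2) wb)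
    moreover have "norm ?z \<le> (1 / 2) ^ Suc n"
    proof -
      have "?z = z * (s n * w)" by (simp add: zs mult.assoc[symmetric])
      then have "norm ?z \<le> norm z * norm (s n * w)" by (simp add: norm_mult_ineq)
      also have "\<dots> \<le> (1 / 2) ^ n * (1 / 2)" by (intro mult_mono z w) auto
      finally show ?thesis by simp
    qed
    ultimately show ?case by blast
  qed
  then obtain z where z: "\<And>n. norm (z n) \<le> (1 / 2) ^ n"
    "\<And>n. s n * (1 - b * b) = b * z n * (1 - s n * s n)" by metis
  have "1 \<le> (1 / 2) ^ n * (2 * norm d)" for n
  proof -
    have "s n = b * z n * (1 - s n * s n) * d"
      unfolding z(2)[symmetric] by (simp add: mult.assoc d)
    then have "1 = norm (b * z n * (1 - s n * s n) * d)" using sn[of n] by simp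
    also have "\<dots> \<le> norm b * norm (z n) * norm (1 - s n * s n) * norm d"
      by (intro order_trans[OF norm_mult_ineq] mult_right_mono norm_ge_zero norm_mult_ineq)
    also have "\<dots> \<le> 1 * (1 / 2) ^ n * (1 + 1 * 1) * norm d"
    proof (intro mult_mono)
      have "norm (1 - s n * s n) \<le> norm (1 :: 'a) + norm (s n) * norm (s n)"
        by (intro order_trans[OF norm_triangle_ineq4] add_mono norm_mult_ineq order_refl)
      then show "norm (1 - s n * s n) \<le> 1 + 1 * 1" using norm_one_le[where 'a='a] by (simp add: sn)
    qed (use z b in auto)
    finally show ?thesis by simp
  qed
  moreover have "(\<lambda>n. (1 / 2) ^ n * (2 * norm d)) \<longlonglongrightarrow> 0"
    by (intro tendsto_mult_left_zero LIMSEQ_realpow_zero) auto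
  ultimately have "(1 :: real) \<le> 0" by (intro LIMSEQ_le_const) auto
  then show False by simp
qed

section \<open>Contractivity of unital homomorphisms\<close>

lemma star_hom_simps:
  assumes "unital_star_hom_on UNIV f"
  shows "f (x + y) = f x + f y" "f (x * y) = f x * f y" "f (c *\<^sub>C x) = c *\<^sub>C f x"
    "f (adj x) = adj (f x)" "f 1 = 1" "f 0 = 0" "f (- x) = - f x" "f (x - y) = f x - f y"
    "f (r *\<^sub>R x) = r *\<^sub>R f x"
proof -
  show *: "f (x + y) = f x + f y" "f (x * y) = f x * f y" "f (c *\<^sub>C x) = c *\<^sub>C f x"
    "f (adj x) = adj (f x)" "f 1 = 1" for x y c
    using assms by (simp_all add: unital_star_hom_on_def)
  show "f 0 = 0" using *(3)[of 0 0] by simp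
  show m: "f (- x) = - f x" for x using *(3)[of "- 1" x] by (simp add: scaleC_minus_one)
  show "f (x - y) = f x - f y" using *(1)[of x "- y"] by (simp add: m)
  show "f (r *\<^sub>R x) = r *\<^sub>R f x" by (simp flip: scaleC_of_real add: *(3))
qed

lemma star_hom_has_inverse:
  "unital_star_hom_on UNIV f \<Longrightarrow> has_inverse x \<Longrightarrow> has_inverse (f x)"
  unfolding has_inverse_def by (metis star_hom_simps(2,5))

text \<open>If a self-adjoint element grew in norm, rescaling would give \<open>c\<close> of norm
  below 1 whose image has norm 1. Then \<open>1 - c * c\<close> is invertible by the Neumann series
  but its image is not. The C*-identity reduces the general case to this one.\<close>

lemma star_hom_contractive:
  fixes f :: "'a::cstar_algebra \<Rightarrow> 'b::cstar_algebra"
  assumes f: "unital_star_hom_on UNIV f"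
  shows "norm (f x) \<le> norm x"
proof -
  note h = star_hom_simps[OF f]
  have sa: "norm (f a) \<le> norm a" if a: "adj a = a" for a
  proof (rule ccontr)
    assume "\<not> ?thesis"
    then have lt: "norm a < norm (f a)" by simp
    define t where "t = norm (f a)"
    define c where "c = inverse t *\<^sub>R a"
    have t: "t > 0" using lt norm_ge_zero[of a] unfolding t_def by linarith
    have nc: "norm c < 1" using lt t by (simp add: c_def t_def divide_simps)
    have "norm (c * c) < 1"
      using nc norm_mult_ineq[of c c] mult_strict_mono[of "norm c" 1 "norm c" 1] by auto
    then have "has_inverse (f (1 - c * c))" by (rule star_hom_has_inverse[OF f neumann])
    moreover have "adj (f c) = f c" using a by (simp add: h(4)[symmetric] c_def adj_scaleR)
    moreover have "norm (f c) = 1" using t by (simp add: c_def h t_def)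
    ultimately show False using selfadjoint_norm_one_not_invertible[of "f c"] by (simp add: h)
  qed
  have "(norm (f x))\<^sup>2 = norm (f (adj x * x))" by (simp add: h cstar_identity)
  also have "\<dots> \<le> norm (adj x * x)" by (rule sa) (simp add: adj_mult)
  also have "\<dots> = (norm x)\<^sup>2" by (rule cstar_identity)
  finally show ?thesis using power2_le_imp_le[OF _ norm_ge_zero] by blast
qed

section \<open>Positive elements\<close>

text \<open>The spectrum of a self-adjoint element is real, so this says that it lies in \<open>[0, \<infinity>)\<close>.\<close>

definition positive_elem :: "'a::cstar_algebra \<Rightarrow> bool"
  where "positive_elem a \<longleftrightarrow> adj a = a \<and> (\<forall>l>0. has_inverse (a + l *\<^sub>R 1))"

text \<open>After division by \<open>norm s\<close> the two shifts multiply to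
  \<open>1 - b * b\<close> with \<open>b\<close> self-adjoint of norm one.\<close>

lemma selfadjoint_norm_in_spectrum:
  fixes s :: "'a::cstar_algebra"
  assumes s: "adj s = s" "s \<noteq> 0"
    and inv: "has_inverse (norm s *\<^sub>R 1 - s)" "has_inverse (norm s *\<^sub>R 1 + s)"
  shows False
proof -
  define b where "b = inverse (norm s) *\<^sub>R s"
  have "has_inverse ((inverse (norm s) *\<^sub>R (norm s *\<^sub>R 1 - s)) * (inverse (norm s) *\<^sub>R (norm s *\<^sub>R 1 + s)))"
    using inv s by (intro has_inverse_mult has_inverse_scaleR) auto
  also have "(inverse (norm s) *\<^sub>R (norm s *\<^sub>R 1 - s)) * (inverse (norm s) *\<^sub>R (norm s *\<^sub>R 1 + s)) = 1 - b * b"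
    using s(2) by (simp add: b_def algebra_simps)
  finally show False
    using selfadjoint_norm_one_not_invertible[of b] s by (simp add: b_def adj_scaleR)
qed

text \<open>The spectrum of \<open>a\<close> lies in [-t, t], so that of \<open>t - a\<close> lies
  in [0, 2t]; positivity of \<open>a\<close> confines it to [0, t], which for a self-adjoint element
  is a bound on the norm. A norm condition, unlike a spectral one, behaves well under sums.\<close>

lemma positive_elem_iff_norm:
  fixes a :: "'a::cstar_algebra"
  assumes a: "adj a = a" "norm a \<le> t"
  shows "positive_elem a \<longleftrightarrow> norm (t *\<^sub>R 1 - a) \<le> t"
proof
  assume p: "positive_elem a"
  show "norm (t *\<^sub>R 1 - a) \<le> t"
  proof (rule ccontr)
    assume neg: "\<not> ?thesis"
    define s where "s = t *\<^sub>R 1 - a"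
    have lt: "t < norm s" using neg by (simp add: s_def)
    have t: "0 \<le> t" using a(2) norm_ge_zero[of a] by linarith
    have "has_inverse ((norm s + t) *\<^sub>R 1 - a)"
      by (rule neumann_scaleR) (use lt t a in linarith)
    then have 1: "has_inverse (norm s *\<^sub>R 1 + s)" by (simp add: s_def scaleR_left_distrib algebra_simps)
    have "has_inverse (a + (norm s - t) *\<^sub>R 1)" using p lt by (simp add: positive_elem_def)
    then have 2: "has_inverse (norm s *\<^sub>R 1 - s)" by (simp add: s_def scaleR_left_diff_distrib algebra_simps)
    have "adj s = s" by (simp add: s_def adj_simps a)
    moreover have "s \<noteq> 0" using lt t by auto
    ultimately show False using 1 2 selfadjoint_norm_in_spectrum by blast
  qed
next
  assume n: "norm (t *\<^sub>R 1 - a) \<le> t"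
  show "positive_elem a" unfolding positive_elem_def
  proof (intro conjI allI impI a)
    fix l :: real assume "l > 0"
    have "has_inverse ((t + l) *\<^sub>R 1 - (t *\<^sub>R 1 - a))"
      by (rule neumann_scaleR) (use n \<open>l > 0\<close> in linarith)
    then show "has_inverse (a + l *\<^sub>R 1)" by (simp add: scaleR_left_distrib algebra_simps)
  qed
qed

text \<open>The triangle inequality for the norm criterion, with t = |a| + |b|.\<close>

lemma positive_elem_add:
  assumes "positive_elem a" "positive_elem b"
  shows "positive_elem (a + b)"
proof -
  have sa: "adj a = a" "adj b = b" using assms by (auto simp: positive_elem_def)
  have "norm (norm a *\<^sub>R 1 - a) \<le> norm a" "norm (norm b *\<^sub>R 1 - b) \<le> norm b"
    using assms positive_elem_iff_norm sa by blast+
  then have "norm ((norm a *\<^sub>R 1 - a) + (norm b *\<^sub>R 1 - b)) \<le> norm a + norm b"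
    by (intro norm_triangle_le add_mono)
  then have "norm ((norm a + norm b) *\<^sub>R 1 - (a + b)) \<le> norm a + norm b"
    by (simp add: algebra_simps)
  then show ?thesis
    using positive_elem_iff_norm[of "a + b" "norm a + norm b"] sa norm_triangle_ineq
    by (auto simp: adj_add)
qed

lemma positive_elem_shift:
  assumes "adj s = s" "norm s \<le> N"
  shows "positive_elem (N *\<^sub>R 1 - s)"
  unfolding positive_elem_def
proof (intro conjI allI impI)
  fix l :: real assume "l > 0"
  have "has_inverse ((N + l) *\<^sub>R 1 - s)" by (rule neumann_scaleR) (use assms \<open>l > 0\<close> in linarith)
  then show "has_inverse (N *\<^sub>R 1 - s + l *\<^sub>R 1)" by (simp add: algebra_simps)
qed (simp add: adj_simps assms)

lemma positive_elem_zero: "positive_elem (0 :: 'a::cstar_algebra)"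
  using positive_elem_shift[of "0 :: 'a" 0] by simp

lemma positive_elem_scaleR:
  assumes "positive_elem a" "0 \<le> r"
  shows "positive_elem (r *\<^sub>R a)"
proof (cases "r = 0")
  case False
  show ?thesis unfolding positive_elem_def
  proof (intro conjI allI impI)
    fix l :: real assume "l > 0"
    then have "has_inverse (a + (l / r) *\<^sub>R 1)"
      using assms False unfolding positive_elem_def by (metis divide_pos_pos order_less_le)
    then have "has_inverse (r *\<^sub>R (a + (l / r) *\<^sub>R 1))" using False by (rule has_inverse_scaleR)
    then show "has_inverse (r *\<^sub>R a + l *\<^sub>R 1)" using False by (simp add: scaleR_right_distrib)
  qed (use assms in \<open>simp add: positive_elem_def adj_scaleR\<close>)
qed (simp add: positive_elem_zero)

lemma positive_elem_square: "adj s = s \<Longrightarrow> positive_elem (s * s)"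
  by (simp add: positive_elem_def adj_mult selfadjoint_square_shift)

lemma positive_elem_norm_le:
  assumes b: "positive_elem b" and Nb: "positive_elem (N *\<^sub>R 1 - b)" and N: "0 \<le> N"
  shows "norm b \<le> N"
proof (rule ccontr)
  assume "\<not> ?thesis"
  then have lt: "N < norm b" by simp
  with N have b0: "b \<noteq> 0" by auto
  have "has_inverse (N *\<^sub>R 1 - b + (norm b - N) *\<^sub>R 1)"
    using Nb lt unfolding positive_elem_def by (metis diff_gt_0_iff_gt)
  then have "has_inverse (norm b *\<^sub>R 1 - b)" by (simp add: algebra_simps)
  moreover have "has_inverse (b + norm b *\<^sub>R 1)"
    using b lt N unfolding positive_elem_def by (metis order_le_less_trans)
  ultimately show False
    using selfadjoint_norm_in_spectrum[of b] b b0 by (auto simp: positive_elem_def add.commute)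
qed

text \<open>The nonzero spectral values of \<open>x * y\<close> and \<open>y * x\<close> agree. The
  inverse \<open>?d\<close> is what the geometric series for (l + y x)^-1 suggests, after the inner
  sum is recognised as (l + x y)^-1.\<close>

lemma has_inverse_swap:
  fixes x y :: "'a::cstar_algebra"
  assumes "has_inverse (x * y + l *\<^sub>R 1)" "l \<noteq> 0"
  shows "has_inverse (y * x + l *\<^sub>R 1)"
proof -
  obtain c where c: "(x * y + l *\<^sub>R 1) * c = 1" "c * (x * y + l *\<^sub>R 1) = 1"
    using assms(1) unfolding has_inverse_def by blast
  let ?d = "inverse l *\<^sub>R (1 - y * c * x)"
  have "(y * x + l *\<^sub>R 1) * (1 - y * c * x) = y * x + l *\<^sub>R 1 - y * ((x * y + l *\<^sub>R 1) * c) * x"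
    by (simp add: algebra_simps)
  then have 1: "(y * x + l *\<^sub>R 1) * (1 - y * c * x) = l *\<^sub>R 1" by (simp add: c)
  have "(1 - y * c * x) * (y * x + l *\<^sub>R 1) = y * x + l *\<^sub>R 1 - y * (c * (x * y + l *\<^sub>R 1)) * x"
    by (simp add: algebra_simps)
  then have 2: "(1 - y * c * x) * (y * x + l *\<^sub>R 1) = l *\<^sub>R 1" by (simp add: c)
  show ?thesis by (rule has_inverseI[of _ ?d ?d]) (use assms(2) 1 2 in simp_all)
qed

text \<open>The condition excludes spectral values above 1; these are nonzero, hence common to
  \<open>adj z * z\<close> and \<open>z * adj z\<close>.\<close>

lemma positive_elem_swap:
  fixes z :: "'a::cstar_algebra"
  assumes "positive_elem (1 - adj z * z)"
  shows "positive_elem (1 - z * adj z)"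
  unfolding positive_elem_def
proof (intro conjI allI impI)
  fix l :: real assume l: "l > 0"
  have "has_inverse (- (1 - adj z * z + l *\<^sub>R 1))"
    using assms l unfolding has_inverse_minus positive_elem_def by blast
  then have "has_inverse (adj z * z + (- (1 + l)) *\<^sub>R 1)" by (simp add: algebra_simps)
  then have "has_inverse (z * adj z + (- (1 + l)) *\<^sub>R 1)" by (rule has_inverse_swap) (use l in auto)
  then have "has_inverse (- (1 - z * adj z + l *\<^sub>R 1))" by (simp add: algebra_simps)
  then show "has_inverse (1 - z * adj z + l *\<^sub>R 1)" unfolding has_inverse_minus .
qed (simp add: adj_simps)

text \<open>For \<open>\<mu> > 1\<close> the cubic \<open>\<mu> - t(1 - t)\<^sup>2\<close> has a single real root, and it exceeds \<open>4/3\<close>.\<close>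

lemma positive_elem_cubic:
  fixes a :: "'a::cstar_algebra"
  assumes a: "adj a = a" "positive_elem (1 - a)"
  shows "positive_elem (1 - a * (1 - a) * (1 - a))"
  unfolding positive_elem_def
proof (intro conjI allI impI)
  show "adj (1 - a * (1 - a) * (1 - a)) = 1 - a * (1 - a) * (1 - a)"
    by (simp add: adj_simps a algebra_simps)
  fix l :: real assume l: "l > 0"
  have "\<exists>r\<ge>1. r \<le> 2 + (1 + l) \<and> r * (r - 1)\<^sup>2 = 1 + l"
  proof (rule IVT')
    have "(1 + l) * 1 \<le> (2 + (1 + l)) * ((2 + (1 + l)) - 1)\<^sup>2"
      using l by (intro mult_mono) auto
    then show "1 + l \<le> (2 + (1 + l)) * ((2 + (1 + l)) - 1)\<^sup>2" by simp
  qed (use l in \<open>auto intro!: continuous_intros\<close>)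
  then obtain r where r: "r \<ge> 1" "r * (r - 1)\<^sup>2 = 1 + l" by blast
  have r43: "r > 4 / 3"
  proof (rule ccontr)
    assume "\<not> ?thesis"
    then have "r * (r - 1)\<^sup>2 \<le> 4 / 3 * (1 / 3)\<^sup>2"
      using r(1) by (intro mult_mono power_mono) auto
    then show False using r(2) l by (simp add: power2_eq_square)
  qed
  \<comment> \<open>Dividing the cubic 1 + l - t (1 - t)^2 by r - t leaves t^2 + p t + q. Completing
    the square leaves r (3 r - 4) / 4, which is where the bound 4/3 comes from.\<close>
  define p where "p = r - 2"
  define q where "q = (r - 1)\<^sup>2"
  have sq: "a * a + p *\<^sub>R a + q *\<^sub>R 1 = (a + (p / 2) *\<^sub>R 1) * (a + (p / 2) *\<^sub>R 1) + (q - (p / 2)\<^sup>2) *\<^sub>R 1"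
  proof -
    have "(p / 2) *\<^sub>R a + (p / 2) *\<^sub>R a = p *\<^sub>R a" by (simp flip: scaleR_left_distrib)
    then show ?thesis by (simp add: algebra_simps power2_eq_square)
  qed
  have "q - (p / 2)\<^sup>2 = r * (3 * r - 4) / 4" by (simp add: p_def q_def power2_eq_square field_simps)
  also have "\<dots> > 0" using r43 by simp
  finally have qp: "q - (p / 2)\<^sup>2 > 0" .
  have i1: "has_inverse (a * a + p *\<^sub>R a + q *\<^sub>R 1)"
    unfolding sq by (rule selfadjoint_square_shift[OF _ qp]) (simp add: adj_simps a)
  have "has_inverse (1 - a + (r - 1) *\<^sub>R 1)"
    using a(2) r43 by (simp add: positive_elem_def)
  then have i2: "has_inverse (r *\<^sub>R 1 - a)" by (simp add: algebra_simps)
  have "(r *\<^sub>R 1 - a) * (a * a + p *\<^sub>R a + q *\<^sub>R 1)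
      = (r * q) *\<^sub>R 1 + (r * p - q) *\<^sub>R a + (r - p) *\<^sub>R (a * a) - a * a * a"
    by (simp add: algebra_simps)
  also have "r * p - q = - 1" by (simp add: p_def q_def power2_eq_square algebra_simps)
  also have "r - p = 2" by (simp add: p_def)
  also have "r * q = 1 + l" using r by (simp add: q_def)
  also have "(1 + l) *\<^sub>R 1 + (- 1) *\<^sub>R a + 2 *\<^sub>R (a * a) - a * a * a = 1 - a * (1 - a) * (1 - a) + l *\<^sub>R 1"
    by (simp add: algebra_simps scaleR_2)
  finally show "has_inverse (1 - a * (1 - a) * (1 - a) + l *\<^sub>R 1)"
    using has_inverse_mult[OF i2 i1] by simp
qed

text \<open>If \<open>- l\<close>, \<open>l > 0\<close>, is in the spectrum of \<open>x\<^sup>* x \<le> 1\<close>, then replacing \<open>x\<close> by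
  \<open>x (1 - x\<^sup>* x)\<close> makes the spectrum of \<open>x\<^sup>* x\<close> contain \<open>- l (1 + l)\<^sup>2\<close> and keeps \<open>x\<^sup>* x \<le> 1\<close>. After
  some iterations this contradicts \<open>x\<^sup>* x + x x\<^sup>* \<ge> 0\<close>, as \<open>x x\<^sup>* \<le> 1\<close>.\<close>

theorem positive_elem_adj_mult:
  fixes x :: "'a::cstar_algebra"
  shows "positive_elem (adj x * x)"
proof -
  have one: "has_inverse (adj x * x + l *\<^sub>R 1)"
    if x: "norm x \<le> 1" and l: "l > 0" for x :: 'a and l
  proof (rule ccontr)
    assume ni: "\<not> has_inverse (adj x * x + l *\<^sub>R 1)"
    \<comment> \<open>Each step gains at least 2 l^2, because m (1 + m)^2 \<ge> m + 2 m^2 and m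
      \<ge> l. Linear growth suffices, as only m > 1 is wanted.\<close>
    have it: "\<exists>(z :: 'a) m. positive_elem (1 - adj z * z) \<and> l + 2 * real n * (l * l) \<le> m \<and>
        \<not> has_inverse (adj z * z + m *\<^sub>R 1)" for n
    proof (induction n)
      case 0
      have "norm (adj x * x) \<le> 1" using x by (simp add: cstar_identity power_le_one)
      then have "positive_elem (1 *\<^sub>R 1 - adj x * x)" by (intro positive_elem_shift) (simp_all add: adj_mult)
      then have "positive_elem (1 - adj x * x) \<and> l + 2 * real 0 * (l * l) \<le> l \<and>
          \<not> has_inverse (adj x * x + l *\<^sub>R 1)" using ni by simp
      then show ?case by blast
    next
      case (Suc n)
      then obtain z :: 'a and m where z: "positive_elem (1 - adj z * z)" "l + 2 * real n * (l * l) \<le> m"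
        "\<not> has_inverse (adj z * z + m *\<^sub>R 1)" by blast
      define a where "a = adj z * z"
      define y where "y = z * (1 - a)"
      have aa: "adj a = a" by (simp add: a_def adj_mult)
      have yy: "adj y * y = a * (1 - a) * (1 - a)"
      proof -
        have "adj y * y = (1 - a) * a * (1 - a)"
          by (simp add: y_def adj_simps aa) (simp add: a_def mult.assoc)
        then show ?thesis by (simp add: algebra_simps)
      qed
      have p: "positive_elem (1 - adj y * y)"
        unfolding yy by (rule positive_elem_cubic) (use z aa in \<open>simp_all add: a_def\<close>)
      let ?m = "m * (1 + m)\<^sup>2"
      have "0 \<le> 2 * real n * (l * l)" using l by simp
      with z(2) have lm: "l \<le> m" by linarith
      have "l * l \<le> m * m" using lm l by (intro mult_mono) auto
      moreover have "?m = m + 2 * (m * m) + m * (m * m)" by (simp add: power2_eq_square algebra_simps)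
      moreover have "0 \<le> m * (m * m)" using lm l by simp
      ultimately have mm: "l + 2 * real (Suc n) * (l * l) \<le> ?m" using z(2) by (simp add: algebra_simps)
      \<comment> \<open>The polynomial t (1 - t)^2 + m (1 + m)^2 vanishes at t = -m, and
        \<open>?q\<close> is the cofactor of t + m.\<close>
      let ?q = "a * a - a - a - m *\<^sub>R a + 1 *\<^sub>R 1 + m *\<^sub>R 1 + m *\<^sub>R 1 + (m * m) *\<^sub>R 1"
      have f: "a * (1 - a) * (1 - a) + m *\<^sub>R 1 + (m * m) *\<^sub>R 1 + (m * m) *\<^sub>R 1 + (m * (m * m)) *\<^sub>R 1
          = (a + m *\<^sub>R 1) * ?q"
        "(a + m *\<^sub>R 1) * ?q = ?q * (a + m *\<^sub>R 1)"
        by (simp_all add: algebra_simps)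
      have "?m = m + m * m + m * m + m * (m * m)" by (simp add: power2_eq_square algebra_simps)
      with f(1) have f1: "adj y * y + ?m *\<^sub>R 1 = (a + m *\<^sub>R 1) * ?q"
        by (simp only: yy scaleR_left_distrib add.assoc)
      have "\<not> has_inverse (adj y * y + ?m *\<^sub>R 1)"
        using has_inverse_mult_commuting(1)[OF _ f(2)] z(3) unfolding f1 a_def by blast
      with p mm show ?case by blast
    qed
    obtain n where n: "1 < real n * (2 * (l * l))"
      using ex_less_of_nat_mult[of "2 * (l * l)" 1] l by auto
    obtain z :: 'a and m where z: "positive_elem (1 - adj z * z)" "l + 2 * real n * (l * l) \<le> m"
      "\<not> has_inverse (adj z * z + m *\<^sub>R 1)" using it[of n] by blast
    have "2 * real n * (l * l) = real n * (2 * (l * l))" by simp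
    with z(2) n l have m: "1 < m" by linarith
    \<comment> \<open>The real and imaginary parts of \<open>z\<close>: with z = u + i v, the cross
      terms cancel in \<open>adj z * z + z * adj z\<close>, leaving twice the sum of the
      squares.\<close>
    define u where "u = (1 / 2) *\<^sub>R (z + adj z)"
    define v where "v = (1 / 2) *\<^sub>R \<i> *\<^sub>C (adj z - z)"
    have "positive_elem (2 *\<^sub>R (u * u + v * v))"
      by (intro positive_elem_scaleR positive_elem_add positive_elem_square)
        (simp_all add: u_def v_def adj_simps scaleC_simps algebra_simps)
    also have "2 *\<^sub>R (u * u + v * v) = adj z * z + z * adj z"
    proof -
      have "u * u = (1 / 4) *\<^sub>R ((z + adj z) * (z + adj z))" by (simp add: u_def)
      moreover have "(\<i> *\<^sub>C y) * (\<i> *\<^sub>C y) = - (y * y)" for y :: 'a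
        by (simp add: scaleC_mult_left scaleC_mult_right scaleC_scaleC scaleC_minus_one)
      then have "v * v = (1 / 4) *\<^sub>R (- ((adj z - z) * (adj z - z)))"
        by (simp add: v_def)
      ultimately have "2 *\<^sub>R (u * u + v * v) =
          (1 / 2) *\<^sub>R ((z + adj z) * (z + adj z) - (adj z - z) * (adj z - z))"
        by (simp add: scaleR_right_diff_distrib)
      also have "(z + adj z) * (z + adj z) - (adj z - z) * (adj z - z) = 2 *\<^sub>R (adj z * z + z * adj z)"
        by (simp add: algebra_simps scaleR_2)
      finally show ?thesis by simp
    qed
    finally have "positive_elem ((adj z * z + z * adj z) + (1 - z * adj z))"
      by (rule positive_elem_add[OF _ positive_elem_swap[OF z(1)]])
    then have "positive_elem (1 + adj z * z)" by (simp add: algebra_simps)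
    then have "has_inverse (1 + adj z * z + (m - 1) *\<^sub>R 1)" using m by (simp add: positive_elem_def)
    with z(3) show False by (simp add: algebra_simps)
  qed
  show ?thesis
  proof (cases "x = 0")
    case False
    define y where "y = inverse (norm x) *\<^sub>R x"
    have "norm y \<le> 1" using False by (simp add: y_def)
    then have "positive_elem (adj y * y)" unfolding positive_elem_def using one by (simp add: adj_mult)
    then have "positive_elem ((norm x * norm x) *\<^sub>R (adj y * y))" by (intro positive_elem_scaleR) auto
    moreover have "norm x * norm x * (inverse (norm x) * inverse (norm x)) = 1"
      using False by (simp add: field_simps)
    ultimately show ?thesis by (simp add: y_def adj_scaleR)
  qed (simp add: positive_elem_zero)
qed

section \<open>States\<close>

text \<open>A cone that is maximal among those without \<open>- 1\<close> is a half-space, and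
  \<open>x \<mapsto> inf {t. t - x \<in> M}\<close> is the functional that defines it.\<close>

theorem state_from_cone:
  fixes K :: "'a::cstar_algebra set"
  assumes K_add: "\<And>x y. x \<in> K \<Longrightarrow> y \<in> K \<Longrightarrow> x + y \<in> K"
    and K_scale: "\<And>x r. x \<in> K \<Longrightarrow> 0 \<le> r \<Longrightarrow> r *\<^sub>R x \<in> K"
    and K_pos: "\<And>x. positive_elem x \<Longrightarrow> x \<in> K"
    and K_anti: "\<And>x. adj x = - x \<Longrightarrow> x \<in> K"
    and K_proper: "- 1 \<notin> K"
  obtains \<psi> where "state \<psi>" "\<And>x. x \<in> K \<Longrightarrow> 0 \<le> Re (\<psi> x)"
proof -
  define cone where "cone M \<longleftrightarrow> (\<forall>x\<in>M. \<forall>y\<in>M. x + y \<in> M) \<and> (\<forall>x\<in>M. \<forall>r\<ge>0. r *\<^sub>R x \<in> M)"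
    for M :: "'a set"
  define F where "F = {M. K \<subseteq> M \<and> cone M \<and> - 1 \<notin> M}"
  have "\<exists>M\<in>F. \<forall>X\<in>F. M \<subseteq> X \<longrightarrow> X = M"
  proof (rule subset_Zorn_nonempty)
    have "K \<in> F" using K_add K_scale K_proper by (simp add: F_def cone_def)
    then show "F \<noteq> {}" by blast
    fix C assume C: "C \<noteq> {}" "subset.chain F C"
    then have CF: "\<And>X. X \<in> C \<Longrightarrow> K \<subseteq> X \<and> cone X \<and> - 1 \<notin> X"
      and ch: "\<And>X Y. X \<in> C \<Longrightarrow> Y \<in> C \<Longrightarrow> X \<subseteq> Y \<or> Y \<subseteq> X"
      unfolding subset_chain_def F_def by blast+
    have "x + y \<in> \<Union>C" if "x \<in> \<Union>C" "y \<in> \<Union>C" for x y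
    proof -
      obtain X Y where XY: "X \<in> C" "Y \<in> C" "x \<in> X" "y \<in> Y" using \<open>x \<in> \<Union>C\<close> \<open>y \<in> \<Union>C\<close> by blast
      have "cone X" "cone Y" using CF XY by auto
      with ch[OF XY(1,2)] XY show ?thesis unfolding cone_def by (metis UnionI subsetD)
    qed
    moreover have "r *\<^sub>R x \<in> \<Union>C" if "x \<in> \<Union>C" "0 \<le> r" for x r
      using that CF unfolding cone_def by blast
    ultimately show "\<Union>C \<in> F" using C(1) CF unfolding F_def cone_def by blast
  qed
  then obtain M where MF: "M \<in> F" and max: "\<And>X. X \<in> F \<Longrightarrow> M \<subseteq> X \<Longrightarrow> X = M" by blast
  from MF have KM: "K \<subseteq> M" and M_add: "\<And>x y. x \<in> M \<Longrightarrow> y \<in> M \<Longrightarrow> x + y \<in> M"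
    and M_scale: "\<And>x r. x \<in> M \<Longrightarrow> 0 \<le> r \<Longrightarrow> r *\<^sub>R x \<in> M" and M_proper: "- 1 \<notin> M"
    unfolding F_def cone_def by auto
  have M0: "0 \<in> M" using K_pos[OF positive_elem_zero] KM by blast
  have M_real: "0 \<le> r" if "r *\<^sub>R 1 \<in> M" for r
  proof (rule ccontr)
    assume "\<not> 0 \<le> r"
    with M_scale[OF that, of "- (1 / r)"] M_proper show False by simp
  qed
  have ext: "\<exists>m\<in>M. \<exists>t>0. - 1 = m + t *\<^sub>R x" if "x \<notin> M" for x
  proof -
    define M' where "M' = {m + t *\<^sub>R x |m t. m \<in> M \<and> 0 \<le> t}"
    have "M \<subseteq> M'"
    proof
      fix m assume "m \<in> M"
      then have "m + 0 *\<^sub>R x \<in> M'" unfolding M'_def by blast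
      then show "m \<in> M'" by simp
    qed
    moreover have "x \<in> M'"
    proof -
      have "0 + 1 *\<^sub>R x \<in> M'" unfolding M'_def using M0 zero_le_one by blast
      then show ?thesis by simp
    qed
    moreover have "cone M'"
      unfolding cone_def
    proof (intro conjI ballI allI impI)
      fix y z assume "y \<in> M'" "z \<in> M'"
      then obtain m t n s where "y = m + t *\<^sub>R x" "m \<in> M" "0 \<le> t" "z = n + s *\<^sub>R x" "n \<in> M" "0 \<le> s"
        unfolding M'_def by blast
      then have "y + z = (m + n) + (t + s) *\<^sub>R x \<and> m + n \<in> M \<and> 0 \<le> t + s"
        by (simp add: M_add algebra_simps)
      then show "y + z \<in> M'" unfolding M'_def by blast
    next
      fix y and r :: real assume "y \<in> M'" "0 \<le> r"
      then obtain m t where "y = m + t *\<^sub>R x" "m \<in> M" "0 \<le> t" unfolding M'_def by blast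
      then have "r *\<^sub>R y = r *\<^sub>R m + (r * t) *\<^sub>R x \<and> r *\<^sub>R m \<in> M \<and> 0 \<le> r * t"
        using \<open>0 \<le> r\<close> by (simp add: M_scale algebra_simps)
      then show "r *\<^sub>R y \<in> M'" unfolding M'_def by blast
    qed
    ultimately have "- 1 \<in> M'" using max[of M'] KM that unfolding F_def by blast
    then obtain m t where mt: "m \<in> M" "0 \<le> t" "- 1 = m + t *\<^sub>R x" unfolding M'_def by blast
    moreover have "t \<noteq> 0"
    proof
      assume "t = 0"
      with mt(3) have "- 1 = m" by simp
      with mt(1) M_proper show False by simp
    qed
    ultimately show ?thesis using order_less_le by metis
  qed
  \<comment> \<open>If neither lies in \<open>M\<close>, adjoining either one produces -1. The
    combination weighted by \<open>s\<close> and \<open>t\<close> cancels \<open>x\<close> and puts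
    a negative multiple of 1 into \<open>M\<close>.\<close>
  have total: "x \<in> M \<or> - x \<in> M" for x
  proof (rule ccontr)
    assume "\<not> ?thesis"
    then obtain m t n s where mt: "m \<in> M" "t > 0" "- 1 = m + t *\<^sub>R x" "n \<in> M" "s > 0" "- 1 = n + s *\<^sub>R (- x)"
      using ext[of x] ext[of "- x"] by blast
    have "(- (s + t)) *\<^sub>R 1 = s *\<^sub>R (m + t *\<^sub>R x) + t *\<^sub>R (n + s *\<^sub>R (- x))"
      unfolding mt(3,6)[symmetric] by (simp add: algebra_simps)
    also have "\<dots> = s *\<^sub>R m + t *\<^sub>R n" by (simp add: algebra_simps)
    also have "\<dots> \<in> M" by (intro M_add M_scale) (use mt in auto)
    finally show False using M_real mt by fastforce
  qed
  define T where "T x = {t. t *\<^sub>R 1 - x \<in> M}" for x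
  define f where "f x = Inf (T x)" for x
  have T_norm: "norm x \<in> T x" for x
  proof -
    \<comment> \<open>Here x = h - z with \<open>h\<close> self-adjoint and \<open>z\<close> skew.
      The skew part costs nothing, since every skew element lies in the cone.\<close>
    define h where "h = (1 / 2) *\<^sub>R (x + adj x)"
    define z where "z = (1 / 2) *\<^sub>R (adj x - x)"
    have "norm h \<le> norm x" using norm_triangle_ineq[of x "adj x"] by (simp add: h_def)
    then have "norm x *\<^sub>R 1 - h \<in> M"
      using K_pos[OF positive_elem_shift[of h]] KM by (auto simp: h_def adj_simps add.commute)
    moreover have "z \<in> M"
      using K_anti[of z] KM by (auto simp: z_def adj_simps simp flip: scaleR_minus_right)
    ultimately have "norm x *\<^sub>R 1 - h + z \<in> M" by (rule M_add)
    also have "norm x *\<^sub>R 1 - h + z = norm x *\<^sub>R 1 - (1 / 2 + 1 / 2) *\<^sub>R x"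
      unfolding h_def z_def scaleR_left_distrib by (simp add: algebra_simps)
    finally show ?thesis by (simp add: T_def)
  qed
  have T_add: "s + t \<in> T (x + y)" if "s \<in> T x" "t \<in> T y" for s t x y
    using M_add[of "s *\<^sub>R 1 - x" "t *\<^sub>R 1 - y"] that by (simp add: T_def algebra_simps)
  have T_lower: "- norm x \<le> t" if "t \<in> T x" for x t
    using T_add[OF that T_norm[of "- x"]] M_real[of "t + norm x"] by (simp add: T_def)
  have f_le: "f x \<le> t" if "t \<in> T x" for x t
    unfolding f_def using that T_lower by (auto intro!: cInf_lower bdd_belowI)
  have f_ge: "c \<le> f x" if "\<And>t. t \<in> T x \<Longrightarrow> c \<le> t" for x c
    unfolding f_def using that T_norm by (intro cInf_greatest) auto
  have f_bound: "\<bar>f x\<bar> \<le> norm x" for x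
    using f_le[OF T_norm] f_ge[OF T_lower] by (simp add: abs_le_iff minus_le_iff)
  have f_sub: "f (x + y) \<le> f x + f y" for x y
  proof -
    have "f (x + y) - f y \<le> s" if "s \<in> T x" for s
    proof -
      have "f (x + y) - s \<le> f y"
      proof (rule f_ge)
        fix t assume "t \<in> T y"
        from f_le[OF T_add[OF that this]] show "f (x + y) - s \<le> t" by simp
      qed
      then show ?thesis by simp
    qed
    then have "f (x + y) - f y \<le> f x" by (rule f_ge)
    then show ?thesis by simp
  qed
  have f_le_minus: "f (- x) \<le> - f x" for x
  proof (rule ccontr)
    assume "\<not> ?thesis"
    then obtain s where s: "- f (- x) < s" "s < f x" using dense[of "- f (- x)" "f x"] by auto
    have "s *\<^sub>R 1 - x \<notin> M" using f_le[of s x] s by (auto simp: T_def)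
    then have "- (s *\<^sub>R 1 - x) \<in> M" using total by blast
    then have "- s \<in> T (- x)" by (simp add: T_def)
    from f_le[OF this] s show False by simp
  qed
  have f_zero: "0 \<le> f 0" by (rule f_ge) (use M_real in \<open>simp add: T_def\<close>)
  have f_minus: "f (- x) = - f x" for x
    using f_sub[of x "- x"] f_zero f_le_minus[of x] by simp
  have f_add: "f (x + y) = f x + f y" for x y
    using f_sub[of x y] f_sub[of "x + y" "- y"] by (simp add: f_minus)
  have f_scale_le: "f (r *\<^sub>R x) \<le> r * f x" if "r > 0" for r x
  proof -
    have "f (r *\<^sub>R x) / r \<le> t" if "t \<in> T x" for t
    proof -
      have "r * t \<in> T (r *\<^sub>R x)"
        using M_scale[of "t *\<^sub>R 1 - x" r] that \<open>r > 0\<close> by (simp add: T_def scaleR_right_diff_distrib)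
      from f_le[OF this] \<open>r > 0\<close> show ?thesis by (simp add: field_simps)
    qed
    then have "f (r *\<^sub>R x) / r \<le> f x" by (rule f_ge)
    with that show ?thesis by (simp add: field_simps)
  qed
  have f_scale_pos: "f (r *\<^sub>R x) = r * f x" if "r > 0" for r x
  proof (rule antisym[OF f_scale_le[OF that]])
    have "f (inverse r *\<^sub>R r *\<^sub>R x) \<le> inverse r * f (r *\<^sub>R x)" by (rule f_scale_le) (use that in simp)
    then show "r * f x \<le> f (r *\<^sub>R x)" using that by (simp add: field_simps)
  qed
  have f0: "f 0 = 0" using f_minus[of 0] by simp
  have f_scale: "f (r *\<^sub>R x) = r * f x" for r x
  proof (cases r "0 :: real" rule: linorder_cases)
    case less
    then show ?thesis using f_scale_pos[of "- r" x] f_minus[of "r *\<^sub>R x"] by simp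
  qed (auto simp: f0 f_scale_pos)
  have f_pos: "0 \<le> f x" if "x \<in> M" for x
    using f_le[of 0 "- x"] that by (simp add: T_def f_minus)
  have f_anti: "f x = 0" if "adj x = - x" for x
  proof -
    have "x \<in> M" "- x \<in> M" using K_anti[of x] K_anti[of "- x"] that KM by (auto simp: adj_minus)
    from f_pos[OF this(1)] f_pos[OF this(2)] show ?thesis by (simp add: f_minus)
  qed
  have f1: "f 1 = 1"
  proof (rule antisym)
    show "f 1 \<le> 1" by (rule f_le) (simp add: T_def M0)
    show "1 \<le> f 1"
    proof (rule f_ge)
      fix t assume "t \<in> T 1"
      then have "(t - 1) *\<^sub>R 1 \<in> M" by (simp add: T_def algebra_simps)
      from M_real[OF this] show "1 \<le> t" by simp
    qed
  qed
  \<comment> \<open>The usual complexification of a real functional. As \<open>f\<close> vanishes on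
    skew elements, \<psi> is real on self-adjoint ones.\<close>
  define \<psi> where "\<psi> x = Complex (f x) (- f (\<i> *\<^sub>C x))" for x
  have s: "c *\<^sub>C x = Re c *\<^sub>R x + Im c *\<^sub>R \<i> *\<^sub>C x" for c and x :: 'a
  proof -
    have "c = complex_of_real (Re c) + complex_of_real (Im c) * \<i>" by (simp add: complex_eq_iff)
    then have "c *\<^sub>C x = (complex_of_real (Re c) + complex_of_real (Im c) * \<i>) *\<^sub>C x" by simp
    then show ?thesis by (simp only: scaleC_add_left scaleC_scaleC[symmetric] scaleC_of_real)
  qed
  have ii: "\<i> *\<^sub>C \<i> *\<^sub>C x = - x" for x :: 'a by (simp add: scaleC_simps)
  have fc: "f (c *\<^sub>C x) = Re c * f x + Im c * f (\<i> *\<^sub>C x)" for c x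
    by (subst s) (simp only: f_add f_scale)
  have add: "\<psi> (x + y) = \<psi> x + \<psi> y" for x y
    by (simp add: \<psi>_def f_add scaleC_add_right complex_eq_iff)
  have sc: "\<psi> (c *\<^sub>C x) = c * \<psi> x" for c x
  proof -
    have "\<i> *\<^sub>C c *\<^sub>C x = c *\<^sub>C \<i> *\<^sub>C x" by (simp add: scaleC_scaleC mult.commute)
    then show ?thesis by (simp add: \<psi>_def complex_eq_iff fc[of c] ii f_minus algebra_simps)
  qed
  have bd: "cmod (\<psi> x) \<le> 2 * norm x" for x
    using cmod_le[of "\<psi> x"] f_bound[of x] f_bound[of "\<i> *\<^sub>C x"] by (simp add: \<psi>_def norm_scaleC)
  have "state \<psi>"
    unfolding state_on_def bounded_clinear_on_def
  proof (intro conjI allI ballI)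
    show "\<exists>K. \<forall>x\<in>UNIV. norm (\<psi> x) \<le> K * norm x" using bd by blast
    show "\<psi> 1 = 1" using f1 f_anti[of "\<i> *\<^sub>C 1"] by (simp add: \<psi>_def complex_eq_iff adj_simps scaleC_simps)
    fix x
    have "adj x * x \<in> M" using K_pos[OF positive_elem_adj_mult] KM by blast
    then show "0 \<le> Re (\<psi> (adj x * x))" by (simp add: \<psi>_def f_pos)
    show "Im (\<psi> (adj x * x)) = 0"
      using f_anti[of "\<i> *\<^sub>C (adj x * x)"] by (simp add: \<psi>_def adj_simps scaleC_simps)
  qed (simp_all add: add sc scaleC_complex_def)
  moreover have "0 \<le> Re (\<psi> x)" if "x \<in> K" for x using f_pos[of x] that KM by (auto simp: \<psi>_def)
  ultimately show ?thesis by (rule that)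
qed

lemma state_simps:
  assumes "state \<phi>"
  shows "\<phi> (x + y) = \<phi> x + \<phi> y" "\<phi> (c *\<^sub>C x) = c * \<phi> x" "\<phi> 1 = 1" "\<phi> 0 = 0"
    "\<phi> (- x) = - \<phi> x" "\<phi> (x - y) = \<phi> x - \<phi> y" "\<phi> (r *\<^sub>R x) = complex_of_real r * \<phi> x"
proof -
  show *: "\<phi> (x + y) = \<phi> x + \<phi> y" "\<phi> (c *\<^sub>C x) = c * \<phi> x" "\<phi> 1 = 1" for x y c
    using assms by (simp_all add: state_on_def bounded_clinear_on_def scaleC_complex_def)
  show "\<phi> 0 = 0" using *(2)[of 0 0] by simp
  show m: "\<phi> (- x) = - \<phi> x" for x using *(2)[of "- 1" x] by (simp add: scaleC_minus_one)
  show "\<phi> (x - y) = \<phi> x - \<phi> y" using *(1)[of x "- y"] by (simp add: m)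
  show "\<phi> (r *\<^sub>R x) = complex_of_real r * \<phi> x" by (simp flip: scaleC_of_real add: *(2))
qed

lemma state_pos:
  assumes "state \<phi>"
  shows "0 \<le> Re (\<phi> (adj x * x))" "Im (\<phi> (adj x * x)) = 0"
  using assms by (simp_all add: state_on_def)

lemma state_boundedE:
  assumes "state \<phi>"
  obtains K where "\<And>x. cmod (\<phi> x) \<le> K * norm x"
  using assms unfolding state_on_def bounded_clinear_on_def by auto

text \<open>Any bound \<open>C\<close> improves to the value at the unit: Cauchy-Schwarz against 1
  reduces to \<open>adj z * z\<close>, where \<open>positive_functional_bound\<close>
  applies.\<close>

lemma positive_functional_norm:
  fixes f :: "'a::pre_cstar_algebra \<Rightarrow> complex"
  assumes add: "\<And>x y. f (x + y) = f x + f y" and sc: "\<And>c x. f (c *\<^sub>C x) = c * f x"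
    and pos: "\<And>x. Im (f (adj x * x)) = 0" "\<And>x. Re (f (adj x * x)) \<ge> 0"
    and bdd: "\<And>x. cmod (f x) \<le> C * norm x"
  shows "cmod (f z) \<le> Re (f 1) * norm z"
proof (rule power2_le_imp_le)
  have "(cmod (f z))\<^sup>2 \<le> Re (f 1) * Re (f (adj z * z))"
    using positive_functional_cauchy_schwarz[of f 1 z] add sc pos by simp
  also have "\<dots> \<le> Re (f 1) * ((norm z)\<^sup>2 * Re (f 1))"
    using positive_functional_bound[of f C z] assms pos(2)[of 1] by (intro mult_left_mono) auto
  finally show "(cmod (f z))\<^sup>2 \<le> (Re (f 1) * norm z)\<^sup>2" by (simp add: power2_eq_square mult_ac)
  show "0 \<le> Re (f 1) * norm z" using pos(2)[of 1] by simp
qed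

lemma state_norm_le:
  assumes "state \<phi>"
  shows "cmod (\<phi> x) \<le> norm x"
proof -
  obtain K where K: "\<And>x. cmod (\<phi> x) \<le> K * norm x" using state_boundedE[OF assms] by blast
  have "cmod (\<phi> x) \<le> Re (\<phi> 1) * norm x"
    by (rule positive_functional_norm[OF _ _ _ _ K]) (simp_all add: state_simps[OF assms] state_pos[OF assms])
  then show ?thesis by (simp add: state_simps[OF assms])
qed

text \<open>A state that is nonnegative on \<open>b - norm b\<close> has value at least
  \<open>norm b\<close> at \<open>b\<close>. The cone generated by this element, the positive and
  the skew elements omits -1; otherwise \<open>b\<close> would be bounded above by norm b - 1/t for
  some t > 0, or 1 would be 0.\<close>

lemma ex_norming_state:
  fixes b :: "'a::cstar_algebra"
  assumes b: "positive_elem b" "b \<noteq> 0"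
  shows "\<exists>\<psi>. state \<psi> \<and> Re (\<psi> b) = norm b"
proof -
  define u where "u = b - norm b *\<^sub>R 1"
  define K where "K = {c + t *\<^sub>R u + z |c t z. positive_elem c \<and> 0 \<le> t \<and> adj z = - z}"
  have KI: "c + t *\<^sub>R u + z \<in> K" if "positive_elem c" "0 \<le> t" "adj z = - z" for c t z
    using that unfolding K_def by blast
  obtain \<psi> where \<psi>: "state \<psi>" "\<And>x. x \<in> K \<Longrightarrow> 0 \<le> Re (\<psi> x)"
  proof (rule state_from_cone[of K])
    fix x y assume "x \<in> K" "y \<in> K"
    then obtain c t z d s w where "x = c + t *\<^sub>R u + z" "positive_elem c" "0 \<le> t" "adj z = - z"
      "y = d + s *\<^sub>R u + w" "positive_elem d" "0 \<le> s" "adj w = - w"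
      unfolding K_def by blast
    then show "x + y \<in> K"
      using KI[of "c + d" "t + s" "z + w"] by (simp add: positive_elem_add adj_add algebra_simps)
  next
    fix x and r :: real assume "x \<in> K" "0 \<le> r"
    then obtain c t z where "x = c + t *\<^sub>R u + z" "positive_elem c" "0 \<le> t" "adj z = - z"
      unfolding K_def by blast
    then show "r *\<^sub>R x \<in> K"
      using KI[of "r *\<^sub>R c" "r * t" "r *\<^sub>R z"] \<open>0 \<le> r\<close>
      by (simp add: positive_elem_scaleR adj_scaleR algebra_simps)
  next
    show "x \<in> K" if "positive_elem x" for x using KI[OF that, of 0 0] by simp
    show "x \<in> K" if "adj x = - x" for x using KI[OF positive_elem_zero, of 0 x] that by simp
    show "- 1 \<notin> K"
    proof
      assume "- 1 \<in> K"
      then obtain c t z where c: "- 1 = c + t *\<^sub>R u + z" "positive_elem c" "0 \<le> t" "adj z = - z"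
        unfolding K_def by blast
      have bb: "adj b = b" using b by (simp add: positive_elem_def)
      have "adj (- 1) = c + t *\<^sub>R u - z"
        unfolding c(1) using c(2,4) by (simp add: u_def adj_simps bb positive_elem_def)
      then have "c + t *\<^sub>R u + z = c + t *\<^sub>R u - z"
        by (simp add: adj_minus c(1)[symmetric])
      then have "z = - z" by simp
      then have "z = 0" by (simp add: eq_neg_iff_add_eq_0 flip: scaleR_2)
      then have c': "c = (t * norm b - 1) *\<^sub>R 1 - t *\<^sub>R b"
        using c(1) by (simp add: u_def algebra_simps eq_diff_eq)
      show False
      proof (cases "t = 0")
        case True
        then have "c = (- 1) *\<^sub>R 1" using c' by simp
        then have "has_inverse ((- 1) *\<^sub>R 1 + 1 *\<^sub>R (1 :: 'a))" using c(2) unfolding positive_elem_def by (metis zero_less_one)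
        then have "(0 :: 'a) = 1" unfolding has_inverse_def by auto
        then have "b = 0" by (metis mult_1_left mult_zero_left)
        with b show False by simp
      next
        case False
        with c(3) have t: "t > 0" by simp
        define N where "N = norm b - 1 / t"
        have "(1 / t) *\<^sub>R c = ((1 / t) * (t * norm b - 1)) *\<^sub>R 1 - ((1 / t) * t) *\<^sub>R b"
          unfolding c' by (simp only: scaleR_right_diff_distrib scaleR_scaleR)
        also have "(1 / t) * (t * norm b - 1) = N" using t by (simp add: N_def field_simps)
        also have "(1 / t) * t = 1" using t by simp
        finally have "(1 / t) *\<^sub>R c = N *\<^sub>R 1 - b" by simp
        then have p: "positive_elem (N *\<^sub>R 1 - b)" using positive_elem_scaleR[OF c(2), of "1 / t"] t by simp
        \<comment> \<open>\<open>N\<close> may be negative, while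
          \<open>positive_elem_norm_le\<close> asks for a nonnegative bound; the maximum with 0
          covers both cases, as \<open>b\<close> is nonzero.\<close>
        have "positive_elem (N *\<^sub>R 1 - b + (max N 0 - N) *\<^sub>R 1)"
          using positive_elem_scaleR[of "1 :: 'a" "max N 0 - N"] positive_elem_square[of "1 :: 'a"]
          by (intro positive_elem_add p) simp
        then have "positive_elem (max N 0 *\<^sub>R 1 - b)" by (simp add: algebra_simps)
        then have "norm b \<le> max N 0" by (intro positive_elem_norm_le b) auto
        with t b show False by (simp add: N_def max_def split: if_splits)
      qed
    qed
  qed blast
  have "b - norm b *\<^sub>R 1 \<in> K" using KI[OF positive_elem_zero, of 1 0] by (simp add: u_def)
  from \<psi>(2)[OF this] have "norm b \<le> Re (\<psi> b)" by (simp add: state_simps[OF \<psi>(1)])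
  moreover have "Re (\<psi> b) \<le> norm b" using state_norm_le[OF \<psi>(1), of b] complex_Re_le_cmod order_trans by blast
  ultimately show ?thesis using \<psi>(1) by (intro exI[of _ \<psi>]) simp
qed

text \<open>For \<open>\<parallel>s\<parallel> \<le> 1\<close>, iterate \<open>1 - s = (1 - s)\<^sup>2 / 2 + (1 - s\<^sup>2) / 2\<close>.\<close>

lemma state_on_pos_elem:
  fixes B :: "'a::cstar_algebra set"
  assumes B: "star_subalgebra B" "1 \<in> B" and \<phi>: "state_on B \<phi>" and x: "x \<in> B" "positive_elem x"
  shows "0 \<le> Re (\<phi> x)"
proof (cases "x = 0")
  case True
  then show ?thesis using \<phi> B(1) unfolding state_on_def star_subalgebra_def by fastforce
next
  case False
  have Bc: "\<And>a b. a \<in> B \<Longrightarrow> b \<in> B \<Longrightarrow> a + b \<in> B" "\<And>a b. a \<in> B \<Longrightarrow> b \<in> B \<Longrightarrow> a * b \<in> B"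
    "\<And>c a. a \<in> B \<Longrightarrow> c *\<^sub>C a \<in> B" "\<And>a. a \<in> B \<Longrightarrow> adj a \<in> B"
    using B(1) unfolding star_subalgebra_def by blast+
  have Br: "r *\<^sub>R a \<in> B" if "a \<in> B" for r a using Bc(3)[OF that, of "complex_of_real r"] by (simp add: scaleC_of_real)
  have Bd: "a - b \<in> B" if "a \<in> B" "b \<in> B" for a b
    using Bc(1)[OF that(1) Br[OF that(2), of "- 1"]] by simp
  have add: "\<phi> (a + b) = \<phi> a + \<phi> b" if "a \<in> B" "b \<in> B" for a b
    using \<phi> that unfolding state_on_def bounded_clinear_on_def by blast
  have scR: "\<phi> (r *\<^sub>R a) = complex_of_real r * \<phi> a" if "a \<in> B" for r a
  proof -
    have "\<phi> (complex_of_real r *\<^sub>C a) = complex_of_real r *\<^sub>C \<phi> a"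
      using \<phi> that unfolding state_on_def bounded_clinear_on_def by blast
    then show ?thesis by (simp add: scaleC_of_real scaleC_complex_def scaleR_conv_of_real)
  qed
  obtain C where C: "\<And>a. a \<in> B \<Longrightarrow> cmod (\<phi> a) \<le> C * norm a"
    using \<phi> unfolding state_on_def bounded_clinear_on_def by blast
  define s where "s n = (1 - inverse (norm x) *\<^sub>R x) ^ (2 ^ n)" for n
  have s0: "s 0 = 1 - inverse (norm x) *\<^sub>R x" by (simp add: s_def)
  have sS: "s (Suc n) = s n * s n" for n by (simp add: s_def mult_2 power_add)
  have sB: "s n \<in> B" for n
    by (induction n) (auto simp: s0 sS intro!: Bc Bd Br B x)
  have xa: "adj x = x" using x by (simp add: positive_elem_def)
  have sa: "adj (s n) = s n" for n by (induction n) (simp_all add: s0 sS adj_simps xa)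
  have "norm (norm x *\<^sub>R 1 - x) \<le> norm x" using positive_elem_iff_norm[of x "norm x"] x xa by simp
  then have "norm (inverse (norm x) *\<^sub>R (norm x *\<^sub>R 1 - x)) \<le> 1"
    using False by (simp add: divide_simps)
  then have n0: "norm (s 0) \<le> 1" using False by (simp add: s0 scaleR_right_diff_distrib)
  have sn: "norm (s n) \<le> 1" for n
  proof (induction n)
    case (Suc n)
    have "norm (s n * s n) \<le> 1 * 1" by (rule order_trans[OF norm_mult_ineq]) (intro mult_mono Suc, auto)
    then show ?case by (simp add: sS)
  qed (rule n0)
  define r where "r n = Re (\<phi> (1 - s n))" for n
  \<comment> \<open>If \<open>r 0\<close> were negative, repeated doubling would drive
    \<open>r n\<close> below every bound, against the boundedness of \<phi>. All terms stay in
    \<open>B\<close>, which need not be closed and so need not contain a square root of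
    \<open>x\<close>.\<close>
  have half: "r (Suc n) \<le> 2 * r n" for n
  proof -
    let ?y = "1 - s n"
    have y: "?y \<in> B" "1 - s (Suc n) \<in> B" by (intro Bd B sB)+
    have "2 *\<^sub>R ?y = adj ?y * ?y + (1 - s (Suc n))" by (simp add: adj_simps sa sS algebra_simps scaleR_2)
    then have "\<phi> (2 *\<^sub>R ?y) = \<phi> (adj ?y * ?y) + \<phi> (1 - s (Suc n))" using add y Bc by simp
    then have "2 * r n = Re (\<phi> (adj ?y * ?y)) + r (Suc n)" by (simp add: scR[OF y(1)] r_def complex_eq_iff)
    moreover have "0 \<le> Re (\<phi> (adj ?y * ?y))" using \<phi> y unfolding state_on_def by blast
    ultimately show ?thesis by simp
  qed
  have r_le: "r n \<le> 2 ^ n * r 0" for n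
  proof (induction n)
    case (Suc n)
    then show ?case using half[of n] by simp
  qed simp
  have r_lower: "- (\<bar>C\<bar> * 2) \<le> r n" for n
  proof -
    have "norm (1 - s n) \<le> 2" using norm_triangle_ineq4[of 1 "s n"] sn[of n] norm_one_le[where 'a='a] by simp
    have "\<bar>r n\<bar> \<le> C * norm (1 - s n)" unfolding r_def
      by (rule order_trans[OF abs_Re_le_cmod]) (intro C Bd B sB)
    also have "\<dots> \<le> \<bar>C\<bar> * 2" using \<open>norm (1 - s n) \<le> 2\<close> by (intro mult_mono) auto
    finally show ?thesis by simp
  qed
  have "0 \<le> r 0"
  proof (rule ccontr)
    assume neg: "\<not> 0 \<le> r 0"
    obtain n :: nat where n: "(\<bar>C\<bar> * 2) / (- r 0) < of_nat n" using reals_Archimedean2 by blast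
    have "of_nat n < (2 :: real) ^ n" using of_nat_less_two_power by blast
    with n have "(\<bar>C\<bar> * 2) / (- r 0) < 2 ^ n" by linarith
    with neg have "\<bar>C\<bar> * 2 < 2 ^ n * (- r 0)" by (simp add: field_simps)
    with r_le[of n] r_lower[of n] show False by simp
  qed
  moreover have "Re (\<phi> (t *\<^sub>R x)) = t * Re (\<phi> x)" for t by (simp add: scR[OF x(1)])
  then have "r 0 = inverse (norm x) * Re (\<phi> x)" by (simp add: r_def s0)
  ultimately show ?thesis using False by (simp add: zero_le_mult_iff)
qed

text \<open>The cone is generated by the positive elements, the self-adjoint elements of
  \<open>B\<close> with nonnegative value, and the skew elements. If it contained -1, some positive
  element of \<open>B\<close> would have a negative value, contrary to
  \<open>state_on_pos_elem\<close>.\<close>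

lemma state_on_extension:
  fixes B :: "'a::cstar_algebra set"
  assumes B: "star_subalgebra B" "1 \<in> B" and \<phi>: "state_on B \<phi>"
  obtains \<psi> where "state \<psi>" "\<And>x. x \<in> B \<Longrightarrow> \<psi> x = \<phi> x"
proof -
  have Bc: "\<And>a b. a \<in> B \<Longrightarrow> b \<in> B \<Longrightarrow> a + b \<in> B" "\<And>a b. a \<in> B \<Longrightarrow> b \<in> B \<Longrightarrow> a * b \<in> B"
    "\<And>c a. a \<in> B \<Longrightarrow> c *\<^sub>C a \<in> B" "\<And>a. a \<in> B \<Longrightarrow> adj a \<in> B"
    using B(1) unfolding star_subalgebra_def by blast+
  have Br: "r *\<^sub>R a \<in> B" if "a \<in> B" for r a using Bc(3)[OF that, of "complex_of_real r"] by (simp add: scaleC_of_real)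
  have Bd: "a - b \<in> B" if "a \<in> B" "b \<in> B" for a b
    using Bc(1)[OF that(1) Br[OF that(2), of "- 1"]] by simp
  have add: "\<phi> (a + b) = \<phi> a + \<phi> b" if "a \<in> B" "b \<in> B" for a b
    using \<phi> that unfolding state_on_def bounded_clinear_on_def by blast
  have sc: "\<phi> (c *\<^sub>C a) = c * \<phi> a" if "a \<in> B" for c a
    using \<phi> that unfolding state_on_def bounded_clinear_on_def scaleC_complex_def by blast
  have scR: "\<phi> (r *\<^sub>R a) = complex_of_real r * \<phi> a" if "a \<in> B" for r a
    using sc[OF that, of "complex_of_real r"] by (simp add: scaleC_of_real)
  have diff: "\<phi> (a - b) = \<phi> a - \<phi> b" if "a \<in> B" "b \<in> B" for a b
    using add[OF that(1) Br[OF that(2), of "- 1"]] scR[OF that(2), of "- 1"] by simp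
  have phi1: "\<phi> 1 = 1" using \<phi> by (simp add: state_on_def)
  define K where "K = {c + y + z |c y z. positive_elem c \<and> y \<in> B \<and> 0 \<le> Re (\<phi> y) \<and> adj y = y \<and> adj z = - z}"
  have KI: "c + y + z \<in> K" if "positive_elem c" "y \<in> B" "0 \<le> Re (\<phi> y)" "adj y = y" "adj z = - z" for c y z
    using that unfolding K_def by blast
  have B0: "0 \<in> B" "\<phi> 0 = 0" using Bd[OF B(2) B(2)] sc[OF B(2), of 0] by simp_all
  obtain \<psi> where \<psi>: "state \<psi>" "\<And>x. x \<in> K \<Longrightarrow> 0 \<le> Re (\<psi> x)"
  proof (rule state_from_cone[of K])
    fix x x' assume "x \<in> K" "x' \<in> K"
    then obtain c y z c' y' z' where *: "x = c + y + z" "positive_elem c" "y \<in> B" "0 \<le> Re (\<phi> y)" "adj y = y" "adj z = - z"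
      "x' = c' + y' + z'" "positive_elem c'" "y' \<in> B" "0 \<le> Re (\<phi> y')" "adj y' = y'" "adj z' = - z'"
      unfolding K_def by blast
    have "(c + c') + (y + y') + (z + z') \<in> K"
      by (intro KI positive_elem_add Bc) (use * in \<open>auto simp: add adj_add\<close>)
    then show "x + x' \<in> K" by (simp add: * algebra_simps)
  next
    fix x and r :: real assume "x \<in> K" "0 \<le> r"
    then obtain c y z where *: "x = c + y + z" "positive_elem c" "y \<in> B" "0 \<le> Re (\<phi> y)" "adj y = y" "adj z = - z"
      unfolding K_def by blast
    have "r *\<^sub>R c + r *\<^sub>R y + r *\<^sub>R z \<in> K"
      by (intro KI positive_elem_scaleR Br) (use * \<open>0 \<le> r\<close> in \<open>auto simp: scR adj_scaleR\<close>)
    then show "r *\<^sub>R x \<in> K" by (simp add: * scaleR_right_distrib)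
  next
    show "x \<in> K" if "positive_elem x" for x using KI[OF that, of 0 0] B0 by simp
    show "x \<in> K" if "adj x = - x" for x using KI[OF positive_elem_zero, of 0 x] that B0 by simp
    show "- 1 \<notin> K"
    proof
      assume "- 1 \<in> K"
      then obtain c y z where *: "- 1 = c + y + z" "positive_elem c" "y \<in> B" "0 \<le> Re (\<phi> y)" "adj y = y" "adj z = - z"
        unfolding K_def by blast
      have "adj (- 1) = c + y - z"
        unfolding *(1) using * by (simp add: adj_simps positive_elem_def)
      then have "c + y + z = c + y - z" by (simp add: adj_minus *(1)[symmetric])
      then have "z = - z" by simp
      then have "z = 0" by (simp add: eq_neg_iff_add_eq_0 flip: scaleR_2)
      then have c: "c = (- 1) *\<^sub>R 1 - y" using *(1) by (simp add: algebra_simps)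
      have cB: "c \<in> B" unfolding c by (intro Bd Br B *)
      have "0 \<le> Re (\<phi> c)" by (rule state_on_pos_elem[OF B \<phi> cB *(2)])
      also have "\<phi> c = \<phi> ((- 1) *\<^sub>R 1) - \<phi> y" unfolding c by (intro diff Br B *)
      also have "\<phi> ((- 1) *\<^sub>R 1) = - 1" using scR[OF B(2), of "- 1"] by (simp only: phi1) simp
      finally show False using *(4) by simp
    qed
  qed blast
  have herm: "\<psi> y = \<phi> y" if y: "y \<in> B" "adj y = y" for y
  proof -
    have im: "Im (\<phi> (a * a)) = 0" if "a \<in> B" "adj a = a" for a
      using \<phi> that unfolding state_on_def by metis
    have im2: "Im (\<psi> (a * a)) = 0" if "adj a = a" for a
      using state_pos(2)[OF \<psi>(1), of a] that by simp
    \<comment> \<open>Polarisation with 1 writes a self-adjoint element as a difference of squares,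
      so both functionals are real on it.\<close>
    have "4 *\<^sub>R y = 2 *\<^sub>R y + 2 *\<^sub>R y" by (simp flip: scaleR_left_distrib)
    then have "4 *\<^sub>R y = (y + 1) * (y + 1) - (y - 1) * (y - 1)"
      by (simp add: algebra_simps scaleR_2)
    then have e: "\<phi> (4 *\<^sub>R y) = \<phi> ((y + 1) * (y + 1)) - \<phi> ((y - 1) * (y - 1))"
      "\<psi> (4 *\<^sub>R y) = \<psi> ((y + 1) * (y + 1)) - \<psi> ((y - 1) * (y - 1))"
      using diff[of "(y + 1) * (y + 1)" "(y - 1) * (y - 1)"] Bc Bd y B
      by (simp_all add: state_simps[OF \<psi>(1)])
    have "Im (\<phi> (4 *\<^sub>R y)) = 0" "Im (\<psi> (4 *\<^sub>R y)) = 0"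
      unfolding e using im[of "y + 1"] im[of "y - 1"] im2[of "y + 1"] im2[of "y - 1"] Bc Bd y B
      by (simp_all add: adj_simps)
    then have Im: "Im (\<phi> y) = 0" "Im (\<psi> y) = 0" by (simp_all add: scR[OF y(1)] state_simps[OF \<psi>(1)])
    \<comment> \<open>Subtracting the value gives an element annihilated by \<phi>; it lies in the
      cone with either sign, so \<psi> annihilates it too.\<close>
    define w where "w = y - Re (\<phi> y) *\<^sub>R 1"
    have wB: "w \<in> B" "(- 1) *\<^sub>R w \<in> B" unfolding w_def by (intro Bd Br B y)+
    have "\<phi> w = 0" using Im by (simp add: w_def diff y Br B scR phi1 complex_eq_iff)
    moreover have "adj w = w" by (simp add: w_def adj_simps y)
    ultimately have "w \<in> K" "- w \<in> K"
      using KI[OF positive_elem_zero, of w 0] KI[OF positive_elem_zero, of "- w" 0] wB scR[OF wB(1), of "- 1"]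
      by (simp_all add: adj_minus)
    then have "Re (\<psi> w) = 0" using \<psi>(2)[of w] \<psi>(2)[of "- w"] by (simp add: state_simps[OF \<psi>(1)])
    then show ?thesis using Im by (simp add: w_def state_simps[OF \<psi>(1)] complex_eq_iff)
  qed
  have "\<psi> x = \<phi> x" if x: "x \<in> B" for x
  proof -
    define h where "h = (1 / 2) *\<^sub>R (x + adj x)"
    define k where "k = (1 / 2) *\<^sub>R \<i> *\<^sub>C (adj x - x)"
    have B': "h \<in> B" "k \<in> B" unfolding h_def k_def by (intro Br Bc Bd x)+
    have a: "adj h = h" "adj k = k" by (simp_all add: h_def k_def adj_simps scaleC_simps algebra_simps)
    have "h + \<i> *\<^sub>C k = (1 / 2 + 1 / 2) *\<^sub>R x"
      unfolding h_def k_def scaleR_left_distrib by (simp add: scaleC_simps algebra_simps)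
    then have xe: "x = h + \<i> *\<^sub>C k" by simp
    show ?thesis unfolding xe
      using B' a by (simp add: add sc Bc state_simps[OF \<psi>(1)] herm)
  qed
  with \<psi>(1) show ?thesis by (rule that)
qed

section \<open>Bounded linear maps\<close>

abbreviation bounded_clinear :: "('a::pre_cstar_algebra \<Rightarrow> 'b::pre_cstar_algebra) \<Rightarrow> bool"
  where "bounded_clinear \<equiv> bounded_clinear_on UNIV"

lemma bounded_clinear_simps:
  assumes "bounded_clinear f"
  shows "f (x + y) = f x + f y" "f (c *\<^sub>C x) = c *\<^sub>C f x" "f 0 = 0" "f (- x) = - f x"
    "f (x - y) = f x - f y" "f (r *\<^sub>R x) = r *\<^sub>R f x"
proof -
  show *: "f (x + y) = f x + f y" "f (c *\<^sub>C x) = c *\<^sub>C f x" for x y c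
    using assms by (simp_all add: bounded_clinear_on_def)
  show "f 0 = 0" using *(2)[of 0 0] by simp
  show m: "f (- x) = - f x" for x using *(2)[of "- 1" x] by (simp add: scaleC_minus_one)
  show "f (x - y) = f x - f y" using *(1)[of x "- y"] by (simp add: m)
  show "f (r *\<^sub>R x) = r *\<^sub>R f x" by (simp flip: scaleC_of_real add: *(2))
qed

lemma bounded_clinearI:
  assumes "\<And>x y. f (x + y) = f x + f y" "\<And>c x. f (c *\<^sub>C x) = c *\<^sub>C f x" "\<And>x. norm (f x) \<le> K * norm x"
  shows "bounded_clinear f"
  using assms unfolding bounded_clinear_on_def by blast

lemma bounded_clinear_boundE:
  assumes "bounded_clinear f"
  obtains K where "0 \<le> K" "\<And>x. norm (f x) \<le> K * norm x"
proof -
  obtain K where K: "\<And>x. norm (f x) \<le> K * norm x" using assms unfolding bounded_clinear_on_def by auto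
  have "norm (f x) \<le> \<bar>K\<bar> * norm x" for x
    by (rule order_trans[OF K mult_right_mono]) auto
  then show ?thesis using that[of "\<bar>K\<bar>"] by simp
qed

lemma bounded_clinear_continuous:
  assumes "bounded_clinear f" "continuous_on A g"
  shows "continuous_on A (\<lambda>x. f (g x))"
proof -
  obtain K where "0 \<le> K" "\<And>x. norm (f x) \<le> K * norm x" using bounded_clinear_boundE[OF assms(1)] by blast
  then have "bounded_linear f"
    by (intro bounded_linear_intro[of f K]) (simp_all add: bounded_clinear_simps[OF assms(1)] mult.commute)
  then show ?thesis using assms(2) by (rule bounded_linear.continuous_on)
qed

lemma bounded_clinear_compose:
  assumes "bounded_clinear f" "bounded_clinear g"
  shows "bounded_clinear (\<lambda>x. g (f x))"
proof -
  obtain K L where K: "0 \<le> K" "\<And>x. norm (f x) \<le> K * norm x" and L: "0 \<le> L" "\<And>x. norm (g x) \<le> L * norm x"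
    using bounded_clinear_boundE[OF assms(1)] bounded_clinear_boundE[OF assms(2)] by metis
  show ?thesis
  proof (rule bounded_clinearI)
    fix x
    have "norm (g (f x)) \<le> L * (K * norm x)"
      by (rule order_trans[OF L(2) mult_left_mono[OF K(2) L(1)]])
    then show "norm (g (f x)) \<le> (L * K) * norm x" by (simp add: mult.assoc)
  qed (simp_all add: bounded_clinear_simps assms)
qed

lemma bounded_clinear_ident: "bounded_clinear (\<lambda>x. x)"
  by (rule bounded_clinearI[of _ 1]) auto

lemma bounded_clinear_mult_right:
  fixes a :: "'a::pre_cstar_algebra"
  shows "bounded_clinear (\<lambda>x. x * a)"
  by (rule bounded_clinearI[of _ "norm a"])
    (auto simp: distrib_right scaleC_mult_left intro: order_trans[OF norm_mult_ineq] simp: mult.commute)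

lemma bounded_clinear_mult_left:
  fixes a :: "'a::pre_cstar_algebra"
  shows "bounded_clinear (\<lambda>x. a * x)"
  by (rule bounded_clinearI[of _ "norm a"])
    (auto simp: distrib_left scaleC_mult_right intro: order_trans[OF norm_mult_ineq])

lemma bounded_clinear_scaleC:
  assumes "bounded_clinear f"
  shows "bounded_clinear (\<lambda>x. c *\<^sub>C f x)"
proof (rule bounded_clinear_compose[OF assms])
  show "bounded_clinear ((*\<^sub>C) c :: 'b \<Rightarrow> 'b)"
    by (rule bounded_clinearI[of _ "cmod c"])
      (simp_all add: scaleC_add_right scaleC_scaleC mult.commute norm_scaleC)
qed

lemma star_hom_bounded_clinear:
  fixes f :: "'a::cstar_algebra \<Rightarrow> 'b::cstar_algebra"
  shows "unital_star_hom_on UNIV f \<Longrightarrow> bounded_clinear f"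
  by (rule bounded_clinearI[of _ 1]) (simp_all add: star_hom_simps star_hom_contractive)

lemma state_bounded_clinear: "state \<phi> \<Longrightarrow> bounded_clinear \<phi>"
  by (simp add: state_on_def)

lemma continuous_on_adj [continuous_intros]:
  fixes f :: "_ \<Rightarrow> 'a::pre_cstar_algebra"
  shows "continuous_on A f \<Longrightarrow> continuous_on A (\<lambda>x. adj (f x))"
  by (rule bounded_linear.continuous_on[OF bounded_linear_adj])

lemma dense_induct:
  assumes "closure S = UNIV" "closed {x. P x}" "\<And>x. x \<in> S \<Longrightarrow> P x"
  shows "P x"
  using closure_minimal[of S "{x. P x}"] assms by auto

text \<open>The bound makes \<open>f\<close> Lipschitz, hence uniformly continuous, and completeness
  of the codomain extends it to the closure. Additivity passes to the limit in one variable at a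
  time.\<close>

lemma bounded_clinear_extension:
  fixes f :: "'a::pre_cstar_algebra \<Rightarrow> 'b::cstar_algebra"
  assumes S_add: "\<And>x y. x \<in> S \<Longrightarrow> y \<in> S \<Longrightarrow> x + y \<in> S"
    and S_scale: "\<And>c x. x \<in> S \<Longrightarrow> c *\<^sub>C x \<in> S"
    and dense: "closure S = UNIV" and f: "bounded_clinear_on S f"
  obtains F where "bounded_clinear F" "\<And>x. x \<in> S \<Longrightarrow> F x = f x"
proof -
  obtain K where add: "\<And>x y. x \<in> S \<Longrightarrow> y \<in> S \<Longrightarrow> f (x + y) = f x + f y"
    and sc: "\<And>c x. x \<in> S \<Longrightarrow> f (c *\<^sub>C x) = c *\<^sub>C f x"
    and K: "\<And>x. x \<in> S \<Longrightarrow> norm (f x) \<le> K * norm x"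
    using f unfolding bounded_clinear_on_def by blast
  have "\<bar>K\<bar>-lipschitz_on S f"
  proof (rule lipschitz_onI)
    fix x y assume xy: "x \<in> S" "y \<in> S"
    then have "x + (- 1) *\<^sub>C y \<in> S" "f (x + (- 1) *\<^sub>C y) = f x + (- 1) *\<^sub>C f y"
      by (simp_all only: S_add S_scale add sc)
    then have "norm (f x - f y) \<le> K * norm (x - y)"
      using K[of "x - y"] by (simp add: scaleC_minus_one)
    also have "\<dots> \<le> \<bar>K\<bar> * norm (x - y)" by (intro mult_right_mono) auto
    finally show "dist (f x) (f y) \<le> \<bar>K\<bar> * dist x y" by (simp add: dist_norm)
  qed simp
  then have "uniformly_continuous_on S f" by (rule lipschitz_on_uniformly_continuous)
  then obtain g where g: "uniformly_continuous_on (closure S) g" "\<And>x. x \<in> S \<Longrightarrow> f x = g x"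
    by (rule uniformly_continuous_on_extension_on_closure) blast
  have "continuous_on UNIV g" using uniformly_continuous_imp_continuous[OF g(1)] dense by simp
  then have gc: "continuous_on UNIV (\<lambda>x. g (h x))" if "continuous_on UNIV h" for h :: "'a \<Rightarrow> 'a"
    using continuous_on_compose2[of UNIV g UNIV h] that by auto
  have gadd1: "g (x + y) = g x + g y" if "y \<in> S" for x y
    by (rule dense_induct[OF dense, of "\<lambda>x. g (x + y) = g x + g y"])
      (use add g(2) S_add that in \<open>auto intro!: closed_Collect_eq gc continuous_intros\<close>)
  have gadd: "g (x + y) = g x + g y" for x y
    by (rule dense_induct[OF dense, of "\<lambda>y. g (x + y) = g x + g y"])
      (auto intro!: closed_Collect_eq gc continuous_intros gadd1)
  have gsc: "g (c *\<^sub>C x) = c *\<^sub>C g x" for c x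
    by (rule dense_induct[OF dense, of "\<lambda>x. g (c *\<^sub>C x) = c *\<^sub>C g x"])
      (use sc g(2) S_scale in \<open>auto intro!: closed_Collect_eq gc continuous_intros
         bounded_linear.continuous_on[OF bounded_linear_scaleC]\<close>)
  have "norm (g x) \<le> K * norm x" for x
    by (rule dense_induct[OF dense, of "\<lambda>x. norm (g x) \<le> K * norm x"])
      (use K g(2) in \<open>auto intro!: closed_Collect_le gc continuous_intros\<close>)
  with gadd gsc have "bounded_clinear g" by (rule bounded_clinearI)
  then show ?thesis using that[of g] g(2) by simp
qed

section \<open>Linear spans\<close>

lemma cspan_zero: "0 \<in> cspan E"
  unfolding cspan_def by (rule CollectI, rule exI[of _ 0]) auto

lemma cspan_add_base:
  assumes "x \<in> cspan E" "s \<in> E"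
  shows "x + c *\<^sub>C s \<in> cspan E"
proof -
  obtain n d t where t: "\<forall>i<n. t i \<in> E" "x = (\<Sum>i<(n::nat). d i *\<^sub>C t i)"
    using assms(1) unfolding cspan_def by blast
  have "(\<Sum>i<Suc n. (if i < n then d i else c) *\<^sub>C (if i < n then t i else s)) = x + c *\<^sub>C s"
    by (simp add: t(2))
  then show ?thesis unfolding cspan_def using t(1) assms(2)
    by (intro CollectI exI[of _ "Suc n"] exI[of _ "\<lambda>i. if i < n then d i else c"]
        exI[of _ "\<lambda>i. if i < n then t i else s"]) auto
qed

lemma cspan_base: "s \<in> E \<Longrightarrow> s \<in> cspan E"
  using cspan_add_base[OF cspan_zero, of s E 1] by simp

lemma cspan_induct [consumes 1, case_names zero add]:
  assumes x: "x \<in> cspan E" and zero: "P 0"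
    and add: "\<And>x c s. x \<in> cspan E \<Longrightarrow> P x \<Longrightarrow> s \<in> E \<Longrightarrow> P (x + c *\<^sub>C s)"
  shows "P x"
proof -
  obtain n d t where t: "\<forall>i<n. t i \<in> E" "x = (\<Sum>i<(n::nat). d i *\<^sub>C t i)"
    using x unfolding cspan_def by blast
  have "m \<le> n \<Longrightarrow> (\<Sum>i<m. d i *\<^sub>C t i) \<in> cspan E \<and> P (\<Sum>i<m. d i *\<^sub>C t i)" for m
    by (induction m) (use t(1) in \<open>auto intro!: cspan_zero zero cspan_add_base add\<close>)
  from this[of n] show ?thesis unfolding t(2) by simp
qed

lemma cspan_add:
  assumes "x \<in> cspan E" "y \<in> cspan E"
  shows "x + y \<in> cspan E"
  using assms(2)
proof (induction y rule: cspan_induct)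
  case (add y c s)
  from cspan_add_base[OF add.IH add.hyps(2)] show ?case by (simp add: add.assoc)
qed (use assms(1) in simp)

lemma cspan_scaleC: "x \<in> cspan E \<Longrightarrow> c *\<^sub>C x \<in> cspan E"
  by (induction x rule: cspan_induct) (auto simp: cspan_zero scaleC_add_right scaleC_scaleC cspan_add_base)

lemma closure_cspan_add:
  assumes "x \<in> closure (cspan E)" "y \<in> closure (cspan E)"
  shows "x + y \<in> closure (cspan E)"
proof -
  obtain X Y where "\<And>n. X n \<in> cspan E" "X \<longlonglongrightarrow> x" "\<And>n. Y n \<in> cspan E" "Y \<longlonglongrightarrow> y"
    using assms unfolding closure_sequential by blast
  then show ?thesis unfolding closure_sequential
    by (intro exI[of _ "\<lambda>n. X n + Y n"]) (auto intro!: cspan_add tendsto_add)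
qed

lemma closure_cspan_scaleC:
  assumes "x \<in> closure (cspan E)"
  shows "c *\<^sub>C x \<in> closure (cspan E)"
proof -
  obtain X where "\<And>n. X n \<in> cspan E" "X \<longlonglongrightarrow> x" using assms unfolding closure_sequential by blast
  then show ?thesis unfolding closure_sequential
    by (intro exI[of _ "\<lambda>n. c *\<^sub>C X n"])
      (auto intro!: cspan_scaleC bounded_linear.tendsto[OF bounded_linear_scaleC])
qed

text \<open>Makes the choice in \<open>tensor_lift\<close> unambiguous on
  \<open>min_tensor_set\<close>. Linearity is known only inside the closure, so the difference from
  a limit is formed as a sum with a scalar multiple that stays there.\<close>

lemma bounded_clinear_on_closure_cspan_eq:
  assumes F: "bounded_clinear_on (closure (cspan E)) F" and G: "bounded_clinear_on (closure (cspan E)) G"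
    and eq: "\<And>s. s \<in> E \<Longrightarrow> F s = G s" and x: "x \<in> closure (cspan E)"
  shows "F x = G x"
proof -
  let ?S = "closure (cspan E)"
  have sub: "x \<in> cspan E \<Longrightarrow> x \<in> ?S" for x using closure_subset by blast
  have lin: "H (x + y) = H x + H y" "H (c *\<^sub>C x) = c *\<^sub>C H x"
    if "bounded_clinear_on ?S H" "x \<in> ?S" "y \<in> ?S" for H :: "'a \<Rightarrow> 'b" and x y c
    using that unfolding bounded_clinear_on_def by blast+
  have z: "H 0 = 0" if "bounded_clinear_on ?S H" for H :: "'a \<Rightarrow> 'b"
    using lin(2)[OF that, of 0 0 0] sub[OF cspan_zero] by simp
  have 1: "F y = G y" if "y \<in> cspan E" for y
    using that
  proof (induction y rule: cspan_induct)
    case (add y c s)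
    note hy = add.hyps
    have s: "c *\<^sub>C s \<in> ?S" "s \<in> ?S" "y \<in> ?S"
      using sub cspan_base[OF hy(2)] cspan_scaleC[OF cspan_base[OF hy(2)]] hy(1) by blast+
    show ?case using add.IH eq[OF hy(2)] lin[OF F] lin[OF G] s by simp
  qed (simp add: z F G)
  obtain X where X: "\<And>n. X n \<in> cspan E" "X \<longlonglongrightarrow> x" using x unfolding closure_sequential by blast
  have lim: "(\<lambda>n. H (X n)) \<longlonglongrightarrow> H x" if H: "bounded_clinear_on ?S H" for H :: "'a \<Rightarrow> 'b"
  proof -
    obtain K where K: "\<And>y. y \<in> ?S \<Longrightarrow> norm (H y) \<le> K * norm y"
      using H unfolding bounded_clinear_on_def by blast
    have b: "norm (H (X n) - H x) \<le> K * norm (X n - x)" for n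
    proof -
      have "(- 1) *\<^sub>C x \<in> ?S" by (rule closure_cspan_scaleC[OF x])
      moreover from this have "X n + (- 1) *\<^sub>C x \<in> ?S" by (rule closure_cspan_add[OF sub[OF X(1)]])
      ultimately show ?thesis
        using K[of "X n + (- 1) *\<^sub>C x"] lin(1)[OF H sub[OF X(1)], of "(- 1) *\<^sub>C x" n] lin(2)[OF H x x, of "- 1"]
        by (simp add: scaleC_minus_one)
    qed
    have l: "(\<lambda>n. K * norm (X n - x)) \<longlonglongrightarrow> 0"
      using X(2) by (intro tendsto_mult_right_zero tendsto_norm_zero) (simp add: LIM_zero_iff)
    have "(\<lambda>n. H (X n) - H x) \<longlonglongrightarrow> 0"
      by (rule Lim_null_comparison[OF _ l]) (simp add: b)
    then show ?thesis by (simp add: LIM_zero_iff)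
  qed
  have "(\<lambda>n. F (X n)) \<longlonglongrightarrow> G x" unfolding 1[OF X(1)] by (rule lim[OF G])
  then show ?thesis by (rule LIMSEQ_unique[OF lim[OF F]])
qed

section \<open>Elementary tensors\<close>

lemma lsum_linear:
  assumes "\<And>x y. f (x + y) = f x + f y" "f 0 = 0"
  shows "f (lsum g t) = lsum (\<lambda>a b. f (g a b)) t"
  by (induction t) (auto simp: assms)

lemma completion_of_add: "completion_of (x + y) = completion_of x + completion_of y"
  by transfer (simp add: cauchy_rel_refl)

lemma completion_of_scaleC: "completion_of (c *\<^sub>C x) = c *\<^sub>C completion_of x"
  by transfer (simp add: cauchy_rel_refl)

lemma completion_of_zero: "completion_of 0 = 0"
  by transfer (simp add: cauchy_rel_refl)

lemma lsum_tensor: "lsum (\<otimes>) t = completion_of (abs_alg_tensor t)"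
proof (induction t)
  case Nil
  show ?case by (simp add: zero_alg_tensor_def[symmetric] completion_of_zero)
next
  case (Cons x t)
  have "abs_alg_tensor (x # t) = abs_alg_tensor [x] + abs_alg_tensor t"
    by (simp add: plus_alg_tensor.abs_eq)
  with Cons show ?case by (cases x) (simp add: tensor_def completion_of_add)
qed

lemma norm_lsum_tensor: "norm (lsum (\<otimes>) t) = spatial_norm t"
  by (simp add: lsum_tensor norm_completion_of norm_alg_tensor.abs_eq)

lemma lsum_tensor_ops:
  "lsum (\<otimes>) (lmult s t) = lsum (\<otimes>) s * lsum (\<otimes>) t"
  "lsum (\<otimes>) (ladj t) = adj (lsum (\<otimes>) t)"
  "lsum (\<otimes>) (lscale c t) = c *\<^sub>C lsum (\<otimes>) t"
  by (simp_all only: lsum_tensor completion_of_simps[symmetric] completion_of_scaleC[symmetric]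
      times_alg_tensor.abs_eq adj_alg_tensor.abs_eq scaleC_alg_tensor.abs_eq)

lemma closure_range_lsum_tensor: "closure (range (lsum (\<otimes>))) = UNIV"
proof -
  have "x \<in> closure (range (lsum (\<otimes>)))" for x :: "('a, 'b) min_tensor"
    unfolding closure_approachable
  proof (intro allI impI)
    fix e :: real assume "0 < e"
    then obtain a where a: "norm (x - completion_of a) < e" using completion_of_dense by blast
    obtain t where "a = abs_alg_tensor t" by (metis Quotient_abs_rep Quotient_alg_tensor)
    with a show "\<exists>y\<in>range (lsum (\<otimes>)). dist y x < e"
      by (intro bexI[of _ "lsum (\<otimes>) t"]) (auto simp: lsum_tensor dist_norm norm_minus_commute)
  qed
  then show ?thesis by blast
qed

lemma tensor_add_left: "(a + a') \<otimes> b = a \<otimes> b + a' \<otimes> b"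
proof -
  have "tensor_rel [(a + a', b)] ([(a, b)] @ [(a', b)])"
    by (rule tensor_relI) (simp add: gns_def state_pair.lin lsum_add algebra_simps)
  then have "abs_alg_tensor [(a + a', b)] = abs_alg_tensor ([(a, b)] @ [(a', b)])"
    by (simp only: alg_tensor.abs_eq_iff)
  also have "\<dots> = abs_alg_tensor [(a, b)] + abs_alg_tensor [(a', b)]"
    by (rule plus_alg_tensor.abs_eq[symmetric])
  finally show ?thesis by (simp add: tensor_def completion_of_add)
qed

lemma tensor_add_right: "a \<otimes> (b + b') = a \<otimes> b + a \<otimes> b'"
proof -
  have "tensor_rel [(a, b + b')] ([(a, b)] @ [(a, b')])"
    by (rule tensor_relI) (simp add: gns_def state_pair.lin lsum_add algebra_simps)
  then have "abs_alg_tensor [(a, b + b')] = abs_alg_tensor ([(a, b)] @ [(a, b')])"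
    by (simp only: alg_tensor.abs_eq_iff)
  also have "\<dots> = abs_alg_tensor [(a, b)] + abs_alg_tensor [(a, b')]"
    by (rule plus_alg_tensor.abs_eq[symmetric])
  finally show ?thesis by (simp add: tensor_def completion_of_add)
qed

lemma tensor_scaleC_left: "(c *\<^sub>C a) \<otimes> b = c *\<^sub>C (a \<otimes> b)"
  using lsum_tensor_ops(3)[of c "[(a, b)]"] by (simp add: lscale_def)

lemma tensor_scaleC_right: "a \<otimes> (c *\<^sub>C b) = c *\<^sub>C (a \<otimes> b)"
proof -
  have "tensor_rel [(a, c *\<^sub>C b)] [(c *\<^sub>C a, b)]"
    by (rule tensor_relI) (simp add: gns_def state_pair.lin scaleC_mult_left scaleC_mult_right algebra_simps)
  then have "abs_alg_tensor [(a, c *\<^sub>C b)] = abs_alg_tensor [(c *\<^sub>C a, b)]"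
    by (simp only: alg_tensor.abs_eq_iff)
  then have "a \<otimes> (c *\<^sub>C b) = (c *\<^sub>C a) \<otimes> b" by (simp only: tensor_def)
  then show ?thesis by (simp only: tensor_scaleC_left)
qed

lemma norm_tensor_le: "norm (a \<otimes> b) \<le> norm a * norm b"
proof -
  have "lmult [(a, 1)] [(1, b)] = [(a, b)]" by (simp add: lmult_def)
  then have "op_bound [(a, b)] (norm a * norm b)"
    using op_bound_lmult[OF op_bound_left[of a] op_bound_right[of b]] by simp
  then show ?thesis using norm_lsum_tensor[of "[(a, b)]"] spatial_norm_le by simp
qed

lemma bounded_clinear_tensor_left:
  assumes "bounded_clinear f"
  shows "bounded_clinear (\<lambda>x. f x \<otimes> b)"
proof (rule bounded_clinear_compose[OF assms])
  show "bounded_clinear (\<lambda>a. a \<otimes> b)"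
  proof (rule bounded_clinearI)
    show "norm (a \<otimes> b) \<le> norm b * norm a" for a
      using norm_tensor_le[of a b] by (simp only: mult.commute)
  qed (simp_all only: tensor_add_left tensor_scaleC_left)
qed

lemma bounded_clinear_tensor_right:
  assumes "bounded_clinear f"
  shows "bounded_clinear (\<lambda>x. a \<otimes> f x)"
proof (rule bounded_clinear_compose[OF assms])
  show "bounded_clinear (\<lambda>b. a \<otimes> b)"
    by (rule bounded_clinearI[where K = "norm a"]) (simp_all only: tensor_add_right tensor_scaleC_right norm_tensor_le)
qed

text \<open>A list of pairs carries no coefficients, so sums of elementary tensors already form a
  dense set.\<close>

lemma min_tensor_induct:
  fixes P :: "('a::pre_cstar_algebra, 'b::pre_cstar_algebra) min_tensor \<Rightarrow> bool"
  assumes "closed {x. P x}" "P 0" "\<And>a b. P (a \<otimes> b)" "\<And>x y. P x \<Longrightarrow> P y \<Longrightarrow> P (x + y)"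
  shows "P x"
proof (rule dense_induct[OF closure_range_lsum_tensor assms(1)])
  have "P (lsum (\<otimes>) t)" for t by (induction t) (auto simp: assms(2-4))
  then show "x \<in> range (lsum (\<otimes>)) \<Longrightarrow> P x" for x by blast
qed

lemma bounded_clinear_tensor_eq:
  assumes "bounded_clinear F" "bounded_clinear G" "\<And>a b. F (a \<otimes> b) = G (a \<otimes> b)"
  shows "F x = G x"
proof (rule min_tensor_induct[of "\<lambda>x. F x = G x"])
  show "closed {x. F x = G x}"
    by (intro closed_Collect_eq bounded_clinear_continuous[OF assms(1)]
        bounded_clinear_continuous[OF assms(2)] continuous_on_id)
qed (simp_all add: bounded_clinear_simps[OF assms(1)] bounded_clinear_simps[OF assms(2)] assms(3))

text \<open>Additivity comes from concatenation of lists. The bound gives well-definedness as well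
  as continuity: two lists for the same tensor differ by a list of spatial norm 0.\<close>

lemma tensor_extension:
  fixes \<beta> :: "'a::pre_cstar_algebra \<Rightarrow> 'b::pre_cstar_algebra \<Rightarrow> 'c::cstar_algebra"
  assumes sc: "\<And>c a b. \<beta> (c *\<^sub>C a) b = c *\<^sub>C \<beta> a b"
    and bd: "\<And>t. norm (lsum \<beta> t) \<le> K * spatial_norm t"
  obtains F where "bounded_clinear F" "\<And>t. F (lsum (\<otimes>) t) = lsum \<beta> t" "\<And>a b. F (a \<otimes> b) = \<beta> a b"
proof -
  have lsc: "lsum \<beta> (lscale c t) = c *\<^sub>C lsum \<beta> t" for c t
    by (induction t) (auto simp: sc lscale_def scaleC_add_right)
  have wd: "lsum \<beta> t = lsum \<beta> u" if "lsum (\<otimes>) t = lsum (\<otimes>) u" for t u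
  proof -
    have "norm (lsum \<beta> t - lsum \<beta> u) = norm (lsum \<beta> (t @ lscale (- 1) u))"
      unfolding lsum_simps(3) lsc by (simp add: scaleC_minus_one)
    also have "\<dots> \<le> K * norm (lsum (\<otimes>) (t @ lscale (- 1) u))"
      using bd unfolding norm_lsum_tensor by blast
    also have "lsum (\<otimes>) (t @ lscale (- 1) u) = 0"
      unfolding lsum_simps(3) lsum_tensor_ops that by (simp add: scaleC_minus_one)
    finally show ?thesis by simp
  qed
  define f where "f x = lsum \<beta> (SOME t. lsum (\<otimes>) t = x)" for x
  have f: "f (lsum (\<otimes>) t) = lsum \<beta> t" for t
    unfolding f_def by (rule wd) (rule someI_ex, blast)
  let ?S = "range (lsum (\<otimes>)) :: ('a, 'b) min_tensor set"
  have Sadd: "lsum (\<otimes>) t + lsum (\<otimes>) u = lsum (\<otimes>) (t @ u)" for t u :: "('a \<times> 'b) list" by simp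
  have bf: "bounded_clinear_on ?S f"
    unfolding bounded_clinear_on_def
  proof (intro conjI allI ballI exI)
    fix x y assume "x \<in> ?S" "y \<in> ?S"
    then obtain t u where tu: "x = lsum (\<otimes>) t" "y = lsum (\<otimes>) u" by blast
    have "f (x + y) = lsum \<beta> (t @ u)" by (simp only: tu Sadd f)
    then show "f (x + y) = f x + f y" by (simp only: tu f lsum_simps(3))
  next
    fix c x assume "x \<in> ?S"
    then obtain t where t: "x = lsum (\<otimes>) t" by blast
    show "f (c *\<^sub>C x) = c *\<^sub>C f x" by (simp only: t lsum_tensor_ops(3)[symmetric] f lsc)
  next
    fix x assume "x \<in> ?S"
    then obtain t where t: "x = lsum (\<otimes>) t" by blast
    show "norm (f x) \<le> K * norm x" by (simp only: t f norm_lsum_tensor bd)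
  qed
  have Sa: "x + y \<in> ?S" if "x \<in> ?S" "y \<in> ?S" for x y
  proof -
    obtain t u where "x = lsum (\<otimes>) t" "y = lsum (\<otimes>) u" using \<open>x \<in> ?S\<close> \<open>y \<in> ?S\<close> by blast
    then have "x + y = lsum (\<otimes>) (t @ u)" by (simp only: Sadd)
    then show ?thesis by blast
  qed
  have Ss: "c *\<^sub>C x \<in> ?S" if "x \<in> ?S" for c x
  proof -
    obtain t where "x = lsum (\<otimes>) t" using \<open>x \<in> ?S\<close> by blast
    then have "c *\<^sub>C x = lsum (\<otimes>) (lscale c t)" by (simp only: lsum_tensor_ops)
    then show ?thesis by blast
  qed
  obtain F where F: "bounded_clinear F" "\<And>x. x \<in> ?S \<Longrightarrow> F x = f x"
  proof (rule bounded_clinear_extension[OF Sa Ss closure_range_lsum_tensor bf])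
    show thesis if "bounded_clinear F" "\<And>x. x \<in> ?S \<Longrightarrow> F x = f x" for F
      using that by (rule \<open>\<And>F. bounded_clinear F \<Longrightarrow> (\<And>x. x \<in> ?S \<Longrightarrow> F x = f x) \<Longrightarrow> thesis\<close>)
  qed
  have Fl: "F (lsum (\<otimes>) t) = lsum \<beta> t" for t using F(2) f by simp
  show ?thesis using that[OF F(1) Fl] Fl[of "[(_, _)]"] by simp
qed

section \<open>Lifts to the minimal tensor product\<close>

lemma lsum_tensor_in_alg_tensor_set: "lsum (\<otimes>) t \<in> alg_tensor_set UNIV UNIV"
proof (induction t)
  case (Cons x t)
  obtain a b where x: "x = (a, b)" by (cases x)
  have "a \<otimes> b \<in> alg_tensor_set UNIV UNIV" unfolding alg_tensor_set_def by (rule cspan_base) blast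
  with Cons show ?case unfolding x lsum_simps by (simp add: alg_tensor_set_def cspan_add)
qed (simp add: alg_tensor_set_def cspan_zero)

lemma min_tensor_set_UNIV [simp]: "min_tensor_set UNIV UNIV = UNIV"
proof -
  have "closure (range (lsum (\<otimes>))) \<subseteq> closure (alg_tensor_set UNIV UNIV :: ('a, 'b) min_tensor set)"
    using lsum_tensor_in_alg_tensor_set by (intro closure_mono) blast
  then show ?thesis unfolding closure_range_lsum_tensor min_tensor_set_def by blast
qed

lemma bounded_clinear_on_subset: "bounded_clinear_on T f \<Longrightarrow> S \<subseteq> T \<Longrightarrow> bounded_clinear_on S f"
  unfolding bounded_clinear_on_def by blast

text \<open>\<open>G\<close> witnesses that a map as required exists, and generators determine it on
  the closure. Lifts over a subalgebra are thereby computed by a map on the full tensor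
  product.\<close>

lemma tensor_lift_eq:
  assumes G: "bounded_clinear G" "\<And>b c. b \<in> B \<Longrightarrow> c \<in> C \<Longrightarrow> G (b \<otimes> c) = \<beta> b c"
    and x: "x \<in> min_tensor_set B C"
  shows "tensor_lift B C \<beta> x = G x"
proof -
  let ?P = "\<lambda>F. bounded_clinear_on (min_tensor_set B C) F \<and> (\<forall>b\<in>B. \<forall>c\<in>C. F (b \<otimes> c) = \<beta> b c)"
  have PG: "?P G" using G bounded_clinear_on_subset[OF G(1)] by blast
  have P: "?P (tensor_lift B C \<beta>)" unfolding tensor_lift_def by (rule someI[of ?P, OF PG])
  show ?thesis
    by (rule bounded_clinear_on_closure_cspan_eq[where E = "{b \<otimes> c |b c. b \<in> B \<and> c \<in> C}"])
      (use P PG x in \<open>auto simp: min_tensor_set_def alg_tensor_set_def\<close>)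
qed

lemma tensor_lift_UNIV:
  assumes "bounded_clinear G" "\<And>b c. G (b \<otimes> c) = \<beta> b c"
  shows "tensor_lift UNIV UNIV \<beta> = G"
  using tensor_lift_eq[OF assms(1), of UNIV UNIV \<beta>] assms(2) by auto

section \<open>Slice maps and product states\<close>

lemma state_pairI: "state \<phi> \<Longrightarrow> state \<psi> \<Longrightarrow> state_pair \<phi> \<psi>"
  by (simp add: state_pair_def)

text \<open>\<open>[(1, 1)]\<close> represents the cyclic unit vector of the product representation,
  on which \<open>t\<close> acts with norm at most its spatial norm; the rest is
  Cauchy-Schwarz.\<close>

lemma gns_lmult_one_le:
  assumes "state \<phi>" "state \<psi>"
  shows "(cmod (gns \<phi> \<psi> s (lmult t [(1, 1)])))\<^sup>2 \<le> Re (gns \<phi> \<psi> s s) * (spatial_norm t)\<^sup>2"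
proof -
  interpret state_pair \<phi> \<psi> by (rule state_pairI[OF assms])
  let ?e = "[(1, 1)]"
  have "Re (gns \<phi> \<psi> (lmult t ?e) (lmult t ?e)) \<le> (spatial_norm t)\<^sup>2 * Re (gns \<phi> \<psi> ?e ?e)"
    using op_bound_spatial_norm[of t] assms unfolding op_bound_def by blast
  also have "gns \<phi> \<psi> ?e ?e = 1"
    by (simp add: gns_def ladj_def lmult_def state_simps[OF assms(1)] state_simps[OF assms(2)])
  finally have "Re (gns \<phi> \<psi> (lmult t ?e) (lmult t ?e)) \<le> (spatial_norm t)\<^sup>2" by simp
  then have "Re (gns \<phi> \<psi> s s) * Re (gns \<phi> \<psi> (lmult t ?e) (lmult t ?e)) \<le> Re (gns \<phi> \<psi> s s) * (spatial_norm t)\<^sup>2"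
    by (intro mult_left_mono gns_pos)
  with gns_cs[of s "lmult t ?e"] show ?thesis by linarith
qed

lemma power4_le_imp_le:
  fixes x y :: real
  assumes "(x\<^sup>2)\<^sup>2 \<le> x\<^sup>2 * y\<^sup>2" "0 \<le> y"
  shows "x \<le> y"
proof (cases "x = 0")
  case False
  then have "0 < x\<^sup>2" by simp
  moreover have "x\<^sup>2 * x\<^sup>2 \<le> x\<^sup>2 * y\<^sup>2" using assms(1) by (simp only: power2_eq_square[of "x\<^sup>2"])
  ultimately have "x\<^sup>2 \<le> y\<^sup>2" using mult_left_le_imp_le by blast
  then show ?thesis using assms(2) by (rule power2_le_imp_le)
next
  case True
  with assms(2) show ?thesis by simp
qed

text \<open>Let \<psi> norm \<open>adj y * y\<close>, where \<open>y\<close> is the slice. Then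
  |y|^2 is the inner product of the vector of \<open>[(1, y)]\<close>, of length |y|, with
  \<open>t\<close> applied to the cyclic unit vector, so |y|^4 is at most |y|^2 times the squared
  spatial norm.\<close>

lemma norm_slice_left_le:
  fixes \<phi> :: "'a::cstar_algebra \<Rightarrow> complex" and t :: "('a \<times> 'b::cstar_algebra) list"
  assumes "state \<phi>"
  shows "norm (lsum (\<lambda>a b. \<phi> a *\<^sub>C b) t) \<le> spatial_norm t"
proof -
  define y where "y = lsum (\<lambda>a b. \<phi> a *\<^sub>C b) t"
  show ?thesis
  proof (cases "adj y * y = 0")
    case True
    then have "y = 0" using cstar_identity[of y] by simp
    then show ?thesis by (simp add: y_def spatial_norm_nonneg)
  next
    case False
    then obtain \<psi> where \<psi>: "state \<psi>" "Re (\<psi> (adj y * y)) = (norm y)\<^sup>2"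
      using ex_norming_state[OF positive_elem_adj_mult] by (metis cstar_identity)
    have e: "\<psi> (adj y * y) = complex_of_real ((norm y)\<^sup>2)"
      using \<psi> state_pos[OF \<psi>(1)] by (simp add: complex_eq_iff)
    have "\<psi> (adj y * y) = lsum (\<lambda>a b. \<phi> a * \<psi> (adj y * b)) t"
      unfolding y_def by (subst lsum_linear[of "\<lambda>z. \<psi> (adj (lsum (\<lambda>a b. \<phi> a *\<^sub>C b) t) * z)"])
        (simp_all add: distrib_left state_simps[OF \<psi>(1)] scaleC_mult_right)
    also have "\<dots> = gns \<phi> \<psi> [(1, y)] (lmult t [(1, 1)])" by (simp add: gns_def)
    finally have "((norm y)\<^sup>2)\<^sup>2 = (cmod (gns \<phi> \<psi> [(1, y)] (lmult t [(1, 1)])))\<^sup>2"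
      unfolding e by (metis norm_of_real abs_power2)
    also have "\<dots> \<le> Re (gns \<phi> \<psi> [(1, y)] [(1, y)]) * (spatial_norm t)\<^sup>2"
      by (rule gns_lmult_one_le[OF assms \<psi>(1)])
    also have "gns \<phi> \<psi> [(1, y)] [(1, y)] = \<psi> (adj y * y)"
      by (simp add: gns_def ladj_def lmult_def state_simps[OF assms])
    finally show ?thesis
      unfolding \<psi>(2) y_def[symmetric] by (rule power4_le_imp_le) (rule spatial_norm_nonneg)
  qed
qed

lemma norm_slice_right_le:
  fixes \<psi> :: "'b::cstar_algebra \<Rightarrow> complex" and t :: "('a::cstar_algebra \<times> 'b) list"
  assumes "state \<psi>"
  shows "norm (lsum (\<lambda>a b. \<psi> b *\<^sub>C a) t) \<le> spatial_norm t"
proof -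
  define y where "y = lsum (\<lambda>a b. \<psi> b *\<^sub>C a) t"
  show ?thesis
  proof (cases "adj y * y = 0")
    case True
    then have "y = 0" using cstar_identity[of y] by simp
    then show ?thesis by (simp add: y_def spatial_norm_nonneg)
  next
    case False
    then obtain \<phi> where \<phi>: "state \<phi>" "Re (\<phi> (adj y * y)) = (norm y)\<^sup>2"
      using ex_norming_state[OF positive_elem_adj_mult] by (metis cstar_identity)
    have e: "\<phi> (adj y * y) = complex_of_real ((norm y)\<^sup>2)"
      using \<phi> state_pos[OF \<phi>(1)] by (simp add: complex_eq_iff)
    have "\<phi> (adj y * y) = lsum (\<lambda>a b. \<phi> (adj y * a) * \<psi> b) t"
      unfolding y_def by (subst lsum_linear[of "\<lambda>z. \<phi> (adj (lsum (\<lambda>a b. \<psi> b *\<^sub>C a) t) * z)"])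
        (simp_all add: distrib_left state_simps[OF \<phi>(1)] scaleC_mult_right mult.commute)
    also have "\<dots> = gns \<phi> \<psi> [(y, 1)] (lmult t [(1, 1)])" by (simp add: gns_def)
    finally have "((norm y)\<^sup>2)\<^sup>2 = (cmod (gns \<phi> \<psi> [(y, 1)] (lmult t [(1, 1)])))\<^sup>2"
      unfolding e by (metis norm_of_real abs_power2)
    also have "\<dots> \<le> Re (gns \<phi> \<psi> [(y, 1)] [(y, 1)]) * (spatial_norm t)\<^sup>2"
      by (rule gns_lmult_one_le[OF \<phi>(1) assms])
    also have "gns \<phi> \<psi> [(y, 1)] [(y, 1)] = \<phi> (adj y * y)"
      by (simp add: gns_def ladj_def lmult_def state_simps[OF assms])
    finally show ?thesis
      unfolding \<phi>(2) y_def[symmetric] by (rule power4_le_imp_le) (rule spatial_norm_nonneg)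
  qed
qed

abbreviation (input) lslice :: "('a::cstar_algebra \<Rightarrow> complex) \<Rightarrow> ('a, 'b::cstar_algebra) min_tensor \<Rightarrow> 'b"
  where "lslice \<phi> \<equiv> slice_left UNIV \<phi> UNIV"

abbreviation (input) rslice :: "('b::cstar_algebra \<Rightarrow> complex) \<Rightarrow> ('a::cstar_algebra, 'b) min_tensor \<Rightarrow> 'a"
  where "rslice \<psi> \<equiv> slice_right UNIV UNIV \<psi>"

lemma lslice:
  fixes \<phi> :: "'a::cstar_algebra \<Rightarrow> complex"
  assumes "state \<phi>"
  shows "bounded_clinear (lslice \<phi> :: ('a, 'b::cstar_algebra) min_tensor \<Rightarrow> 'b)"
    and "lslice \<phi> (a \<otimes> (b :: 'b)) = \<phi> a *\<^sub>C b"
    and "lslice \<phi> (lsum (\<otimes>) (t :: ('a \<times> 'b) list)) = lsum (\<lambda>a b. \<phi> a *\<^sub>C b) t"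
proof -
  obtain F :: "('a, 'b) min_tensor \<Rightarrow> 'b" where F: "bounded_clinear F"
    "\<And>t. F (lsum (\<otimes>) t) = lsum (\<lambda>a b. \<phi> a *\<^sub>C b) t" "\<And>a b. F (a \<otimes> b) = \<phi> a *\<^sub>C b"
    by (rule tensor_extension[of "\<lambda>a b. \<phi> a *\<^sub>C b" 1])
      (auto simp: state_simps[OF assms] scaleC_scaleC norm_slice_left_le[OF assms])
  have "slice_left UNIV \<phi> UNIV = F" unfolding slice_left_def by (rule tensor_lift_UNIV[OF F(1,3)])
  with F show "bounded_clinear (lslice \<phi> :: ('a, 'b) min_tensor \<Rightarrow> 'b)" "lslice \<phi> (a \<otimes> b) = \<phi> a *\<^sub>C b"
    "lslice \<phi> (lsum (\<otimes>) t) = lsum (\<lambda>a b. \<phi> a *\<^sub>C b) t" by simp_all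
qed

lemma rslice:
  fixes \<psi> :: "'b::cstar_algebra \<Rightarrow> complex"
  assumes "state \<psi>"
  shows "bounded_clinear (rslice \<psi> :: ('a::cstar_algebra, 'b) min_tensor \<Rightarrow> 'a)"
    and "rslice \<psi> ((a :: 'a) \<otimes> b) = \<psi> b *\<^sub>C a"
proof -
  obtain F :: "('a, 'b) min_tensor \<Rightarrow> 'a" where F: "bounded_clinear F"
    "\<And>t. F (lsum (\<otimes>) t) = lsum (\<lambda>a b. \<psi> b *\<^sub>C a) t" "\<And>a b. F (a \<otimes> b) = \<psi> b *\<^sub>C a"
    by (rule tensor_extension[of "\<lambda>a b. \<psi> b *\<^sub>C a" 1])
      (auto simp: scaleC_scaleC mult.commute norm_slice_right_le[OF assms])
  have "slice_right UNIV UNIV \<psi> = F" unfolding slice_right_def by (rule tensor_lift_UNIV[OF F(1,3)])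
  with F show "bounded_clinear (rslice \<psi> :: ('a, 'b) min_tensor \<Rightarrow> 'a)" "rslice \<psi> (a \<otimes> b) = \<psi> b *\<^sub>C a"
    by simp_all
qed

definition prod_state :: "('a::cstar_algebra \<Rightarrow> complex) \<Rightarrow> ('b::cstar_algebra \<Rightarrow> complex) \<Rightarrow>
    ('a, 'b) min_tensor \<Rightarrow> complex"
  where "prod_state \<phi> \<psi> z = \<psi> (lslice \<phi> z)"

context
  fixes \<phi> :: "'a::cstar_algebra \<Rightarrow> complex" and \<psi> :: "'b::cstar_algebra \<Rightarrow> complex"
  assumes st: "state \<phi>" "state \<psi>"
begin

lemma prod_state_tensor: "prod_state \<phi> \<psi> (a \<otimes> b) = \<phi> a * \<psi> b"
  by (simp add: prod_state_def lslice[OF st(1)] state_simps[OF st(2)])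

lemma prod_state_bounded_clinear: "bounded_clinear (prod_state \<phi> \<psi>)"
  unfolding prod_state_def[abs_def]
  by (rule bounded_clinear_compose[OF lslice(1)[OF st(1)] state_bounded_clinear[OF st(2)]])

lemma prod_state_gns: "prod_state \<phi> \<psi> (adj (lsum (\<otimes>) s) * lsum (\<otimes>) t) = gns \<phi> \<psi> s t"
proof -
  have "prod_state \<phi> \<psi> (lsum (\<otimes>) u) = lsum (\<lambda>a b. \<phi> a * \<psi> b) u" for u
    by (subst lsum_linear[of "prod_state \<phi> \<psi>"])
      (simp_all add: bounded_clinear_simps[OF prod_state_bounded_clinear] prod_state_tensor)
  then show ?thesis unfolding gns_def by (simp only: lsum_tensor_ops[symmetric])
qed

text \<open>On lists, positivity is \<open>gns_pos\<close>, that is, the Schur product theorem;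
  continuity carries it to the completion.\<close>

lemma state_prod_state: "state (prod_state \<phi> \<psi>)"
  unfolding state_on_def
proof (intro conjI ballI)
  let ?P = "prod_state \<phi> \<psi>"
  interpret state_pair \<phi> \<psi> by (rule state_pairI[OF st])
  show "bounded_clinear ?P" by (rule prod_state_bounded_clinear)
  show "?P 1 = 1" using prod_state_tensor[of 1 1] st by (simp add: tensor_one state_simps)
  have c: "continuous_on UNIV (\<lambda>x. ?P (adj x * x))"
    by (intro bounded_clinear_continuous[OF prod_state_bounded_clinear] continuous_intros)
  fix x
  show "0 \<le> Re (?P (adj x * x))"
    by (rule dense_induct[OF closure_range_lsum_tensor, of "\<lambda>x. 0 \<le> Re (?P (adj x * x))"])
      (auto simp: prod_state_gns gns_pos intro!: closed_Collect_le continuous_intros c)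
  show "Im (?P (adj x * x)) = 0"
    by (rule dense_induct[OF closure_range_lsum_tensor, of "\<lambda>x. Im (?P (adj x * x)) = 0"])
      (auto simp: prod_state_gns gns_pos intro!: closed_Collect_eq continuous_intros c)
qed

end

text \<open>The spatial norm is expressed by states only for lists, while \<open>y\<close> is an
  arbitrary element of the completion. For a list \<open>x\<close> the estimate holds with the error
  d = |adj x * x - adj y * y|, giving |x|^2 \<le> K^2 + d. Both sides are continuous in
  \<open>x\<close>, and x = y makes the error vanish.\<close>

lemma norm_min_tensor_le:
  fixes y :: "('a::cstar_algebra, 'b::cstar_algebra) min_tensor"
  assumes K: "0 \<le> K" and le: "\<And>\<phi> \<psi> s. state \<phi> \<Longrightarrow> state \<psi> \<Longrightarrow>
      Re (prod_state \<phi> \<psi> (adj (y * lsum (\<otimes>) s) * (y * lsum (\<otimes>) s)))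
      \<le> K\<^sup>2 * Re (prod_state \<phi> \<psi> (adj (lsum (\<otimes>) s) * lsum (\<otimes>) s))"
  shows "norm y \<le> K"
proof -
  have "(norm x)\<^sup>2 \<le> K\<^sup>2 + norm (adj x * x - adj y * y)" for x :: "('a, 'b) min_tensor"
  proof (rule dense_induct[OF closure_range_lsum_tensor,
        of "\<lambda>x. (norm x)\<^sup>2 \<le> K\<^sup>2 + norm (adj x * x - adj y * y)"])
    show "closed {x. (norm x)\<^sup>2 \<le> K\<^sup>2 + norm (adj x * x - adj y * y)}"
      by (intro closed_Collect_le continuous_intros)
    fix x :: "('a, 'b) min_tensor" assume "x \<in> range (lsum (\<otimes>))"
    then obtain t where t: "x = lsum (\<otimes>) t" by blast
    define d where "d = norm (adj x * x - adj y * y)"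
    have "op_bound t (sqrt (K\<^sup>2 + d))"
      unfolding op_bound_def
    proof (intro conjI allI impI)
      fix \<phi> :: "'a \<Rightarrow> complex" and \<psi> :: "'b \<Rightarrow> complex" and s :: "('a \<times> 'b) list"
      assume st: "state \<phi>" "state \<psi>"
      let ?P = "prod_state \<phi> \<psi>" and ?w = "lsum (\<otimes>) s"
      note P = state_prod_state[OF st]
      define g where "g z = ?P (adj ?w * z * ?w)" for z
      have gb: "bounded_clinear g"
        unfolding g_def[abs_def]
        by (intro bounded_clinear_compose[OF _ prod_state_bounded_clinear[OF st]]
            bounded_clinear_compose[OF bounded_clinear_mult_left bounded_clinear_mult_right])
      have gp: "g (adj z * z) = ?P (adj (z * ?w) * (z * ?w))" for z
        by (simp add: g_def adj_mult mult.assoc)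
      obtain C where C: "\<And>z. norm (g z) \<le> C * norm z" using bounded_clinear_boundE[OF gb] by blast
      have gn: "cmod (g z) \<le> Re (g 1) * norm z" for z
        by (rule positive_functional_norm[OF _ _ _ _ C])
          (simp_all add: bounded_clinear_simps[OF gb] scaleC_complex_def gp state_pos[OF P])
      have "g (adj x * x) = g (adj y * y) + g (adj x * x - adj y * y)"
        by (simp add: bounded_clinear_simps[OF gb])
      then have "Re (g (adj x * x)) \<le> Re (g (adj y * y)) + cmod (g (adj x * x - adj y * y))"
        using complex_Re_le_cmod[of "g (adj x * x - adj y * y)"] by simp
      also have "\<dots> \<le> K\<^sup>2 * Re (g 1) + Re (g 1) * d"
        using le[OF st, of s] gn[of "adj x * x - adj y * y"] by (intro add_mono) (simp_all add: gp d_def, simp add: g_def)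
      finally have "Re (g (adj x * x)) \<le> (K\<^sup>2 + d) * Re (g 1)" by (simp add: algebra_simps)
      moreover have "g (adj x * x) = gns \<phi> \<psi> (lmult t s) (lmult t s)"
        unfolding gp prod_state_gns[OF st, symmetric] lsum_tensor_ops t ..
      moreover have "g 1 = gns \<phi> \<psi> s s" by (simp add: g_def prod_state_gns[OF st])
      moreover have "0 \<le> K\<^sup>2 + d" by (simp add: d_def)
      ultimately show "Re (gns \<phi> \<psi> (lmult t s) (lmult t s)) \<le> (sqrt (K\<^sup>2 + d))\<^sup>2 * Re (gns \<phi> \<psi> s s)"
        by simp
    qed (simp add: d_def)
    then have "norm x \<le> sqrt (K\<^sup>2 + d)" using spatial_norm_le by (simp add: t norm_lsum_tensor)
    then have "(norm x)\<^sup>2 \<le> (sqrt (K\<^sup>2 + d))\<^sup>2" by (intro power_mono) auto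
    then show "(norm x)\<^sup>2 \<le> K\<^sup>2 + norm (adj x * x - adj y * y)" by (simp add: d_def)
  qed
  from this[of y] show ?thesis using K power2_le_imp_le by simp
qed

section \<open>Pulled-back states and vector functionals\<close>

lemma state_compose_hom:
  fixes f :: "'a::cstar_algebra \<Rightarrow> 'b::cstar_algebra"
  assumes "state \<phi>" "unital_star_hom_on UNIV f"
  shows "state (\<lambda>x. \<phi> (f x))"
  unfolding state_on_def
  using bounded_clinear_compose[OF star_hom_bounded_clinear[OF assms(2)] state_bounded_clinear[OF assms(1)]]
    state_pos[OF assms(1)] state_simps(3)[OF assms(1)] by (simp add: star_hom_simps[OF assms(2)])

text \<open>The functional is positive, hence a multiple of a state unless its mass \<open>r\<close>
  is 0. In that case it vanishes and any state serves, here \<phi> itself.\<close>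

lemma vector_state:
  fixes \<phi> :: "'a::cstar_algebra \<Rightarrow> complex"
  assumes "state \<phi>"
  obtains \<eta> r where "state \<eta>" "\<And>a. \<phi> (adj x * a * x) = complex_of_real r * \<eta> a"
proof -
  define g where "g a = \<phi> (adj x * a * x)" for a
  have gb: "bounded_clinear g"
    unfolding g_def[abs_def]
    by (intro bounded_clinear_compose[OF _ state_bounded_clinear[OF assms]]
        bounded_clinear_compose[OF bounded_clinear_mult_left bounded_clinear_mult_right])
  have gp: "g (adj z * z) = \<phi> (adj (z * x) * (z * x))" for z by (simp add: g_def adj_mult mult.assoc)
  obtain C where C: "\<And>z. norm (g z) \<le> C * norm z" using bounded_clinear_boundE[OF gb] by blast
  have gn: "cmod (g z) \<le> Re (g 1) * norm z" for z
    by (rule positive_functional_norm[OF _ _ _ _ C])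
      (simp_all add: bounded_clinear_simps[OF gb] scaleC_complex_def gp state_pos[OF assms])
  define r where "r = Re (g 1)"
  have g1: "g 1 = complex_of_real r" "0 \<le> r"
    using gp[of 1] state_pos[OF assms, of x] by (simp_all add: r_def complex_eq_iff)
  show ?thesis
  proof (cases "r = 0")
    case True
    then have "g a = 0" for a using gn[of a] g1 by simp
    with True show ?thesis using that[OF assms, of 0] by (simp add: g_def)
  next
    case False
    define \<eta> where "\<eta> a = complex_of_real (inverse r) *\<^sub>C g a" for a
    have "state \<eta>"
      unfolding state_on_def
    proof (intro conjI ballI)
      show "bounded_clinear \<eta>" unfolding \<eta>_def[abs_def] by (rule bounded_clinear_scaleC[OF gb])
      show "\<eta> 1 = 1" using False g1 by (simp add: \<eta>_def scaleC_complex_def)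
      have ch: "\<eta> a = complex_of_real (inverse r) * g a" for a by (simp add: \<eta>_def scaleC_complex_def)
      have re: "Re (complex_of_real q * u) = q * Re u" "Im (complex_of_real q * u) = q * Im u" for q u
        by simp_all
      show "0 \<le> Re (\<eta> (adj z * z))" "Im (\<eta> (adj z * z)) = 0" for z
        unfolding ch re using state_pos[OF assms] g1(2) by (simp_all add: gp)
    qed
    moreover have "\<phi> (adj x * a * x) = complex_of_real r * \<eta> a" for a
      using False by (simp add: \<eta>_def g_def scaleC_complex_def)
    ultimately show ?thesis by (rule that)
  qed
qed

text \<open>The parallelogram law with a nonnegative term dropped, for splitting vectors where
  constants do not matter.\<close>

lemma state_parallelogram:
  assumes "state f"
  shows "Re (f (adj (u + v) * (u + v))) \<le> 2 * Re (f (adj u * u)) + 2 * Re (f (adj v * v))"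
proof -
  have "f (adj (u + v) * (u + v)) + f (adj (u - v) * (u - v)) = 2 * f (adj u * u) + 2 * f (adj v * v)"
    by (simp add: adj_simps algebra_simps state_simps[OF assms])
  from arg_cong[OF this, of Re]
  have "Re (f (adj (u + v) * (u + v))) + Re (f (adj (u - v) * (u - v))) =
      2 * Re (f (adj u * u)) + 2 * Re (f (adj v * v))" by simp
  then show ?thesis using state_pos(1)[OF assms, of "u - v"] by linarith
qed

section \<open>Tensor products of homomorphisms\<close>

lemma unital_star_homI:
  assumes "bounded_clinear F" "\<And>x y. F (x * y) = F x * F y" "\<And>x. F (adj x) = adj (F x)" "F 1 = 1"
  shows "unital_star_hom_on UNIV F"
  using assms by (simp add: unital_star_hom_on_def bounded_clinear_simps[OF assms(1)])

text \<open>The minimal norm on the codomain is given by vector functionals in product representations.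
  Composed with \<open>a \<otimes> b \<mapsto> p a * q b\<close> they are positive, hence as soon as they are bounded at all they
  are bounded by their value at the unit.\<close>

lemma tensor_hom_lift:
  fixes p :: "'a::cstar_algebra \<Rightarrow> ('c::cstar_algebra, 'd::cstar_algebra) min_tensor"
    and q :: "'b::cstar_algebra \<Rightarrow> ('c, 'd) min_tensor"
  assumes p: "unital_star_hom_on UNIV p" and q: "unital_star_hom_on UNIV q"
    and pq: "\<And>a b. p a * q b = q b * p a"
    and bd: "\<And>\<phi> \<psi>. state \<phi> \<Longrightarrow> state \<psi> \<Longrightarrow>
      \<exists>K. \<forall>t. cmod (prod_state \<phi> \<psi> (lsum (\<lambda>a b. p a * q b) t)) \<le> K * spatial_norm t"
  obtains F where "unital_star_hom_on UNIV F" "\<And>a b. F (a \<otimes> b) = p a * q b"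
proof -
  note ps = star_hom_simps[OF p] and qs = star_hom_simps[OF q]
  define L where "L t = lsum (\<lambda>a b. p a * q b) t" for t
  have L_mult: "L (lmult s t) = L s * L t" for s t
  proof -
    have *: "p (a * c) * q (b * d) = (p a * q b) * (p c * q d)" for a b c d
    proof -
      have "p (a * c) * q (b * d) = p a * (p c * q b) * q d" by (simp only: ps qs mult.assoc)
      also have "p c * q b = q b * p c" by (rule pq)
      finally show ?thesis by (simp only: mult.assoc)
    qed
    have "L (lmult s t) = lsum (\<lambda>a b. (p a * q b) * L t) s"
      unfolding L_def lsum_lmult * by (subst lsum_linear[of "\<lambda>z. _ * z"]) (simp_all add: distrib_left)
    also have "\<dots> = L s * L t"
      unfolding L_def[of s] by (subst lsum_linear[of "\<lambda>z. z * L t"]) (simp_all add: distrib_right)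
    finally show ?thesis .
  qed
  have L_adj: "L (ladj t) = adj (L t)" for t
  proof -
    have "adj (p a * q b) = p (adj a) * q (adj b)" for a b
      by (simp only: adj_mult ps(4)[symmetric] qs(4)[symmetric] pq)
    then show ?thesis
      unfolding L_def by (subst lsum_linear[of adj]) (simp_all only: adj_add adj_zero lsum_simps3)
  qed
  have L_one: "L [(1, 1)] = 1" by (simp add: L_def ps qs)
  have L_sq: "L (lmult (ladj t) t) = adj (L t) * L t" for t by (simp add: L_mult L_adj)
  have bound: "norm (L t) \<le> spatial_norm t" for t
  proof (rule norm_min_tensor_le)
    show "0 \<le> spatial_norm t" by (rule spatial_norm_nonneg)
    fix \<phi> :: "'c \<Rightarrow> complex" and \<psi> :: "'d \<Rightarrow> complex" and s :: "('c \<times> 'd) list"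
    assume st: "state \<phi>" "state \<psi>"
    let ?P = "prod_state \<phi> \<psi>"
    note P = state_prod_state[OF st] and Pb = prod_state_bounded_clinear[OF st]
    note Ps = state_simps[OF P]
    have sp2: "spatial_norm (lmult (ladj u) u) = (spatial_norm u)\<^sup>2" for u :: "('a \<times> 'b) list"
      by (simp only: norm_lsum_tensor[symmetric] lsum_tensor_ops cstar_identity)
    \<comment> \<open>The constant may depend on the vector \<open>s\<close>. It serves only to make
      the functional \<open>G\<close> below exist; positivity then replaces it by the value at the
      unit.\<close>
    have ex: "\<exists>C. \<forall>u. Re (?P (adj (L u * lsum (\<otimes>) s) * (L u * lsum (\<otimes>) s))) \<le> C * (spatial_norm u)\<^sup>2" for s
    proof (induction s)
      case Nil
      show ?case by (rule exI[of _ 0]) (simp add: Ps)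
    next
      case (Cons xy s)
      obtain x y where xy: "xy = (x, y)" by (cases xy)
      obtain C where C: "\<And>u. Re (?P (adj (L u * lsum (\<otimes>) s) * (L u * lsum (\<otimes>) s))) \<le> C * (spatial_norm u)\<^sup>2"
        using Cons by blast
      obtain \<eta> r where \<eta>: "state \<eta>" "\<And>a. \<phi> (adj x * a * x) = complex_of_real r * \<eta> a"
        by (rule vector_state[OF st(1), of x]) auto
      obtain \<xi> l where \<xi>: "state \<xi>" "\<And>a. \<psi> (adj y * a * y) = complex_of_real l * \<xi> a"
        by (rule vector_state[OF st(2), of y]) auto
      \<comment> \<open>An elementary vector splits: its vector functional is a multiple of another
        product state, to which the assumed bound applies.\<close>
      have v: "?P (adj (x \<otimes> y) * z * (x \<otimes> y)) = complex_of_real (r * l) *\<^sub>C prod_state \<eta> \<xi> z" for z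
      proof (rule bounded_clinear_tensor_eq[of "\<lambda>z. ?P (adj (x \<otimes> y) * z * (x \<otimes> y))"
            "\<lambda>z. complex_of_real (r * l) *\<^sub>C prod_state \<eta> \<xi> z"])
        show "bounded_clinear (\<lambda>z. ?P (adj (x \<otimes> y) * z * (x \<otimes> y)))"
          by (intro bounded_clinear_compose[OF _ Pb]
              bounded_clinear_compose[OF bounded_clinear_mult_left bounded_clinear_mult_right])
        show "bounded_clinear (\<lambda>z. complex_of_real (r * l) *\<^sub>C prod_state \<eta> \<xi> z)"
          by (intro bounded_clinear_scaleC prod_state_bounded_clinear \<eta> \<xi>)
      qed (simp add: tensor_adj tensor_mult prod_state_tensor[OF st] prod_state_tensor[OF \<eta>(1) \<xi>(1)]
          \<eta>(2) \<xi>(2) scaleC_complex_def)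
      obtain K where K: "\<And>t. cmod (prod_state \<eta> \<xi> (L t)) \<le> K * spatial_norm t"
        using bd[OF \<eta>(1) \<xi>(1)] unfolding L_def by blast
      have e: "Re (?P (adj (L u * (x \<otimes> y)) * (L u * (x \<otimes> y)))) \<le> \<bar>r * l\<bar> * K * (spatial_norm u)\<^sup>2" for u
      proof -
        have "?P (adj (L u * (x \<otimes> y)) * (L u * (x \<otimes> y))) = complex_of_real (r * l) *\<^sub>C prod_state \<eta> \<xi> (L (lmult (ladj u) u))"
          by (simp only: v[symmetric] L_sq adj_mult mult.assoc)
        then have "Re (?P (adj (L u * (x \<otimes> y)) * (L u * (x \<otimes> y)))) \<le> \<bar>r * l\<bar> * cmod (prod_state \<eta> \<xi> (L (lmult (ladj u) u)))"
          by (metis complex_Re_le_cmod norm_of_real norm_scaleC)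
        also have "\<dots> \<le> \<bar>r * l\<bar> * (K * spatial_norm (lmult (ladj u) u))" by (intro mult_left_mono K) simp
        finally show ?thesis by (simp add: sp2 mult.assoc)
      qed
      have "Re (?P (adj (L u * lsum (\<otimes>) (xy # s)) * (L u * lsum (\<otimes>) (xy # s))))
          \<le> (2 * (\<bar>r * l\<bar> * K) + 2 * C) * (spatial_norm u)\<^sup>2" for u
        using state_parallelogram[OF P, of "L u * (x \<otimes> y)" "L u * lsum (\<otimes>) s"] e[of u] C[of u]
        by (simp add: xy distrib_left distrib_right)
      then show ?case by blast
    qed
    let ?w = "lsum (\<otimes>) s"
    obtain C where C: "\<And>u. Re (?P (adj (L u * ?w) * (L u * ?w))) \<le> C * (spatial_norm u)\<^sup>2"
      using ex[of s] by blast
    define A where "A = Re (?P (adj ?w * ?w))"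
    have A: "0 \<le> A" by (simp add: A_def state_pos[OF P])
    define \<beta> where "\<beta> a b = ?P (adj ?w * (p a * q b) * ?w)" for a b
    have \<beta>: "lsum \<beta> u = ?P (adj ?w * L u * ?w)" for u
      unfolding L_def by (subst lsum_linear[of "\<lambda>z. ?P (adj ?w * z * ?w)"])
        (simp_all add: \<beta>_def[abs_def] distrib_left distrib_right Ps)
    \<comment> \<open>Cauchy-Schwarz turns the bound on squared lengths into the linear bound that
      \<open>tensor_extension\<close> expects.\<close>
    have bb: "norm (lsum \<beta> u) \<le> sqrt (A * \<bar>C\<bar>) * spatial_norm u" for u
    proof (rule power2_le_imp_le)
      have "(cmod (?P (adj ?w * (L u * ?w))))\<^sup>2 \<le> A * Re (?P (adj (L u * ?w) * (L u * ?w)))"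
        unfolding A_def by (rule positive_functional_cauchy_schwarz) (simp_all add: Ps state_pos[OF P])
      also have "\<dots> \<le> A * (C * (spatial_norm u)\<^sup>2)" by (intro mult_left_mono C A)
      also have "\<dots> \<le> A * (\<bar>C\<bar> * (spatial_norm u)\<^sup>2)" using A by (intro mult_left_mono mult_right_mono) auto
      finally show "(norm (lsum \<beta> u))\<^sup>2 \<le> (sqrt (A * \<bar>C\<bar>) * spatial_norm u)\<^sup>2"
        using A by (simp add: \<beta> power_mult_distrib mult.assoc)
      show "0 \<le> sqrt (A * \<bar>C\<bar>) * spatial_norm u" using A by (simp add: spatial_norm_nonneg)
    qed
    have bs: "\<beta> (c *\<^sub>C a) b = c *\<^sub>C \<beta> a b" for c a b
      by (simp add: \<beta>_def ps scaleC_mult_left scaleC_mult_right Ps scaleC_complex_def)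
    obtain G where G: "bounded_clinear G" "\<And>u. G (lsum (\<otimes>) u) = lsum \<beta> u" "\<And>a b. G (a \<otimes> b) = \<beta> a b"
      by (rule tensor_extension[OF bs bb]) auto
    have Gp: "G (adj (lsum (\<otimes>) u) * lsum (\<otimes>) u) = ?P (adj (L u * ?w) * (L u * ?w))" for u
      by (simp only: lsum_tensor_ops[symmetric] G \<beta> L_sq adj_mult mult.assoc)
    have Gc: "continuous_on UNIV (\<lambda>x. G (adj x * x))"
      by (intro bounded_clinear_continuous[OF G(1)] continuous_intros)
    have Gpos: "0 \<le> Re (G (adj x * x))" "Im (G (adj x * x)) = 0" for x
    proof -
      show "0 \<le> Re (G (adj x * x))"
        by (rule dense_induct[OF closure_range_lsum_tensor, of "\<lambda>x. 0 \<le> Re (G (adj x * x))"])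
          (auto simp: Gp state_pos[OF P] intro!: closed_Collect_le continuous_intros Gc)
      show "Im (G (adj x * x)) = 0"
        by (rule dense_induct[OF closure_range_lsum_tensor, of "\<lambda>x. Im (G (adj x * x)) = 0"])
          (auto simp: Gp state_pos[OF P] intro!: closed_Collect_eq continuous_intros Gc)
    qed
    obtain M where M: "\<And>x. norm (G x) \<le> M * norm x" using bounded_clinear_boundE[OF G(1)] by blast
    have "Re (G (adj (lsum (\<otimes>) t) * lsum (\<otimes>) t)) \<le> (norm (lsum (\<otimes>) t))\<^sup>2 * Re (G 1)"
      by (rule positive_functional_bound[OF _ _ _ _ M])
        (simp_all add: bounded_clinear_simps[OF G(1)] scaleC_complex_def Gpos)
    moreover have "G 1 = ?P (adj ?w * ?w)" using G(3)[of 1 1] by (simp add: tensor_one \<beta>_def ps qs)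
    ultimately show "Re (?P (adj (L t * ?w) * (L t * ?w))) \<le> (spatial_norm t)\<^sup>2 * Re (?P (adj ?w * ?w))"
      by (simp add: Gp norm_lsum_tensor)
  qed
  have "norm (lsum (\<lambda>a b. p a * q b) t) \<le> 1 * spatial_norm t" for t using bound[of t] by (simp add: L_def)
  then obtain F where F: "bounded_clinear F" "\<And>t. F (lsum (\<otimes>) t) = lsum (\<lambda>a b. p a * q b) t"
    "\<And>a b. F (a \<otimes> b) = p a * q b"
    by (rule tensor_extension[rotated]) (auto simp: ps scaleC_mult_left)
  note Fc = bounded_clinear_continuous[OF F(1)]
  have FL: "F (lsum (\<otimes>) t) = L t" for t by (simp add: F(2) L_def)
  have FLm: "F (lsum (\<otimes>) s * lsum (\<otimes>) t) = L s * L t" and FLa: "F (adj (lsum (\<otimes>) t)) = adj (L t)" for s t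
    by (simp_all only: lsum_tensor_ops[symmetric] FL L_mult L_adj)
  have m1: "F (lsum (\<otimes>) s * y) = L s * F y" for s y
    by (rule dense_induct[OF closure_range_lsum_tensor, of "\<lambda>y. F (lsum (\<otimes>) s * y) = L s * F y"])
      (auto intro!: closed_Collect_eq Fc continuous_intros simp: FL FLm)
  have m2: "F (x * y) = F x * F y" for x y
    by (rule dense_induct[OF closure_range_lsum_tensor, of "\<lambda>x. F (x * y) = F x * F y"])
      (auto intro!: closed_Collect_eq Fc continuous_intros simp: FL m1)
  have ad: "F (adj x) = adj (F x)" for x
    by (rule dense_induct[OF closure_range_lsum_tensor, of "\<lambda>x. F (adj x) = adj (F x)"])
      (auto intro!: closed_Collect_eq Fc continuous_intros simp: FL FLa)
  have "F 1 = 1" using F(3)[of 1 1] by (simp add: tensor_one ps qs)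
  with F(1) m2 ad have "unital_star_hom_on UNIV F" by (intro unital_star_homI)
  then show ?thesis using F(3) by (rule that)
qed

lemma star_hom_tensor_left:
  fixes f :: "'a::cstar_algebra \<Rightarrow> 'b::cstar_algebra"
  assumes "unital_star_hom_on UNIV f"
  shows "unital_star_hom_on UNIV (\<lambda>x. f x \<otimes> (1 :: 'c::cstar_algebra))"
  unfolding unital_star_hom_on_def
  by (simp add: star_hom_simps[OF assms] tensor_add_left tensor_scaleC_left tensor_mult tensor_adj tensor_one)

lemma star_hom_tensor_right:
  fixes f :: "'a::cstar_algebra \<Rightarrow> 'b::cstar_algebra"
  assumes "unital_star_hom_on UNIV f"
  shows "unital_star_hom_on UNIV (\<lambda>x. (1 :: 'c::cstar_algebra) \<otimes> f x)"
  unfolding unital_star_hom_on_def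
  by (simp add: star_hom_simps[OF assms] tensor_add_right tensor_scaleC_right tensor_mult tensor_adj tensor_one)

lemma star_hom_id: "unital_star_hom_on UNIV id" "unital_star_hom_on UNIV (\<lambda>x. x)"
  by (simp_all add: unital_star_hom_on_def)

text \<open>A product state composed with \<open>f \<otimes> g\<close> is the product of the
  pulled-back states, hence contractive; this supplies the bound for
  \<open>tensor_hom_lift\<close>.\<close>

lemma tensor_map_hom:
  fixes f :: "'a::cstar_algebra \<Rightarrow> 'c::cstar_algebra" and g :: "'b::cstar_algebra \<Rightarrow> 'd::cstar_algebra"
  assumes f: "unital_star_hom_on UNIV f" and g: "unital_star_hom_on UNIV g"
  shows "unital_star_hom_on UNIV (tensor_map UNIV f UNIV g)"
    and "tensor_map UNIV f UNIV g (a \<otimes> b) = f a \<otimes> g b"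
proof -
  obtain F :: "('a, 'b) min_tensor \<Rightarrow> ('c, 'd) min_tensor" where F: "unital_star_hom_on UNIV F"
    "\<And>a b. F (a \<otimes> b) = (f a \<otimes> 1) * (1 \<otimes> g b)"
  proof (rule tensor_hom_lift[OF star_hom_tensor_left[OF f] star_hom_tensor_right[OF g]])
    fix \<phi> :: "'c \<Rightarrow> complex" and \<psi> :: "'d \<Rightarrow> complex" assume st: "state \<phi>" "state \<psi>"
    let ?\<phi> = "\<lambda>x. \<phi> (f x)" and ?\<psi> = "\<lambda>x. \<psi> (g x)"
    have st': "state ?\<phi>" "state ?\<psi>"
      by (rule state_compose_hom[OF st(1) f], rule state_compose_hom[OF st(2) g])
    have "prod_state \<phi> \<psi> (lsum (\<lambda>a b. (f a \<otimes> 1) * (1 \<otimes> g b)) t) = prod_state ?\<phi> ?\<psi> (lsum (\<otimes>) t)" for t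
      by (induction t) (auto simp: state_simps[OF state_prod_state[OF st]] state_simps[OF state_prod_state[OF st']]
          prod_state_tensor[OF st] prod_state_tensor[OF st'] tensor_mult)
    then have "cmod (prod_state \<phi> \<psi> (lsum (\<lambda>a b. (f a \<otimes> 1) * (1 \<otimes> g b)) t)) \<le> 1 * spatial_norm t" for t
      using state_norm_le[OF state_prod_state[OF st'], of "lsum (\<otimes>) t"] by (simp add: norm_lsum_tensor)
    then show "\<exists>K. \<forall>t. cmod (prod_state \<phi> \<psi> (lsum (\<lambda>a b. (f a \<otimes> 1) * (1 \<otimes> g b)) t)) \<le> K * spatial_norm t"
      by blast
  qed (simp add: tensor_mult, blast)
  have "tensor_map UNIV f UNIV g = F"
    unfolding tensor_map_def
    by (rule tensor_lift_UNIV[OF star_hom_bounded_clinear[OF F(1)]]) (simp add: F(2) tensor_mult)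
  with F show "unital_star_hom_on UNIV (tensor_map UNIV f UNIV g)" "tensor_map UNIV f UNIV g (a \<otimes> b) = f a \<otimes> g b"
    by (simp_all add: tensor_mult)
qed

section \<open>Associativity\<close>

text \<open>The slice of \<open>d\<close> in the first of three legs is a compression: matrix
  coefficients of the slice are those of \<open>d\<close> between vectors embedded by
  \<open>j\<close>, which inserts 1 in the first leg. A compression does not increase the
  norm.\<close>

lemma norm_slice_tensor_le:
  fixes \<phi> :: "'a::cstar_algebra \<Rightarrow> complex"
    and d :: "(('a, 'b::cstar_algebra) min_tensor \<times> 'c::cstar_algebra) list"
  assumes \<phi>: "state \<phi>"
  shows "norm (lsum (\<lambda>t c. lslice \<phi> t \<otimes> c) d) \<le> spatial_norm d"
proof (rule norm_min_tensor_le)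
  show "0 \<le> spatial_norm d" by (rule spatial_norm_nonneg)
  fix \<psi>\<^sub>1 :: "'b \<Rightarrow> complex" and \<psi>\<^sub>2 :: "'c \<Rightarrow> complex" and s :: "('b \<times> 'c) list"
  assume st: "state \<psi>\<^sub>1" "state \<psi>\<^sub>2"
  define j :: "('b, 'c) min_tensor \<Rightarrow> (('a, 'b) min_tensor, 'c) min_tensor"
    where "j = tensor_map UNIV (\<lambda>b. 1 \<otimes> b) UNIV (\<lambda>c. c)"
  have jh: "unital_star_hom_on UNIV j"
    unfolding j_def by (rule tensor_map_hom(1)[OF star_hom_tensor_right[OF star_hom_id(2)] star_hom_id(2)])
  have jt: "j (b \<otimes> c) = (1 \<otimes> b) \<otimes> c" for b c
    unfolding j_def by (rule tensor_map_hom(2)[OF star_hom_tensor_right[OF star_hom_id(2)] star_hom_id(2)])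
  note jb = star_hom_bounded_clinear[OF jh]
  let ?\<eta> = "prod_state \<phi> \<psi>\<^sub>1"
  note \<eta> = state_prod_state[OF \<phi> st(1)]
  let ?P = "prod_state \<psi>\<^sub>1 \<psi>\<^sub>2" and ?Q = "prod_state ?\<eta> \<psi>\<^sub>2"
  note P = state_prod_state[OF st] and Q = state_prod_state[OF \<eta> st(2)]
  note Pb = prod_state_bounded_clinear[OF st] and Qb = prod_state_bounded_clinear[OF \<eta> st(2)]
  note Sb = lslice(1)[OF \<phi>]
  \<comment> \<open>The compression identity is spread from elementary tensors by bounded linearity,
    one argument at a time: \<open>t\<close> here, then the left and the right multiplier.\<close>
  have 1: "?P ((x \<otimes> z) * (lslice \<phi> t \<otimes> c) * (x' \<otimes> z')) = ?Q (((1 \<otimes> x) \<otimes> z) * (t \<otimes> c) * ((1 \<otimes> x') \<otimes> z'))"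
    for x x' z z' c t
    by (rule bounded_clinear_tensor_eq[of "\<lambda>t. ?P ((x \<otimes> z) * (lslice \<phi> t \<otimes> c) * (x' \<otimes> z'))"
          "\<lambda>t. ?Q (((1 \<otimes> x) \<otimes> z) * (t \<otimes> c) * ((1 \<otimes> x') \<otimes> z'))"])
      (intro bounded_clinear_compose[OF _ Pb] bounded_clinear_compose[OF _ Qb]
        bounded_clinear_compose[OF _ bounded_clinear_mult_right] bounded_clinear_compose[OF _ bounded_clinear_mult_left]
        bounded_clinear_tensor_left bounded_clinear_tensor_right Sb bounded_clinear_ident
      | simp add: tensor_mult lslice(2)[OF \<phi>] prod_state_tensor[OF st] prod_state_tensor[OF \<eta> st(2)]
          prod_state_tensor[OF \<phi> st(1)] state_simps[OF st(1)] scaleC_mult_left scaleC_mult_right)+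
  have 2: "?P (u * (lslice \<phi> t \<otimes> c) * (x' \<otimes> z')) = ?Q (j u * (t \<otimes> c) * ((1 \<otimes> x') \<otimes> z'))"
    for x' z' c t u
    by (rule bounded_clinear_tensor_eq[of "\<lambda>u. ?P (u * (lslice \<phi> t \<otimes> c) * (x' \<otimes> z'))"
          "\<lambda>u. ?Q (j u * (t \<otimes> c) * ((1 \<otimes> x') \<otimes> z'))"])
      (intro bounded_clinear_compose[OF _ Pb] bounded_clinear_compose[OF _ Qb]
        bounded_clinear_compose[OF _ bounded_clinear_mult_right] bounded_clinear_ident jb
      | simp add: jt 1)+
  have 3: "?P (u * (lslice \<phi> t \<otimes> c) * v) = ?Q (j u * (t \<otimes> c) * j v)" for c t u v
    by (rule bounded_clinear_tensor_eq[of "\<lambda>v. ?P (u * (lslice \<phi> t \<otimes> c) * v)"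
          "\<lambda>v. ?Q (j u * (t \<otimes> c) * j v)"])
      (intro bounded_clinear_compose[OF _ Pb] bounded_clinear_compose[OF _ Qb]
        bounded_clinear_compose[OF _ bounded_clinear_mult_left] bounded_clinear_ident jb
      | simp add: jt 2)+
  have j: "?Q (j u) = ?P u" for u
    by (rule bounded_clinear_tensor_eq[OF bounded_clinear_compose[OF jb Qb] Pb])
      (simp add: jt prod_state_tensor[OF st] prod_state_tensor[OF \<eta> st(2)]
          prod_state_tensor[OF \<phi> st(1)] state_simps[OF \<phi>])
  define y where "y = lsum (\<lambda>t c. lslice \<phi> t \<otimes> c) d"
  define D where "D = lsum (\<otimes>) d"
  have 4: "?P (u * y * v) = ?Q (j u * D * j v)" for u v
    unfolding y_def D_def
    by (subst lsum_linear[of "\<lambda>y. ?P (u * y * v)"], simp_all add: distrib_left distrib_right state_simps[OF P])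
      (subst lsum_linear[of "\<lambda>D. ?Q (j u * D * j v)"], simp_all add: distrib_left distrib_right state_simps[OF Q] 3)
  let ?w = "lsum (\<otimes>) s"
  \<comment> \<open>Taking \<open>adj u\<close> as the left multiplier makes the coefficient
    \<open>?P (adj u * u)\<close>. Cauchy-Schwarz bounds its square by itself times the wanted
    bound, and one factor cancels.\<close>
  define u where "u = y * ?w"
  define N where "N = spatial_norm d"
  have Dn: "norm D = N" by (simp add: D_def N_def norm_lsum_tensor)
  have "?P (adj u * u) = ?Q (adj (j u) * (D * j ?w))"
    using 4[of "adj u" ?w] by (simp add: u_def mult.assoc star_hom_simps[OF jh])
  then have "(cmod (?P (adj u * u)))\<^sup>2 \<le> Re (?Q (adj (j u) * j u)) * Re (?Q (adj (D * j ?w) * (D * j ?w)))"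
    using positive_functional_cauchy_schwarz[of ?Q "j u" "D * j ?w"]
    by (simp add: state_simps[OF Q] state_pos[OF Q])
  also have "?Q (adj (j u) * j u) = ?P (adj u * u)" by (simp flip: star_hom_simps(2,4)[OF jh] add: j)
  also have "Re (?Q (adj (D * j ?w) * (D * j ?w))) \<le> N\<^sup>2 * Re (?P (adj ?w * ?w))"
  proof -
    define g where "g z = ?Q (adj (j ?w) * z * j ?w)" for z
    have gb: "bounded_clinear g"
      unfolding g_def[abs_def]
      by (intro bounded_clinear_compose[OF _ Qb]
          bounded_clinear_compose[OF bounded_clinear_mult_left bounded_clinear_mult_right])
    have gp: "g (adj z * z) = ?Q (adj (z * j ?w) * (z * j ?w))" for z
      by (simp add: g_def adj_mult mult.assoc)
    obtain C where C: "\<And>z. norm (g z) \<le> C * norm z" using bounded_clinear_boundE[OF gb] by blast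
    have "Re (g (adj D * D)) \<le> (norm D)\<^sup>2 * Re (g 1)"
      by (rule positive_functional_bound[OF _ _ _ _ C])
        (simp_all add: bounded_clinear_simps[OF gb] scaleC_complex_def gp state_pos[OF Q])
    moreover have "g 1 = ?P (adj ?w * ?w)" by (simp add: g_def j flip: star_hom_simps(2,4)[OF jh])
    ultimately show ?thesis by (simp add: gp Dn)
  qed
  finally have le: "(cmod (?P (adj u * u)))\<^sup>2 \<le> Re (?P (adj u * u)) * (N\<^sup>2 * Re (?P (adj ?w * ?w)))"
    using state_pos(1)[OF P, of u] by (simp add: mult_left_mono)
  have "Re (?P (adj u * u)) \<le> N\<^sup>2 * Re (?P (adj ?w * ?w))"
  proof (cases "Re (?P (adj u * u)) = 0")
    case True
    then show ?thesis using state_pos(1)[OF P, of ?w] by simp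
  next
    case False
    then have pos: "0 < Re (?P (adj u * u))" using state_pos(1)[OF P, of u] by simp
    have "Re (?P (adj u * u)) * Re (?P (adj u * u)) \<le> (cmod (?P (adj u * u)))\<^sup>2"
      unfolding power2_eq_square using pos by (intro mult_mono complex_Re_le_cmod) auto
    with le have "Re (?P (adj u * u)) * Re (?P (adj u * u)) \<le> Re (?P (adj u * u)) * (N\<^sup>2 * Re (?P (adj ?w * ?w)))"
      by linarith
    from mult_left_le_imp_le[OF this pos] show ?thesis .
  qed
  then show "Re (?P (adj (lsum (\<lambda>t c. lslice \<phi> t \<otimes> c) d * ?w) * (lsum (\<lambda>t c. lslice \<phi> t \<otimes> c) d * ?w)))
      \<le> (spatial_norm d)\<^sup>2 * Re (?P (adj ?w * ?w))"
    by (simp only: u_def N_def y_def)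
qed

text \<open>The associator is \<open>tensor_hom_lift\<close> of the commuting maps
  \<open>a \<otimes> b \<mapsto> a \<otimes> (b \<otimes> 1)\<close> and
  \<open>c \<mapsto> 1 \<otimes> (1 \<otimes> c)\<close>. The state \<psi> of the inner tensor
  product need not be a product state, so only the first leg is sliced by a state and
  \<open>norm_slice_tensor_le\<close> bounds what remains.\<close>

lemma tensor_assoc:
  fixes a :: "'a::cstar_algebra" and b :: "'b::cstar_algebra" and c :: "'c::cstar_algebra"
  shows "unital_star_hom_on UNIV (tensor_assoc :: (('a, 'b) min_tensor, 'c) min_tensor \<Rightarrow> _)"
    and "tensor_assoc ((a \<otimes> b) \<otimes> c) = a \<otimes> (b \<otimes> c)"
proof -
  define T :: "('a, 'b) min_tensor \<Rightarrow> ('a, ('b, 'c) min_tensor) min_tensor"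
    where "T = tensor_map UNIV (\<lambda>a. a) UNIV (\<lambda>b. b \<otimes> 1)"
  have Th: "unital_star_hom_on UNIV T"
    unfolding T_def by (rule tensor_map_hom(1)[OF star_hom_id(2) star_hom_tensor_left[OF star_hom_id(2)]])
  have Tt: "T (a \<otimes> b) = a \<otimes> (b \<otimes> 1)" for a b
    unfolding T_def by (rule tensor_map_hom(2)[OF star_hom_id(2) star_hom_tensor_left[OF star_hom_id(2)]])
  note Tb = star_hom_bounded_clinear[OF Th]
  define q :: "'c \<Rightarrow> ('a, ('b, 'c) min_tensor) min_tensor" where "q c = 1 \<otimes> (1 \<otimes> c)" for c
  have qh: "unital_star_hom_on UNIV q"
    unfolding q_def[abs_def] by (rule star_hom_tensor_right[OF star_hom_tensor_right[OF star_hom_id(2)]])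
  obtain F where F: "unital_star_hom_on UNIV F" "\<And>t c. F (t \<otimes> c) = T t * q c"
  proof (rule tensor_hom_lift[OF Th qh])
    show "T t * q c = q c * T t" for t c
      by (rule bounded_clinear_tensor_eq[of "\<lambda>t. T t * q c" "\<lambda>t. q c * T t",
            OF bounded_clinear_compose[OF Tb bounded_clinear_mult_right]
            bounded_clinear_compose[OF Tb bounded_clinear_mult_left]])
        (simp add: Tt q_def tensor_mult)
    fix \<phi> :: "'a \<Rightarrow> complex" and \<psi> :: "('b, 'c) min_tensor \<Rightarrow> complex" assume st: "state \<phi>" "state \<psi>"
    have s: "lslice \<phi> (T t * q c) = lslice \<phi> t \<otimes> c" for t c
      by (rule bounded_clinear_tensor_eq[of "\<lambda>t. lslice \<phi> (T t * q c)" "\<lambda>t. lslice \<phi> t \<otimes> c", OF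
            bounded_clinear_compose[OF bounded_clinear_compose[OF Tb bounded_clinear_mult_right] lslice(1)[OF st(1)]]
            bounded_clinear_tensor_left[OF lslice(1)[OF st(1)]]])
        (simp add: Tt q_def tensor_mult lslice[OF st(1)] tensor_scaleC_left)
    have "lslice \<phi> (lsum (\<lambda>t c. T t * q c) d) = lsum (\<lambda>t c. lslice \<phi> t \<otimes> c) d" for d
      by (subst lsum_linear[of "lslice \<phi>"]) (simp_all add: bounded_clinear_simps[OF lslice(1)[OF st(1)]] s)
    then have "cmod (prod_state \<phi> \<psi> (lsum (\<lambda>t c. T t * q c) d)) \<le> 1 * spatial_norm d" for d
      using order_trans[OF state_norm_le[OF st(2)] norm_slice_tensor_le[OF st(1), of d]]
      by (simp add: prod_state_def)
    then show "\<exists>K. \<forall>d. cmod (prod_state \<phi> \<psi> (lsum (\<lambda>t c. T t * q c) d)) \<le> K * spatial_norm d"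
      by blast
  qed blast
  have "tensor_lift UNIV UNIV (\<lambda>a b. a \<otimes> b \<otimes> c) = (\<lambda>t. T t * q c)" for c
    by (rule tensor_lift_UNIV[OF bounded_clinear_compose[OF Tb bounded_clinear_mult_right]])
      (simp add: Tt q_def tensor_mult)
  then have "tensor_assoc = F"
    unfolding tensor_assoc_def
    by (intro tensor_lift_UNIV star_hom_bounded_clinear F(1)) (simp add: F(2))
  with F show "unital_star_hom_on UNIV (tensor_assoc :: (('a, 'b) min_tensor, 'c) min_tensor \<Rightarrow> _)"
    "tensor_assoc ((a \<otimes> b) \<otimes> c) = a \<otimes> (b \<otimes> c)"
    by (simp_all add: Tt q_def tensor_mult)
qed

section \<open>The counit\<close>

lemma bounded_clinear_sum:
  fixes n :: nat
  assumes "bounded_clinear f"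
  shows "f (\<Sum>i<n. g i) = (\<Sum>i<n. f (g i))"
  by (induction n) (simp_all add: bounded_clinear_simps[OF assms])

lemma star_subalgebraD:
  assumes "star_subalgebra S"
  shows "0 \<in> S" "x \<in> S \<Longrightarrow> y \<in> S \<Longrightarrow> x + y \<in> S" "x \<in> S \<Longrightarrow> y \<in> S \<Longrightarrow> x * y \<in> S"
    "x \<in> S \<Longrightarrow> c *\<^sub>C x \<in> S" "x \<in> S \<Longrightarrow> adj x \<in> S"
  using assms unfolding star_subalgebra_def by blast+

lemma alg_tensor_setD:
  assumes S: "star_subalgebra S" and z: "z \<in> alg_tensor_set S T"
  shows "\<exists>(n :: nat) x y. (\<forall>i<n. x i \<in> S \<and> y i \<in> T) \<and> z = (\<Sum>i<n. x i \<otimes> y i)"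
proof -
  obtain n c s where s: "\<forall>i<n. s i \<in> {b \<otimes> c |b c. b \<in> S \<and> c \<in> T}" "z = (\<Sum>i<(n::nat). c i *\<^sub>C s i)"
    using z unfolding alg_tensor_set_def cspan_def by blast
  from s(1) have "\<forall>i. \<exists>b d. i < n \<longrightarrow> b \<in> S \<and> d \<in> T \<and> s i = b \<otimes> d" by blast
  then obtain b d where bd: "\<And>i. i < n \<Longrightarrow> b i \<in> S \<and> d i \<in> T \<and> s i = b i \<otimes> d i" by metis
  have "z = (\<Sum>i<n. (c i *\<^sub>C b i) \<otimes> d i)"
    unfolding s(2) by (intro sum.cong refl) (simp add: bd tensor_scaleC_left)
  moreover have "\<forall>i<n. c i *\<^sub>C b i \<in> S \<and> d i \<in> T" using bd star_subalgebraD(4)[OF S] by blast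
  ultimately show ?thesis by (intro exI[of _ n] exI[of _ "\<lambda>i. c i *\<^sub>C b i"] exI[of _ d] conjI)
qed

lemma state_star_hom:
  fixes f :: "'a::cstar_algebra \<Rightarrow> complex"
  assumes "unital_star_hom_on UNIV f"
  shows "state f"
  unfolding state_on_def
  using star_hom_bounded_clinear[OF assms]
  by (simp add: star_hom_simps[OF assms] adj_complex_def)

lemma star_hom_on_extension:
  fixes f :: "'a::cstar_algebra \<Rightarrow> 'b::cstar_algebra"
  assumes S: "star_subalgebra S" "closure S = UNIV" "1 \<in> S" and f: "unital_star_hom_on S f"
    and bd: "\<And>x. x \<in> S \<Longrightarrow> norm (f x) \<le> K * norm x"
  shows "\<exists>F. unital_star_hom_on UNIV F \<and> (\<forall>x\<in>S. F x = f x)"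
proof -
  have "bounded_clinear_on S f"
    using f bd unfolding bounded_clinear_on_def unital_star_hom_on_def by blast
  then have "\<exists>F. bounded_clinear F \<and> (\<forall>x\<in>S. F x = f x)"
    using bounded_clinear_extension[of S f] S(2) star_subalgebraD(2,4)[OF S(1)] by (metis (full_types))
  then obtain F where F: "bounded_clinear F" "\<And>x. x \<in> S \<Longrightarrow> F x = f x" by blast
  note Fc = bounded_clinear_continuous[OF F(1)] and D = star_subalgebraD[OF S(1)]
  have fm: "f (x * y) = f x * f y" "f (adj x) = adj (f x)" "f 1 = 1" if "x \<in> S" "y \<in> S" for x y
    using f that unfolding unital_star_hom_on_def by blast+
  have m1: "F (x * y) = F x * F y" if "y \<in> S" for x y
    by (rule dense_induct[OF S(2), of "\<lambda>x. F (x * y) = F x * F y"])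
      (use that in \<open>auto intro!: closed_Collect_eq Fc continuous_intros simp: F(2) D fm\<close>)
  have m2: "F (x * y) = F x * F y" for x y
    by (rule dense_induct[OF S(2), of "\<lambda>y. F (x * y) = F x * F y"])
      (auto intro!: closed_Collect_eq Fc continuous_intros m1)
  have ad: "F (adj x) = adj (F x)" for x
    by (rule dense_induct[OF S(2), of "\<lambda>x. F (adj x) = adj (F x)"])
      (auto intro!: closed_Collect_eq Fc continuous_intros simp: F(2) D fm)
  have "F 1 = 1" using F(2)[OF S(3)] fm(3)[OF S(3) S(3)] by simp
  then show ?thesis using unital_star_homI[OF F(1) m2 ad] F(2) by blast
qed

lemma hopf_star_algebra_on_cong:
  assumes H: "hopf_star_algebra_on S \<Phi> \<epsilon> \<kappa>" and eq: "\<And>x. x \<in> S \<Longrightarrow> \<epsilon>' x = \<epsilon> x"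
    and hom: "unital_star_hom_on UNIV \<epsilon>'"
  shows "hopf_star_algebra_on S \<Phi> \<epsilon>' \<kappa>"
proof -
  have "unital_star_hom_on S \<epsilon>'" using hom unfolding unital_star_hom_on_def by blast
  moreover have "(\<Sum>i<n. \<epsilon>' (x i) *\<^sub>C y i) = (\<Sum>i<n. \<epsilon> (x i) *\<^sub>C y i)" if "\<forall>i<n. x i \<in> S \<and> z i \<in> S"
    for n :: nat and x and y z :: "nat \<Rightarrow> 'a"
    using that eq by (intro sum.cong) auto
  moreover have "(\<Sum>i<n. \<epsilon>' (x i) *\<^sub>C y i) = (\<Sum>i<n. \<epsilon> (x i) *\<^sub>C y i)" if "\<forall>i<n. z i \<in> S \<and> x i \<in> S"
    for n :: nat and x and y z :: "nat \<Rightarrow> 'a"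
    using that eq by (intro sum.cong) auto
  ultimately show ?thesis using H eq unfolding hopf_star_algebra_on_def by simp
qed

context
  fixes \<Phi> :: "'a::cstar_algebra \<Rightarrow> ('a, 'a) min_tensor"
  assumes full: "full_woronowicz_algebra \<Phi>"
begin

lemma coproduct_hom: "unital_star_hom_on UNIV \<Phi>"
  using full by (simp add: full_woronowicz_algebra_def)

lemma coeff_algebra:
  shows "star_subalgebra (coeff_algebra \<Phi>)" and "1 \<in> coeff_algebra \<Phi>"
    and "closure (coeff_algebra \<Phi>) = UNIV"
    and "a \<in> coeff_algebra \<Phi> \<Longrightarrow> \<Phi> a \<in> alg_tensor_set (coeff_algebra \<Phi>) (coeff_algebra \<Phi>)"
  using full unfolding full_woronowicz_algebra_def hopf_star_algebra_on_def by blast+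

text \<open>Apply \<open>G\<close> to the left counit identity of \<open>F\<close>, and
  \<open>F\<close> to the right counit identity of \<open>G\<close>: both give the sum of the F(x_i)
  G(y_i). This is what makes the definite description in \<open>counit\<close> meaningful.\<close>

lemma hopf_counit_unique:
  assumes F: "unital_star_hom_on UNIV F" "hopf_star_algebra_on (coeff_algebra \<Phi>) \<Phi> F \<kappa>"
    and G: "unital_star_hom_on UNIV G" "hopf_star_algebra_on (coeff_algebra \<Phi>) \<Phi> G \<kappa>'"
  shows "F = G"
proof
  fix a
  note Fb = star_hom_bounded_clinear[OF F(1)] and Gb = star_hom_bounded_clinear[OF G(1)]
  have eq: "F a = G a" if a: "a \<in> coeff_algebra \<Phi>" for a
  proof -
    obtain n :: nat and x y where xy0: "(\<forall>i<n. x i \<in> coeff_algebra \<Phi> \<and> y i \<in> coeff_algebra \<Phi>) \<and>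
        \<Phi> a = (\<Sum>i<n. x i \<otimes> y i)"
      using alg_tensor_setD[OF coeff_algebra(1) coeff_algebra(4)[OF a]] by blast
    note xy = conjunct1[OF xy0] conjunct2[OF xy0]
    have 1: "(\<Sum>i<n. F (x i) *\<^sub>C y i) = a" using F(2) a xy unfolding hopf_star_algebra_on_def by blast
    have 2: "(\<Sum>i<n. G (y i) *\<^sub>C x i) = a" using G(2) a xy unfolding hopf_star_algebra_on_def by blast
    have "G a = (\<Sum>i<n. F (x i) * G (y i))"
      by (subst 1[symmetric]) (simp add: bounded_clinear_sum[OF Gb] star_hom_simps[OF G(1)] scaleC_complex_def)
    moreover have "F a = (\<Sum>i<n. G (y i) * F (x i))"
      by (subst 2[symmetric]) (simp add: bounded_clinear_sum[OF Fb] star_hom_simps[OF F(1)] scaleC_complex_def)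
    ultimately show ?thesis by (simp add: mult.commute)
  qed
  show "F a = G a"
    by (rule dense_induct[OF coeff_algebra(3), of "\<lambda>a. F a = G a"])
      (auto intro!: closed_Collect_eq bounded_clinear_continuous[OF Fb] bounded_clinear_continuous[OF Gb]
        continuous_on_id eq)
qed

text \<open>The modulus of the counit is a C*-seminorm on the coefficient algebra. Since the norm is
  the largest such seminorm, the counit is bounded and extends by density.\<close>

lemma counit:
  shows "unital_star_hom_on UNIV (counit \<Phi>)" and "rslice (counit \<Phi>) (\<Phi> a) = a"
proof -
  obtain \<epsilon> \<kappa> where H: "hopf_star_algebra_on (coeff_algebra \<Phi>) \<Phi> \<epsilon> \<kappa>"
    using full unfolding full_woronowicz_algebra_def by blast
  then have e: "unital_star_hom_on (coeff_algebra \<Phi>) \<epsilon>" unfolding hopf_star_algebra_on_def by blast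
  then have es: "\<epsilon> (x + y) = \<epsilon> x + \<epsilon> y" "\<epsilon> (x * y) = \<epsilon> x * \<epsilon> y" "\<epsilon> (c *\<^sub>C x) = c * \<epsilon> x" "\<epsilon> (adj x) = cnj (\<epsilon> x)"
    if "x \<in> coeff_algebra \<Phi>" "y \<in> coeff_algebra \<Phi>" for x y c
    using that unfolding unital_star_hom_on_def scaleC_complex_def adj_complex_def by blast+
  note D = star_subalgebraD[OF coeff_algebra(1)]
  have "cstar_seminorm_on (coeff_algebra \<Phi>) (\<lambda>a. cmod (\<epsilon> a))"
    unfolding cstar_seminorm_on_def
  proof (intro conjI ballI allI)
    fix x y c assume x: "x \<in> coeff_algebra \<Phi>"
    show "cmod (\<epsilon> (adj x * x)) = (cmod (\<epsilon> x))\<^sup>2"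
      using es(2)[OF D(5)[OF x] x] es(4)[OF x x] by (simp add: norm_mult power2_eq_square)
    show "cmod (\<epsilon> (c *\<^sub>C x)) = cmod c * cmod (\<epsilon> x)" by (simp add: es(3)[OF x x] norm_mult)
    assume y: "y \<in> coeff_algebra \<Phi>"
    show "cmod (\<epsilon> (x + y)) \<le> cmod (\<epsilon> x) + cmod (\<epsilon> y)" by (simp add: es(1)[OF x y] norm_triangle_ineq)
    show "cmod (\<epsilon> (x * y)) \<le> cmod (\<epsilon> x) * cmod (\<epsilon> y)" by (simp add: es(2)[OF x y] norm_mult)
  qed simp
  then have bd: "cmod (\<epsilon> x) \<le> 1 * norm x" if "x \<in> coeff_algebra \<Phi>" for x
    using full that unfolding full_woronowicz_algebra_def by auto
  obtain F where F: "unital_star_hom_on UNIV F" "\<And>x. x \<in> coeff_algebra \<Phi> \<Longrightarrow> F x = \<epsilon> x"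
    using star_hom_on_extension[OF coeff_algebra(1,3,2) e bd] by blast
  have HF: "hopf_star_algebra_on (coeff_algebra \<Phi>) \<Phi> F \<kappa>"
    by (rule hopf_star_algebra_on_cong[OF H F(2) F(1)])
  have cF: "counit \<Phi> = F"
    unfolding counit_def by (rule the_equality) (use F(1) HF hopf_counit_unique in blast)+
  show "unital_star_hom_on UNIV (counit \<Phi>)" using F(1) by (simp add: cF)
  note sF = state_star_hom[OF F(1)]
  have b: "bounded_clinear (\<lambda>a. rslice F (\<Phi> a))"
    by (rule bounded_clinear_compose[OF star_hom_bounded_clinear[OF coproduct_hom] rslice(1)[OF sF]])
  have "rslice F (\<Phi> a) = a"
  proof (rule dense_induct[OF coeff_algebra(3), of "\<lambda>a. rslice F (\<Phi> a) = a"])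
    show "closed {a. rslice F (\<Phi> a) = a}"
      by (intro closed_Collect_eq bounded_clinear_continuous[OF b] continuous_on_id)
    fix a assume a: "a \<in> coeff_algebra \<Phi>"
    obtain n :: nat and x y where xy0: "(\<forall>i<n. x i \<in> coeff_algebra \<Phi> \<and> y i \<in> coeff_algebra \<Phi>) \<and>
        \<Phi> a = (\<Sum>i<n. x i \<otimes> y i)"
      using alg_tensor_setD[OF coeff_algebra(1) coeff_algebra(4)[OF a]] by blast
    note xy = conjunct1[OF xy0] conjunct2[OF xy0]
    have "(\<Sum>i<n. F (y i) *\<^sub>C x i) = a" using HF a xy unfolding hopf_star_algebra_on_def by blast
    then show "rslice F (\<Phi> a) = a"
      by (simp add: xy(2) bounded_clinear_sum[OF rslice(1)[OF sF]] rslice(2)[OF sF])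
  qed
  then show "rslice (counit \<Phi>) (\<Phi> a) = a" by (simp add: cF)
qed

end

section \<open>The quotient by a quantum subgroup\<close>

definition quotient_expectation ::
    "('g::cstar_algebra \<Rightarrow> ('g, 'g) min_tensor) \<Rightarrow> ('g \<Rightarrow> 'h::cstar_algebra) \<Rightarrow> ('h \<Rightarrow> complex) \<Rightarrow> 'g \<Rightarrow> 'g"
  where "quotient_expectation \<Phi> \<theta> h a = lslice (h \<circ> \<theta>) (\<Phi> a)"

lemma haar_stateD:
  assumes "haar_state \<Phi> h"
  shows "state h" "rslice h (\<Phi> a) = h a *\<^sub>C 1" "lslice h (\<Phi> a) = h a *\<^sub>C 1"
  using assms by (simp_all add: haar_state_def)

text \<open>The exchange of slices behind both Haar state computations,
  \<open>invariant_state_eq_haar\<close> and \<open>haar_E\<close>.\<close>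

lemma slice_fubini:
  assumes "state \<phi>" "state \<psi>"
  shows "\<psi> (lslice \<phi> z) = \<phi> (rslice \<psi> z)"
  by (rule bounded_clinear_tensor_eq[of "\<lambda>z. \<psi> (lslice \<phi> z)" "\<lambda>z. \<phi> (rslice \<psi> z)", OF
        bounded_clinear_compose[OF lslice(1)[OF assms(1)] state_bounded_clinear[OF assms(2)]]
        bounded_clinear_compose[OF rslice(1)[OF assms(2)] state_bounded_clinear[OF assms(1)]]])
    (simp add: lslice[OF assms(1)] rslice[OF assms(2)] state_simps[OF assms(1)] state_simps[OF assms(2)] mult.commute)

context
  fixes \<Phi> :: "'g::cstar_algebra \<Rightarrow> ('g, 'g) min_tensor"
    and \<Phi>\<^sub>H :: "'h::cstar_algebra \<Rightarrow> ('h, 'h) min_tensor"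
    and \<theta> :: "'g \<Rightarrow> 'h"
    and h\<^sub>H :: "'h \<Rightarrow> complex"
  assumes full: "full_woronowicz_algebra \<Phi>"
    and morphism: "woronowicz_morphism \<Phi> \<Phi>\<^sub>H \<theta>"
    and haar_H: "haar_state \<Phi>\<^sub>H h\<^sub>H"
begin

abbreviation (input) "B \<equiv> quotient_algebra \<Phi> \<theta>"
abbreviation (input) "E \<equiv> quotient_expectation \<Phi> \<theta> h\<^sub>H"
abbreviation (input) "A\<^sub>0 \<equiv> coeff_algebra \<Phi>"

lemma Phi_hom: "unital_star_hom_on UNIV \<Phi>" by (rule coproduct_hom[OF full])

lemma theta_hom: "unital_star_hom_on UNIV \<theta>"
  using morphism by (simp add: woronowicz_morphism_def)

lemma state_eta: "state (h\<^sub>H \<circ> \<theta>)"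
  unfolding o_def by (rule state_compose_hom[OF haar_stateD(1)[OF haar_H] theta_hom])

lemmas Phi_bounded = star_hom_bounded_clinear[OF Phi_hom]
lemmas theta_bounded = star_hom_bounded_clinear[OF theta_hom]
lemmas theta_id = tensor_map_hom[OF theta_hom star_hom_id(1)]
lemmas slice_eta = lslice[OF state_eta]

lemma E_bounded: "bounded_clinear E"
  unfolding quotient_expectation_def[abs_def] by (rule bounded_clinear_compose[OF Phi_bounded slice_eta(1)])

lemma quotient_unital_cstar_subalgebra: "unital_cstar_subalgebra B"
proof -
  note s = star_hom_simps[OF Phi_hom] star_hom_simps[OF theta_id(1)]
  have "closed B"
    unfolding quotient_algebra_def
    by (intro closed_Collect_eq bounded_clinear_continuous[OF star_hom_bounded_clinear[OF theta_id(1)]]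
        bounded_clinear_continuous[OF Phi_bounded] continuous_on_id
        bounded_clinear_continuous[OF bounded_clinear_tensor_right[OF bounded_clinear_ident]])
  moreover have "(1 :: 'h) \<otimes> (x * y :: 'g) = (1 \<otimes> x) * (1 \<otimes> y)" "(1 :: 'h) \<otimes> adj (x :: 'g) = adj (1 \<otimes> x)" for x y
    by (simp_all add: tensor_mult tensor_adj)
  moreover have "(1 :: 'h) \<otimes> (0 :: 'g) = 0" using tensor_scaleC_right[of "1 :: 'h" 0 "0 :: 'g"] by simp
  ultimately show ?thesis
    unfolding unital_cstar_subalgebra_def star_subalgebra_def quotient_algebra_def
    by (simp add: s tensor_add_right tensor_scaleC_right tensor_one)
qed

lemma quotient_star_subalgebra: "star_subalgebra B" "1 \<in> B"
  using quotient_unital_cstar_subalgebra by (simp_all add: unital_cstar_subalgebra_def)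

text \<open>The map \<open>E \<otimes> id\<close>. As \<open>E\<close> is not multiplicative,
  \<open>tensor_map_hom\<close> does not apply to it; written as a slice after coproduct and
  associator, the map is bounded by construction.\<close>

definition E_tensor_id :: "('g, 'g) min_tensor \<Rightarrow> ('g, 'g) min_tensor"
  where "E_tensor_id z = lslice (h\<^sub>H \<circ> \<theta>) (tensor_assoc (tensor_map UNIV \<Phi> UNIV id z))"

lemma E_tensor_id: "bounded_clinear E_tensor_id" "E_tensor_id (x \<otimes> y) = E x \<otimes> y"
proof -
  note Pid = tensor_map_hom[OF Phi_hom star_hom_id(1)] and assoc = star_hom_bounded_clinear[OF tensor_assoc(1)]
  show "bounded_clinear E_tensor_id"
    unfolding E_tensor_id_def[abs_def]
    by (rule bounded_clinear_compose[OF bounded_clinear_compose[OF star_hom_bounded_clinear[OF Pid(1)] assoc] slice_eta(1)])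
  have "lslice (h\<^sub>H \<circ> \<theta>) (tensor_assoc (w \<otimes> y)) = lslice (h\<^sub>H \<circ> \<theta>) w \<otimes> y" for w :: "('g, 'g) min_tensor"
    by (rule bounded_clinear_tensor_eq[of "\<lambda>w. lslice (h\<^sub>H \<circ> \<theta>) (tensor_assoc (w \<otimes> y))" "\<lambda>w. lslice (h\<^sub>H \<circ> \<theta>) w \<otimes> y",
          OF bounded_clinear_compose[OF bounded_clinear_compose[OF bounded_clinear_tensor_left[OF bounded_clinear_ident] assoc] slice_eta(1)]
          bounded_clinear_tensor_left[OF slice_eta(1)]])
      (simp add: tensor_assoc(2) slice_eta tensor_scaleC_left)
  then show "E_tensor_id (x \<otimes> y) = E x \<otimes> y" by (simp add: E_tensor_id_def Pid(2) quotient_expectation_def)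
qed

text \<open>Coassociativity, with \<open>h\<^sub>H \<theta>\<close> applied to the first leg.\<close>

lemma Phi_E: "\<Phi> (E a) = E_tensor_id (\<Phi> a)"
proof -
  note idP = tensor_map_hom[OF star_hom_id(1) Phi_hom]
  have "\<Phi> (lslice (h\<^sub>H \<circ> \<theta>) z) = lslice (h\<^sub>H \<circ> \<theta>) (tensor_map UNIV id UNIV \<Phi> z)" for z
    by (rule bounded_clinear_tensor_eq[of "\<lambda>z. \<Phi> (lslice (h\<^sub>H \<circ> \<theta>) z)" "\<lambda>z. lslice (h\<^sub>H \<circ> \<theta>) (tensor_map UNIV id UNIV \<Phi> z)",
          OF bounded_clinear_compose[OF slice_eta(1) Phi_bounded]
          bounded_clinear_compose[OF star_hom_bounded_clinear[OF idP(1)] slice_eta(1)]])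
      (simp add: slice_eta idP(2) star_hom_simps[OF Phi_hom])
  moreover have "tensor_assoc (tensor_map UNIV \<Phi> UNIV id (\<Phi> a)) = tensor_map UNIV id UNIV \<Phi> (\<Phi> a)"
    using full unfolding full_woronowicz_algebra_def coassociative_def by blast
  ultimately show ?thesis by (simp add: E_tensor_id_def quotient_expectation_def)
qed

text \<open>Since \<theta> intertwines the coproducts, \<theta>(E a) is the slice of the coproduct
  of \<theta>(a) by the Haar state of H, and invariance makes it scalar.\<close>

lemma theta_E: "\<theta> (E a) = h\<^sub>H (\<theta> a) *\<^sub>C 1"
proof -
  note hs = lslice[OF haar_stateD(1)[OF haar_H]] and tt = tensor_map_hom[OF theta_hom theta_hom]
  have "\<theta> (lslice (h\<^sub>H \<circ> \<theta>) z) = lslice h\<^sub>H (tensor_map UNIV \<theta> UNIV \<theta> z)" for z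
    by (rule bounded_clinear_tensor_eq[of "\<lambda>z. \<theta> (lslice (h\<^sub>H \<circ> \<theta>) z)" "\<lambda>z. lslice h\<^sub>H (tensor_map UNIV \<theta> UNIV \<theta> z)",
          OF bounded_clinear_compose[OF slice_eta(1) theta_bounded]
          bounded_clinear_compose[OF star_hom_bounded_clinear[OF tt(1)] hs(1)]])
      (simp add: slice_eta hs tt(2) star_hom_simps[OF theta_hom])
  moreover have "tensor_map UNIV \<theta> UNIV \<theta> (\<Phi> a) = \<Phi>\<^sub>H (\<theta> a)"
    using morphism by (simp add: woronowicz_morphism_def)
  ultimately show ?thesis by (simp add: quotient_expectation_def haar_stateD(3)[OF haar_H])
qed

text \<open>By \<open>theta_E\<close>, applying \<open>\<theta> \<otimes> id\<close> after
  \<open>E \<otimes> id\<close> turns the first leg into a scalar, which moves to the second leg and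
  forms the slice there.\<close>

lemma E_in_quotient: "E a \<in> B"
proof -
  have "tensor_map UNIV \<theta> UNIV id (E_tensor_id z) = 1 \<otimes> lslice (h\<^sub>H \<circ> \<theta>) z" for z
    by (rule bounded_clinear_tensor_eq[of "\<lambda>z. tensor_map UNIV \<theta> UNIV id (E_tensor_id z)" "\<lambda>z. 1 \<otimes> lslice (h\<^sub>H \<circ> \<theta>) z",
          OF bounded_clinear_compose[OF E_tensor_id(1) star_hom_bounded_clinear[OF theta_id(1)]]
          bounded_clinear_tensor_right[OF slice_eta(1)]])
      (simp add: E_tensor_id(2) theta_id(2) theta_E slice_eta tensor_scaleC_left tensor_scaleC_right)
  then show ?thesis by (simp add: quotient_algebra_def Phi_E) (simp add: quotient_expectation_def)
qed

text \<open>The slice factors through \<open>\<theta> \<otimes> id\<close>, which sends the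
  coproduct of \<open>b\<close> to \<open>1 \<otimes> b\<close>.\<close>

lemma E_quotient:
  assumes "b \<in> B"
  shows "E b = b"
proof -
  note hs = lslice[OF haar_stateD(1)[OF haar_H]]
  have "lslice (h\<^sub>H \<circ> \<theta>) z = lslice h\<^sub>H (tensor_map UNIV \<theta> UNIV id z)" for z :: "('g, 'g) min_tensor"
    by (rule bounded_clinear_tensor_eq[of "lslice (h\<^sub>H \<circ> \<theta>)" "\<lambda>z. lslice h\<^sub>H (tensor_map UNIV \<theta> UNIV id z)",
          OF slice_eta(1) bounded_clinear_compose[OF star_hom_bounded_clinear[OF theta_id(1)] hs(1)]])
      (simp add: slice_eta hs theta_id(2))
  with assms show ?thesis
    by (simp add: quotient_expectation_def quotient_algebra_def hs state_simps(3)[OF haar_stateD(1)[OF haar_H]])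
qed

lemma E_tensor_id_in_min_tensor_set: "E_tensor_id z \<in> min_tensor_set B UNIV"
proof (rule min_tensor_induct[of "\<lambda>z. E_tensor_id z \<in> min_tensor_set B UNIV"])
  have "closed (E_tensor_id -` min_tensor_set B UNIV)"
    by (rule closed_vimage[OF _ bounded_clinear_continuous[OF E_tensor_id(1) continuous_on_id]])
      (simp add: min_tensor_set_def)
  then show "closed {z. E_tensor_id z \<in> min_tensor_set B UNIV}" by (simp add: vimage_def)
  show "E_tensor_id (a \<otimes> b) \<in> min_tensor_set B UNIV" for a b
    unfolding E_tensor_id(2) min_tensor_set_def alg_tensor_set_def
    using E_in_quotient[of a] by (intro subsetD[OF closure_subset] cspan_base) blast
qed (auto simp: bounded_clinear_simps[OF E_tensor_id(1)] min_tensor_set_def alg_tensor_set_def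
    intro: closure_cspan_add subsetD[OF closure_subset cspan_zero])

lemma Phi_quotient: "b \<in> B \<Longrightarrow> \<Phi> b \<in> min_tensor_set B UNIV"
  using E_tensor_id_in_min_tensor_set[of "\<Phi> b"] Phi_E[of b] by (simp add: E_quotient)

text \<open>The coproduct of a coefficient is a finite sum with both legs in
  \<open>A\<^sub>0\<close>. Slicing keeps the second leg, so \<open>E\<close> preserves
  \<open>A\<^sub>0\<close>; then \<open>E \<otimes> id\<close> puts the first legs into
  \<open>B \<inter> A\<^sub>0\<close>.\<close>

lemma E_coeff_algebra:
  assumes "a \<in> A\<^sub>0"
  shows "E a \<in> A\<^sub>0" and "\<Phi> (E a) \<in> alg_tensor_set (B \<inter> A\<^sub>0) A\<^sub>0"
proof -
  note D = star_subalgebraD[OF coeff_algebra(1)[OF full]]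
  have E: "E a \<in> A\<^sub>0" if "a \<in> A\<^sub>0" for a
  proof -
    have "lslice (h\<^sub>H \<circ> \<theta>) z \<in> A\<^sub>0" if "z \<in> alg_tensor_set A\<^sub>0 A\<^sub>0" for z
      using that unfolding alg_tensor_set_def
    proof (induction z rule: cspan_induct)
      case (add z c s)
      from add.hyps(2) obtain x y where s: "s = x \<otimes> y" "y \<in> A\<^sub>0" by blast
      have "lslice (h\<^sub>H \<circ> \<theta>) (z + c *\<^sub>C s) = lslice (h\<^sub>H \<circ> \<theta>) z + c *\<^sub>C (h\<^sub>H \<circ> \<theta>) x *\<^sub>C y"
        by (simp only: s bounded_clinear_simps[OF slice_eta(1)] slice_eta(2))
      also have "\<dots> \<in> A\<^sub>0" by (intro D(2,4) add.IH s)
      finally show ?case .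
    qed (simp only: bounded_clinear_simps(3)[OF slice_eta(1)] D(1))
    then show ?thesis using coeff_algebra(4)[OF full that] by (simp add: quotient_expectation_def)
  qed
  show "E a \<in> A\<^sub>0" by (rule E[OF assms])
  have Rz: "E_tensor_id z \<in> alg_tensor_set (B \<inter> A\<^sub>0) A\<^sub>0" if "z \<in> alg_tensor_set A\<^sub>0 A\<^sub>0" for z
    using that unfolding alg_tensor_set_def
  proof (induction z rule: cspan_induct)
    case (add z c s)
    from add.hyps(2) obtain x y where s: "s = x \<otimes> y" "x \<in> A\<^sub>0" "y \<in> A\<^sub>0" by blast
    have "E_tensor_id (z + c *\<^sub>C s) = E_tensor_id z + c *\<^sub>C (E x \<otimes> y)" by (simp add: s bounded_clinear_simps[OF E_tensor_id(1)] E_tensor_id(2))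
    also have "\<dots> \<in> cspan {b \<otimes> c |b c. b \<in> B \<inter> A\<^sub>0 \<and> c \<in> A\<^sub>0}"
      using E[OF s(2)] E_in_quotient[of x] s(3) by (intro cspan_add_base add.IH) blast
    finally show ?case .
  qed (simp add: bounded_clinear_simps[OF E_tensor_id(1)] cspan_zero)
  show "\<Phi> (E a) \<in> alg_tensor_set (B \<inter> A\<^sub>0) A\<^sub>0"
    unfolding Phi_E by (rule Rz[OF coeff_algebra(4)[OF full assms]])
qed

lemma quotient_action: "cqg_action \<Phi> B \<Phi>"
  unfolding cqg_action_def
proof (intro conjI ballI)
  show "unital_cstar_subalgebra B" by (rule quotient_unital_cstar_subalgebra)
  show "unital_star_hom_on B \<Phi>" using Phi_hom unfolding unital_star_hom_on_def by blast
  show "\<Phi> ` B \<subseteq> min_tensor_set B UNIV" using Phi_quotient by blast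
next
  fix b assume b: "b \<in> B"
  note idP = tensor_map_hom[OF star_hom_id(1) Phi_hom] and Pid = tensor_map_hom[OF Phi_hom star_hom_id(1)]
  \<comment> \<open>Lifts over \<open>B\<close> agree with the global ones on
    \<open>\<Phi> b\<close>, which lies in the closed span of tensors with first leg in
    \<open>B\<close>; so coassociativity on C(G) is all that is left.\<close>
  have "tensor_map B id UNIV \<Phi> (\<Phi> b) = tensor_map UNIV id UNIV \<Phi> (\<Phi> b)"
    unfolding tensor_map_def[of B]
    by (rule tensor_lift_eq[OF star_hom_bounded_clinear[OF idP(1)] _ Phi_quotient[OF b]]) (rule idP(2))
  moreover have "tensor_map B \<Phi> UNIV id (\<Phi> b) = tensor_map UNIV \<Phi> UNIV id (\<Phi> b)"
    unfolding tensor_map_def[of B]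
    by (rule tensor_lift_eq[OF star_hom_bounded_clinear[OF Pid(1)] _ Phi_quotient[OF b]]) (rule Pid(2))
  ultimately show "tensor_map B id UNIV \<Phi> (\<Phi> b) = tensor_assoc (tensor_map B \<Phi> UNIV id (\<Phi> b))"
    using full unfolding full_woronowicz_algebra_def coassociative_def by simp
  note s = state_star_hom[OF counit(1)[OF full]]
  have "slice_right B UNIV (counit \<Phi>) (\<Phi> b) = rslice (counit \<Phi>) (\<Phi> b)"
    unfolding slice_right_def[of B]
    by (rule tensor_lift_eq[OF rslice(1)[OF s] _ Phi_quotient[OF b]]) (rule rslice(2)[OF s])
  then show "slice_right B UNIV (counit \<Phi>) (\<Phi> b) = b" by (simp add: counit(2)[OF full])
next
  have "B \<subseteq> closure (B \<inter> A\<^sub>0)"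
  proof
    fix b assume b: "b \<in> B"
    \<comment> \<open>The core \<open>B \<inter> A\<^sub>0\<close> is dense in \<open>B\<close>: the
      continuous map \<open>E\<close> sends the dense set \<open>A\<^sub>0\<close> into it and fixes
      \<open>B\<close>.\<close>
    have "E ` closure A\<^sub>0 \<subseteq> closure (B \<inter> A\<^sub>0)"
    proof (rule image_closure_subset)
      show "continuous_on (closure A\<^sub>0) E" by (rule bounded_clinear_continuous[OF E_bounded continuous_on_id])
      have "E ` A\<^sub>0 \<subseteq> B \<inter> A\<^sub>0" using E_in_quotient E_coeff_algebra by blast
      then show "E ` A\<^sub>0 \<subseteq> closure (B \<inter> A\<^sub>0)" using closure_subset by blast
    qed simp
    then have "E b \<in> closure (B \<inter> A\<^sub>0)" using coeff_algebra(3)[OF full] by blast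
    then show "b \<in> closure (B \<inter> A\<^sub>0)" by (simp add: E_quotient[OF b])
  qed
  moreover have "star_subalgebra (B \<inter> A\<^sub>0)"
    using quotient_star_subalgebra(1) coeff_algebra(1)[OF full] unfolding star_subalgebra_def by blast
  moreover have "\<Phi> ` (B \<inter> A\<^sub>0) \<subseteq> alg_tensor_set (B \<inter> A\<^sub>0) A\<^sub>0"
    using E_coeff_algebra(2) E_quotient by fastforce
  ultimately show "\<exists>B\<^sub>0. star_subalgebra B\<^sub>0 \<and> B\<^sub>0 \<subseteq> B \<and> B \<subseteq> closure B\<^sub>0 \<and> \<Phi> ` B\<^sub>0 \<subseteq> alg_tensor_set B\<^sub>0 A\<^sub>0"
    by blast
qed

section \<open>The Haar state of G on the quotient\<close>

context
  fixes h :: "'g \<Rightarrow> complex"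
  assumes haar_G: "haar_state \<Phi> h"
begin

lemma quotient_ergodic: "ergodic_action \<Phi> B \<Phi>"
  unfolding ergodic_action_def
proof (intro conjI ballI impI quotient_action)
  fix b assume "b \<in> B" "\<Phi> b = b \<otimes> 1"
  then have "h b *\<^sub>C 1 = rslice h (b \<otimes> 1)" using haar_stateD(2)[OF haar_G, of b] by simp
  also have "\<dots> = b" by (simp add: rslice haar_stateD(1)[OF haar_G] state_simps(3))
  finally show "\<exists>c. b = c *\<^sub>C 1" by metis
qed

text \<open>Left invariance of the Haar state, read on \<open>B\<close>. The restriction is the
  extensional representative of the functional, in which form uniqueness is stated.\<close>

lemma haar_invariant: "invariant_state B \<Phi> (restrict h B)"
  unfolding invariant_state_def
proof (intro conjI ballI)
  note h = haar_stateD(1)[OF haar_G]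
  note D = star_subalgebraD[OF quotient_star_subalgebra(1)]
  obtain K where "\<And>x. cmod (h x) \<le> K * norm x" using state_boundedE[OF h] by blast
  then show "state_on B (restrict h B)"
    unfolding state_on_def bounded_clinear_on_def using quotient_star_subalgebra(2)
    by (auto simp: D state_simps[OF h] state_pos[OF h] scaleC_complex_def)
  fix b assume b: "b \<in> B"
  have "slice_left B (restrict h B) UNIV (\<Phi> b) = lslice h (\<Phi> b)"
    unfolding slice_left_def[of B]
    by (rule tensor_lift_eq[OF lslice(1)[OF h] _ Phi_quotient[OF b]]) (simp add: lslice(2)[OF h])
  then show "slice_left B (restrict h B) UNIV (\<Phi> b) = restrict h B b *\<^sub>C 1"
    using b by (simp add: haar_stateD(3)[OF haar_G])
qed

text \<open>A slice by \<omega> is a lift over \<open>B\<close> alone. Extending \<omega> to a state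
  \<psi> of C(G) identifies it with a bounded slice on the full tensor product, where slices may be
  exchanged: applying \<open>h\<close> to the invariance identity gives \<psi> of \<open>h b\<close>
  times the unit.\<close>

lemma invariant_state_eq_haar:
  assumes "invariant_state B \<Phi> \<omega>" "b \<in> B"
  shows "\<omega> b = h b"
proof -
  note h = haar_stateD(1)[OF haar_G]
  obtain \<psi> where \<psi>: "state \<psi>" "\<And>x. x \<in> B \<Longrightarrow> \<psi> x = \<omega> x"
    using state_on_extension[OF quotient_star_subalgebra] assms(1) unfolding invariant_state_def by blast
  have "slice_left B \<omega> UNIV (\<Phi> b) = lslice \<psi> (\<Phi> b)"
    unfolding slice_left_def[of B]
    by (rule tensor_lift_eq[OF lslice(1)[OF \<psi>(1)] _ Phi_quotient[OF assms(2)]]) (simp add: lslice(2)[OF \<psi>(1)] \<psi>(2))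
  then have "lslice \<psi> (\<Phi> b) = \<omega> b *\<^sub>C 1" using assms unfolding invariant_state_def by simp
  then have "\<omega> b = h (lslice \<psi> (\<Phi> b))" by (simp add: state_simps[OF h])
  also have "\<dots> = h b" by (simp add: slice_fubini[OF \<psi>(1) h] haar_stateD(2)[OF haar_G] state_simps[OF \<psi>(1)])
  finally show ?thesis .
qed

lemma haar_E: "h (E a) = h a"
  by (simp add: quotient_expectation_def slice_fubini[OF state_eta haar_stateD(1)[OF haar_G]]
      haar_stateD(2)[OF haar_G] state_simps(2,3)[OF state_eta] del: o_apply)

end

end

text \<open>A state on the quotient algebra is a function on the whole type, so uniqueness is taken
  among \<open>extensional\<close> functions, which are fixed outside the algebra.\<close>

theorem proposition6p1:
  fixes \<Phi>\<^sub>G :: "'g::cstar_algebra \<Rightarrow> ('g, 'g) min_tensor"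
    and \<Phi>\<^sub>H :: "'h::cstar_algebra \<Rightarrow> ('h, 'h) min_tensor"
    and \<theta> :: "'g \<Rightarrow> 'h"
    and h\<^sub>G :: "'g \<Rightarrow> complex" and h\<^sub>H :: "'h \<Rightarrow> complex"
  assumes "full_woronowicz_algebra \<Phi>\<^sub>G" and "full_woronowicz_algebra \<Phi>\<^sub>H"
    and "woronowicz_morphism \<Phi>\<^sub>G \<Phi>\<^sub>H \<theta>" and "surj \<theta>"
    and "haar_state \<Phi>\<^sub>G h\<^sub>G" and "haar_state \<Phi>\<^sub>H h\<^sub>H"
  shows "ergodic_action \<Phi>\<^sub>G (quotient_algebra \<Phi>\<^sub>G \<theta>) \<Phi>\<^sub>G \<and>
    (\<exists>!\<omega>. \<omega> \<in> extensional (quotient_algebra \<Phi>\<^sub>G \<theta>) \<and>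
      invariant_state (quotient_algebra \<Phi>\<^sub>G \<theta>) \<Phi>\<^sub>G \<omega>) \<and>
    (\<forall>\<omega>. \<omega> \<in> extensional (quotient_algebra \<Phi>\<^sub>G \<theta>) \<and>
        invariant_state (quotient_algebra \<Phi>\<^sub>G \<theta>) \<Phi>\<^sub>G \<omega> \<longrightarrow>
      (\<forall>a. slice_left UNIV (h\<^sub>H \<circ> \<theta>) UNIV (\<Phi>\<^sub>G a) \<in> quotient_algebra \<Phi>\<^sub>G \<theta> \<and>
        h\<^sub>G a = \<omega> (slice_left UNIV (h\<^sub>H \<circ> \<theta>) UNIV (\<Phi>\<^sub>G a))) \<and>
      \<omega> = restrict h\<^sub>G (quotient_algebra \<Phi>\<^sub>G \<theta>))"
proof -
  let ?B = "quotient_algebra \<Phi>\<^sub>G \<theta>" and ?E = "quotient_expectation \<Phi>\<^sub>G \<theta> h\<^sub>H"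
  note H = assms(1,3,6) and haar_G = assms(5)
  have eq: "\<omega> = restrict h\<^sub>G ?B" if "\<omega> \<in> extensional ?B" "invariant_state ?B \<Phi>\<^sub>G \<omega>" for \<omega>
    by (rule extensionalityI[OF that(1) restrict_extensional])
      (simp add: invariant_state_eq_haar[OF H haar_G that(2)])
  have "slice_left UNIV (h\<^sub>H \<circ> \<theta>) UNIV (\<Phi>\<^sub>G a) \<in> ?B"
    "restrict h\<^sub>G ?B (slice_left UNIV (h\<^sub>H \<circ> \<theta>) UNIV (\<Phi>\<^sub>G a)) = h\<^sub>G a" for a
    using E_in_quotient[OF H, of a] haar_E[OF H haar_G, of a] unfolding quotient_expectation_def by simp_all
  with eq haar_invariant[OF H haar_G] quotient_ergodic[OF H haar_G] show ?thesis
    by (metis restrict_extensional)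
qed

end
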